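(* Assume that the genus of $\Gamma_0(N)$ is zero and that $n$ is a positive integer relatively prime to $N$. Assume further that $n$ is not a perfect square. Then $$\Phi_n^{\Gamma_0(N)}(X,X)\;=\;(-1)^{\frac12\sigma_0(n)}\;\times\prod_{r\in\mathbb Z,\ |r|<2\sqrt n}H_{r^2-4n,N}(X)\;\times\prod_{s\in S,\ s\not\sim\infty}\bigl(X-j_N(s)\bigr)^{\nu_{s,n,N}},$$ where $S$ is a set of representatives of all the inequivalent cusps of $\Gamma_0(N)$.
   Context: Assume $X_0(N)=\Gamma_0(N)\backslash\mathbb H^*$ has genus zero ($\mathbb H$ is the upper half plane, $\mathbb H^*=\mathbb H\cup\mathbb Q\cup\{\infty\}$). $j_N(\tau)$ denotes the Hauptmodul for $\Gamma_0(N)$, i.e. the generator over $\mathbb C$ of the function field of $X_0(N)$ whose only pole on $X_0(N)$ is a simple pole at $\infty$, normalized so that $j_N(\tau)=q^{-1}+\sum_{m\ge1}c_mq^m$ with $c_m\in\mathbb Z$, $q=e^{2\pi i\tau}$. For a cusp $s\not\sim\infty$ (inequivalent to $\infty$ under $\Gamma_0(N)$), $j_N(s)$ is the value of $j_N$ at that point of $X_0(N)$. For a positive integer $n$, let $\mathrm M_{n,N}=\{\begin{pmatrix}a&b\\c&d\end{pmatrix}\in \mathrm M_2(\mathbb Z): ad-bc=n,\ \gcd(a,N)=1,\ c\equiv0\pmod N\}$ and $$\Phi_n^{\Gamma_0(N)}(X,j_N)=\prod_{[\alpha]\in\Gamma_0(N)\backslash \mathrm M_{n,N}}\bigl(X-j_N(\alpha(\tau))\bigr).$$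 Its coefficients as a polynomial in $X$ lie in $\mathbb C(j_N)$, so this defines $\Phi_n^{\Gamma_0(N)}(X,Y)\in\mathbb C(Y)[X]$; when $\gcd(n,N)=1$ it is a polynomial in $X$ and $Y$. For a negative integer $D$, $\mathrm Q_{D,N}$ is the set of positive definite integral binary quadratic forms $ax^2+bxy+cy^2$ (so $a>0$; primitivity not required) with $b^2-4ac=D$ and $a\equiv0\pmod N$. $\Gamma_0(N)$ acts on it by $(Q\cdot\gamma)(x,y)=Q(\alpha x+\beta y,\gamma'x+\delta y)$ for $\gamma=\begin{pmatrix}\alpha&\beta\\ \gamma'&\delta\end{pmatrix}$. $\tau_Q$ is the unique root in $\mathbb H$ of $Q(x,1)=0$, $\omega_{Q,N}=|\overline\Gamma_0(N)_Q|$ is the order of the stabilizer of $Q$ in $\overline\Gamma_0(N)=\Gamma_0(N)/\{\pm1\}$, and $$H_{D,N}(X)=\prod_{[Q]\in \mathrm Q_{D,N}/\Gamma_0(N)}\bigl(X-j_N(\tau_Q)\bigr)^{1/\omega_{Q,N}}.$$ The exponents may be fractional; in products of the $H_{D,N}(X)$ the powers are treated formally, adding up the exponents of each linear factor $X-x_0$. For a cusp $s=\frac ab\in S$ with $\gcd(a,b)=1$ and $b\ge0$ (with $\frac{\pm1}{0}=\infty$), put $b_s=b$ and $$\nu_{s,n,N}=\sum\min\{d,\,n/d\},$$ the sum being over all positive divisors $d$ of $n$ with $n\equiv d^2\pmod{\gcd(b_s,\,N/\gcd(b_s,N))}$. $\sigma_0(n)$ is the number of positive divisors of $n$. *)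

theory Defs
  imports
    "HOL-Complex_Analysis.Complex_Analysis"
    "HOL-Homology.Homology"
    "HOL-Library.Poly_Mapping"
    "HOL-Number_Theory.Cong"
begin

text \<open>Here \<open>$\<close> always denotes a vector component, never a power series coefficient.\<close>

no_notation fps_nth (infixl "$" 75)

section \<open>The group and its actions\<close>

definition uhp :: "complex set" where
  "uhp = {\<tau>. Im \<tau> > 0}"

definition SL2Z :: "(int^2^2) set" where
  "SL2Z = {A. det A = 1}"

definition Gamma0 :: "nat \<Rightarrow> (int^2^2) set" where
  "Gamma0 N = {A \<in> SL2Z. int N dvd A$2$1}"

definition moebius :: "int^2^2 \<Rightarrow> complex \<Rightarrow> complex" where
  "moebius A \<tau> =
     (of_int (A$1$1) * \<tau> + of_int (A$1$2)) / (of_int (A$2$1) * \<tau> + of_int (A$2$2))"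

text \<open>An element of \<open>\<rat> \<union> {\<infinity>}\<close> is a \<^typ>\<open>rat option\<close>, with \<^term>\<open>None\<close> for \<open>\<infinity>\<close>.\<close>

type_synonym cusp = "rat option"

fun cusp_act :: "int^2^2 \<Rightarrow> cusp \<Rightarrow> cusp" where
  "cusp_act A None = (if A$2$1 = 0 then None else Some (of_int (A$1$1) / of_int (A$2$1)))"
| "cusp_act A (Some x) =
     (if of_int (A$2$1) * x + of_int (A$2$2) = 0 then None
      else Some ((of_int (A$1$1) * x + of_int (A$1$2)) / (of_int (A$2$1) * x + of_int (A$2$2))))"

definition cusp_equiv :: "nat \<Rightarrow> cusp \<Rightarrow> cusp \<Rightarrow> bool" where
  "cusp_equiv N s t \<longleftrightarrow> (\<exists>A\<in>Gamma0 N. t = cusp_act A s)"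

definition cusp_representatives :: "nat \<Rightarrow> cusp set \<Rightarrow> bool" where
  "cusp_representatives N S \<longleftrightarrow> (\<forall>t. \<exists>!s. s \<in> S \<and> cusp_equiv N s t)"

text \<open>The denominator of a cusp in lowest terms, where \<open>\<infinity> = 1/0\<close>.\<close>

fun cusp_denom :: "cusp \<Rightarrow> nat" where
  "cusp_denom None = 0"
| "cusp_denom (Some x) = nat (snd (quotient_of x))"

section \<open>The modular curve and its genus\<close>

type_synonym hpoint = "complex + cusp"

definition hstar_points :: "hpoint set" where
  "hstar_points = Inl ` uhp \<union> range Inr"

fun hstar_act :: "int^2^2 \<Rightarrow> hpoint \<Rightarrow> hpoint" where
  "hstar_act A (Inl \<tau>) = Inl (moebius A \<tau>)"
| "hstar_act A (Inr s) = Inr (cusp_act A s)"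

text \<open>Basic neighbourhoods of the cusp \<open>A \<infinity>\<close>, for \<open>A\<close> in \<^term>\<open>SL2Z\<close>, consist of that cusp
  and the image under \<open>A\<close> of a half plane \<open>Im \<tau> > r\<close>.\<close>

definition hstar_open :: "hpoint set \<Rightarrow> bool" where
  "hstar_open U \<longleftrightarrow>
     U \<subseteq> hstar_points \<and> open {\<tau>. Inl \<tau> \<in> U} \<and>
     (\<forall>A\<in>SL2Z. Inr (cusp_act A None) \<in> U \<longrightarrow>
        (\<exists>r>0. \<forall>\<tau>. Im \<tau> > r \<longrightarrow> Inl (moebius A \<tau>) \<in> U))"

lemma istopology_hstar_open: "istopology hstar_open"
  unfolding istopology_def
proof (intro conjI allI impI)
  fix U V assume U: "hstar_open U" and V: "hstar_open V"
  show "hstar_open (U \<inter> V)"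
    unfolding hstar_open_def
  proof (intro conjI ballI impI)
    show "U \<inter> V \<subseteq> hstar_points" using U unfolding hstar_open_def by blast
    have "{\<tau>. Inl \<tau> \<in> U \<inter> V} = {\<tau>. Inl \<tau> \<in> U} \<inter> {\<tau>. Inl \<tau> \<in> V}" by blast
    then show "open {\<tau>. Inl \<tau> \<in> U \<inter> V}"
      using U V unfolding hstar_open_def by (simp only: open_Int)
    fix A assume A: "A \<in> SL2Z" "Inr (cusp_act A None) \<in> U \<inter> V"
    obtain r where r: "r > 0" "\<forall>\<tau>. Im \<tau> > r \<longrightarrow> Inl (moebius A \<tau>) \<in> U"
      using U A unfolding hstar_open_def by blast
    obtain s where s: "s > 0" "\<forall>\<tau>. Im \<tau> > s \<longrightarrow> Inl (moebius A \<tau>) \<in> V"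
      using V A unfolding hstar_open_def by blast
    from r s show "\<exists>r>0. \<forall>\<tau>. Im \<tau> > r \<longrightarrow> Inl (moebius A \<tau>) \<in> U \<inter> V"
      by (intro exI[of _ "max r s"]) simp
  qed
next
  fix K assume K: "\<forall>U\<in>K. hstar_open U"
  show "hstar_open (\<Union>K)"
    unfolding hstar_open_def
  proof (intro conjI ballI impI)
    show "\<Union>K \<subseteq> hstar_points" using K unfolding hstar_open_def by blast
    have "{\<tau>. Inl \<tau> \<in> \<Union>K} = (\<Union>U\<in>K. {\<tau>. Inl \<tau> \<in> U})" by blast
    moreover have "open (\<Union>U\<in>K. {\<tau>. Inl \<tau> \<in> U})"
      by (rule open_UN) (use K in \<open>simp add: hstar_open_def\<close>)
    ultimately show "open {\<tau>. Inl \<tau> \<in> \<Union>K}" by (simp only:)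
    fix A assume A: "A \<in> SL2Z" "Inr (cusp_act A None) \<in> \<Union>K"
    then obtain U where U: "U \<in> K" "Inr (cusp_act A None) \<in> U" by blast
    then obtain r where "r > 0" "\<forall>\<tau>. Im \<tau> > r \<longrightarrow> Inl (moebius A \<tau>) \<in> U"
      using K A unfolding hstar_open_def by blast
    with U show "\<exists>r>0. \<forall>\<tau>. Im \<tau> > r \<longrightarrow> Inl (moebius A \<tau>) \<in> \<Union>K" by blast
  qed
qed

definition hstar :: "hpoint topology" where
  "hstar = topology hstar_open"

lemma openin_hstar: "openin hstar U \<longleftrightarrow> hstar_open U"
  by (simp add: hstar_def istopology_hstar_open)

definition quotient_space :: "'a topology \<Rightarrow> ('a \<times> 'a) set \<Rightarrow> 'a set topology" where
  "quotient_space X R =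
     topology (\<lambda>V. V \<subseteq> topspace X // R \<and> openin X {x \<in> topspace X. R `` {x} \<in> V})"

lemma openin_quotient_space:
  "openin (quotient_space X R) V \<longleftrightarrow>
     V \<subseteq> topspace X // R \<and> openin X {x \<in> topspace X. R `` {x} \<in> V}"
proof -
  have "istopology (\<lambda>V. V \<subseteq> topspace X // R \<and> openin X {x \<in> topspace X. R `` {x} \<in> V})"
    unfolding istopology_def
  proof (intro conjI allI impI)
    fix U V
    assume "U \<subseteq> topspace X // R \<and> openin X {x \<in> topspace X. R `` {x} \<in> U}"
      and "V \<subseteq> topspace X // R \<and> openin X {x \<in> topspace X. R `` {x} \<in> V}"
    moreover have "{x \<in> topspace X. R `` {x} \<in> U \<inter> V} =
        {x \<in> topspace X. R `` {x} \<in> U} \<inter> {x \<in> topspace X. R `` {x} \<in> V}" by auto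
    ultimately show "U \<inter> V \<subseteq> topspace X // R"
      and "openin X {x \<in> topspace X. R `` {x} \<in> U \<inter> V}" by auto
  next
    fix K assume K: "\<forall>V\<in>K. V \<subseteq> topspace X // R \<and> openin X {x \<in> topspace X. R `` {x} \<in> V}"
    then show "\<Union>K \<subseteq> topspace X // R" by blast
    have "{x \<in> topspace X. R `` {x} \<in> \<Union>K} = (\<Union>V\<in>K. {x \<in> topspace X. R `` {x} \<in> V})" by auto
    then show "openin X {x \<in> topspace X. R `` {x} \<in> \<Union>K}" using K by auto
  qed
  then show ?thesis by (simp add: quotient_space_def)
qed

definition X0 :: "nat \<Rightarrow> hpoint set topology" where
  "X0 N = quotient_space hstar
     {(x, y). x \<in> hstar_points \<and> y \<in> hstar_points \<and> (\<exists>A\<in>Gamma0 N. y = hstar_act A x)}"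

text \<open>A compact Riemann surface has genus \<open>g\<close> when its first integral homology group is free
  abelian of rank \<open>2 g\<close>.\<close>

definition has_genus :: "'a topology \<Rightarrow> nat \<Rightarrow> bool" where
  "has_genus X g \<longleftrightarrow> homology_group 1 X \<cong> free_Abelian_group {..<2 * g}"

section \<open>Modular functions and the Hauptmodul\<close>

abbreviation at_i_infinity :: "complex filter" where
  "at_i_infinity \<equiv> filtercomap Im at_top"

text \<open>Meromorphy at the cusp \<open>A \<infinity>\<close> is expressed in the parameter \<open>exp (2 \<pi> \<i> \<tau> / N)\<close>; this suffices
  because the width of every cusp of \<^term>\<open>Gamma0 N\<close> divides \<open>N\<close>.\<close>

definition modular_function :: "nat \<Rightarrow> (complex \<Rightarrow> complex) \<Rightarrow> bool" where
  "modular_function N f \<longleftrightarrow>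
     f meromorphic_on uhp \<and>
     (\<forall>A\<in>Gamma0 N. \<forall>\<tau>\<in>uhp. f (moebius A \<tau>) = f \<tau>) \<and>
     (\<forall>A\<in>SL2Z. \<exists>F. F meromorphic_on {0} \<and>
        (\<forall>\<^sub>F \<tau> in at_i_infinity. f (moebius A \<tau>) = F (exp (2 * of_real pi * \<i> * \<tau> / of_nat N))))"

definition generates_function_field :: "nat \<Rightarrow> (complex \<Rightarrow> complex) \<Rightarrow> bool" where
  "generates_function_field N j \<longleftrightarrow>
     modular_function N j \<and>
     (\<forall>f. modular_function N f \<longrightarrow>
        (\<exists>P Q :: complex poly. Q \<noteq> 0 \<and> (\<forall>\<^sub>\<approx>\<tau>\<in>uhp. f \<tau> = poly P (j \<tau>) / poly Q (j \<tau>))))"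

text \<open>In the last conjunct \<open>c m\<close> is the coefficient of \<open>q\<close> to the power \<open>m + 1\<close>; the expansion
  also makes the pole at \<open>\<infinity>\<close> simple.\<close>

definition hauptmodul :: "nat \<Rightarrow> (complex \<Rightarrow> complex) \<Rightarrow> bool" where
  "hauptmodul N j \<longleftrightarrow>
     generates_function_field N j \<and>
     j holomorphic_on uhp \<and>
     (\<forall>A\<in>SL2Z. \<not> cusp_equiv N None (cusp_act A None) \<longrightarrow>
        (\<exists>L. tendsto (\<lambda>\<tau>. j (moebius A \<tau>)) L at_i_infinity)) \<and>
     (\<exists>c :: nat \<Rightarrow> int. \<forall>\<tau>\<in>uhp. let q = exp (2 * of_real pi * \<i> * \<tau>) in
        (\<lambda>m. of_int (c m) * q ^ Suc m) sums (j \<tau> - inverse q))"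

definition cusp_value :: "(complex \<Rightarrow> complex) \<Rightarrow> cusp \<Rightarrow> complex" where
  "cusp_value f s =
     (THE L. \<exists>A\<in>SL2Z. cusp_act A None = s \<and> tendsto (\<lambda>\<tau>. f (moebius A \<tau>)) L at_i_infinity)"

section \<open>The modular polynomial\<close>

definition hecke_matrices :: "nat \<Rightarrow> nat \<Rightarrow> (int^2^2) set" where
  "hecke_matrices N n = {A. det A = int n \<and> coprime (A$1$1) (int N) \<and> int N dvd A$2$1}"

definition hecke_cosets :: "nat \<Rightarrow> nat \<Rightarrow> (int^2^2) set set" where
  "hecke_cosets N n = hecke_matrices N n //
     {(A, B). A \<in> hecke_matrices N n \<and> B \<in> hecke_matrices N n \<and> (\<exists>C\<in>Gamma0 N. B = C ** A)}"

text \<open>\<open>\<Phi>(X, Y)\<close> as a polynomial in \<open>X\<close> whose coefficients are polynomials in \<open>Y\<close>, for \<open>n\<close> coprime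
  to \<open>N\<close>: it is characterised by its specialisations at \<open>Y = j \<tau>\<close>.\<close>

definition modular_poly :: "nat \<Rightarrow> nat \<Rightarrow> (complex \<Rightarrow> complex) \<Rightarrow> complex poly poly" where
  "modular_poly N n j =
     (THE \<Phi>. \<forall>\<tau>\<in>uhp. map_poly (\<lambda>c. poly c (j \<tau>)) \<Phi> =
        (\<Prod>K\<in>hecke_cosets N n. [:- j (moebius (SOME A. A \<in> K) \<tau>), 1:]))"

text \<open>The substitution of \<open>X\<close> for both variables.\<close>

definition diagonal :: "'a::comm_semiring_1 poly poly \<Rightarrow> 'a poly" where
  "diagonal \<Phi> = poly \<Phi> [:0, 1:]"

section \<open>Binary quadratic forms and class polynomials\<close>

text \<open>The triple \<open>(a, b, c)\<close> is the form \<open>a x\<^sup>2 + b x y + c y\<^sup>2\<close>.\<close>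

type_synonym bqf = "int \<times> int \<times> int"

fun bqf_eval :: "bqf \<Rightarrow> int \<Rightarrow> int \<Rightarrow> int" where
  "bqf_eval (a, b, c) x y = a * x\<^sup>2 + b * x * y + c * y\<^sup>2"

fun bqf_disc :: "bqf \<Rightarrow> int" where
  "bqf_disc (a, b, c) = b\<^sup>2 - 4 * a * c"

definition bqf_pos_def :: "bqf \<Rightarrow> bool" where
  "bqf_pos_def Q \<longleftrightarrow> (\<forall>x y. (x, y) \<noteq> (0, 0) \<longrightarrow> bqf_eval Q x y > 0)"

definition bqf_act :: "bqf \<Rightarrow> int^2^2 \<Rightarrow> bqf" where
  "bqf_act Q A = (case Q of (a, b, c) \<Rightarrow>
     (a * (A$1$1)\<^sup>2 + b * A$1$1 * A$2$1 + c * (A$2$1)\<^sup>2,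
      2 * a * A$1$1 * A$1$2 + b * (A$1$1 * A$2$2 + A$1$2 * A$2$1) + 2 * c * A$2$1 * A$2$2,
      a * (A$1$2)\<^sup>2 + b * A$1$2 * A$2$2 + c * (A$2$2)\<^sup>2))"

lemma bqf_eval_act:
  "bqf_eval (bqf_act Q A) x y = bqf_eval Q (A$1$1 * x + A$1$2 * y) (A$2$1 * x + A$2$2 * y)"
proof (cases Q)
  case (fields a b c)
  show ?thesis unfolding fields bqf_act_def prod.case bqf_eval.simps
    by (simp add: power2_eq_square algebra_simps)
qed

definition bqfs :: "nat \<Rightarrow> int \<Rightarrow> bqf set" where
  "bqfs N D = {Q. bqf_pos_def Q \<and> bqf_disc Q = D \<and> int N dvd fst Q}"

definition bqf_classes :: "nat \<Rightarrow> int \<Rightarrow> bqf set set" where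
  "bqf_classes N D = bqfs N D //
     {(Q, Q'). Q \<in> bqfs N D \<and> Q' \<in> bqfs N D \<and> (\<exists>A\<in>Gamma0 N. Q' = bqf_act Q A)}"

fun bqf_root :: "bqf \<Rightarrow> complex" where
  "bqf_root (a, b, c) = (THE \<tau>. \<tau> \<in> uhp \<and> of_int a * \<tau>\<^sup>2 + of_int b * \<tau> + of_int c = 0)"

definition bqf_stab :: "nat \<Rightarrow> bqf \<Rightarrow> (int^2^2) set" where
  "bqf_stab N Q = {A \<in> Gamma0 N. bqf_act Q A = Q}"

text \<open>The order of the stabilizer in the quotient of \<^term>\<open>Gamma0 N\<close> by \<open>\<plusminus>1\<close>.\<close>

definition bqf_weight :: "nat \<Rightarrow> bqf \<Rightarrow> nat" where
  "bqf_weight N Q =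
     card (bqf_stab N Q // {(A, B). A \<in> bqf_stab N Q \<and> B \<in> bqf_stab N Q \<and> (B = A \<or> B = - A)})"

text \<open>A formal product of rational powers of linear factors \<open>X - x\<close> is represented by the finitely
  supported function sending \<open>x\<close> to its exponent. Multiplying such products adds exponents, so
  products of them are sums here. When all exponents are natural numbers, \<open>linear_powers\<close> is the
  polynomial that is represented.\<close>

definition class_poly :: "nat \<Rightarrow> (complex \<Rightarrow> complex) \<Rightarrow> int \<Rightarrow> complex \<Rightarrow>\<^sub>0 rat" where
  "class_poly N j D =
     (\<Sum>K\<in>bqf_classes N D. let Q = (SOME Q. Q \<in> K) in
        Poly_Mapping.single (j (bqf_root Q)) (1 / of_nat (bqf_weight N Q)))"

definition natural_exponents :: "(complex \<Rightarrow>\<^sub>0 rat) \<Rightarrow> bool" where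
  "natural_exponents e \<longleftrightarrow> (\<forall>x. Poly_Mapping.lookup e x \<in> \<nat>)"

definition linear_powers :: "(complex \<Rightarrow>\<^sub>0 rat) \<Rightarrow> complex poly" where
  "linear_powers e =
     (\<Prod>x\<in>Poly_Mapping.keys e. [:- x, 1:] ^ nat \<lfloor>Poly_Mapping.lookup e x\<rfloor>)"

definition cusp_exponent :: "cusp \<Rightarrow> nat \<Rightarrow> nat \<Rightarrow> nat" where
  "cusp_exponent s n N =
     (let g = gcd (cusp_denom s) N in
      \<Sum>d | d dvd n \<and> [n = d\<^sup>2] (mod gcd (cusp_denom s) (N div g)). min d (n div d))"

end

theory Submission
  imports Defs "HOL-Computational_Algebra.Fundamental_Theorem_Algebra"
begin

text \<open>
  Write \<open>D(X) = \<Phi>(X, X)\<close>. Specialising at \<open>X = j \<tau>\<close> gives \<open>D(j \<tau>) = \<Prod> (j \<tau> - j (\<alpha> \<tau>))\<close>, the product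
  running over the Hecke cosets \<open>\<Gamma>\<^sub>0(N) \<alpha>\<close>. A complex polynomial is determined by its leading
  coefficient and the multiplicities of its roots, and both can be read off from this product,
  because \<open>j\<close> is a bijection from the compactified modular curve onto the Riemann sphere: every
  complex number is the value of \<open>j\<close> at exactly one orbit of points or at exactly one finite cusp.

  The bijection (\<open>j_surjective\<close>, \<open>j_injective\<close>, \<open>cusp_values_distinct\<close>, \<open>cusp_value_not_attained\<close>) rests
  on compactness of the curve. Surjectivity is Liouville's theorem on the curve applied to
  \<open>1 / (j - c)\<close>. For injectivity, the values taken twice form an open bounded set, by the open mapping
  theorem and the simple pole at infinity; compactness makes it closed away from countably many
  values, and a plane with countably many points removed is connected. Liouville's theorem also shows
  that invariant functions with poles at infinity only are polynomials in \<open>j\<close> (\<open>polynomial_in_j\<close>), which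
  gives the existence of \<open>\<Phi>\<close> (\<open>modular_poly_spec\<close>).

  At a point \<open>\<tau>\<^sub>0\<close> let \<open>m\<close> be the vanishing order of \<open>j - j \<tau>\<^sub>0\<close>. A factor with \<open>\<alpha> \<tau>\<^sub>0 = \<tau>\<^sub>0\<close> behaves
  like \<open>(1 - \<zeta>\<^sup>m) (\<tau> - \<tau>\<^sub>0)\<^sup>m\<close>, where \<open>\<zeta>\<close> is the derivative of \<open>\<alpha>\<close> at \<open>\<tau>\<^sub>0\<close>. If \<open>\<zeta>\<^sup>m\<close> were \<open>1\<close>, then \<open>\<zeta>\<close> would
  be the derivative of an element of the stabilizer as well, and comparing the two matrices would
  make \<open>\<surd>n\<close> rational. So the order of \<open>D\<close> at \<open>j \<tau>\<^sub>0\<close> is the number of cosets with a representative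
  fixing \<open>\<tau>\<^sub>0\<close> (\<open>order_at_point\<close>). Such representatives are, up to sign, the same as pairs of a trace \<open>r\<close>
  and a form of discriminant \<open>r\<^sup>2 - 4 n\<close> with root \<open>\<tau>\<^sub>0\<close> (\<open>card_fixing_matrices_forms\<close>). Each coset contains
  as many of them as the stabilizer has elements, which produces the weights \<open>1 / \<omega>\<close>.

  At a cusp \<open>A \<infinity>\<close> with finite value the same comparison is made with exponentials: the factor
  of a coset represented by \<open>A (a b; 0 d) A\<^sup>-\<^sup>1\<close> vanishes to order \<open>min 1 (a / d)\<close> times that of
  \<open>j - j(A \<infinity>)\<close>, and for each divisor \<open>d\<close> of \<open>n\<close> there are \<open>d\<close> such cosets or none, according to a
  congruence (\<open>order_at_cusp_eq_exponent\<close>). At infinity every coset has a representative \<open>(a b; 0 d)\<close>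
  with \<open>0 \<le> b < d\<close>. The factors with \<open>a > d\<close> contribute \<open>- exp (- 2 \<pi> \<i> b / d)\<close> to the leading
  coefficient, the others \<open>1\<close>; the product over \<open>b\<close> is \<open>- 1\<close>, whence the sign. That \<open>n\<close> is not a square
  excludes \<open>a = d\<close> throughout.
\<close>

section \<open>Integral matrices of size two and their action\<close>

definition M2 :: "int \<Rightarrow> int \<Rightarrow> int \<Rightarrow> int \<Rightarrow> int^2^2" where
  "M2 a b c d = vector [vector [a, b], vector [c, d]]"

lemma M2_nth [simp]:
  "M2 a b c d $ 1 $ 1 = a" "M2 a b c d $ 1 $ 2 = b" "M2 a b c d $ 2 $ 1 = c" "M2 a b c d $ 2 $ 2 = d"
  by (simp_all add: M2_def)

lemma mat2_eq_iff:
  "A = B \<longleftrightarrow> A$1$1 = B$1$1 \<and> A$1$2 = B$1$2 \<and> A$2$1 = B$2$1 \<and> A$2$2 = B$2$2"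
  for A B :: "int^2^2"
  by (auto simp: vec_eq_iff forall_2)

lemma matmul_nth: "(A ** B) $ i $ k = A$i$1 * B$1$k + A$i$2 * B$2$k" for A B :: "int^2^2"
  by (simp add: matrix_matrix_mult_def sum_2)

lemma mat_nth [simp]: "(mat k :: int^2^2) $ 1 $ 1 = k" "(mat k :: int^2^2) $ 1 $ 2 = 0"
  "(mat k :: int^2^2) $ 2 $ 1 = 0" "(mat k :: int^2^2) $ 2 $ 2 = k"
  by (simp_all add: mat_def)

lemma det_M2 [simp]: "det (M2 a b c d) = a * d - b * c"
  by (simp add: det_2)

lemma M2_eta: "M2 (A$1$1) (A$1$2) (A$2$1) (A$2$2) = A"
  by (simp add: mat2_eq_iff)

text \<open>The adjugate is an inverse up to the determinant and keeps the entries integral; it serves as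
  the inverse in the group and as the dual Hecke matrix.\<close>

definition adj2 :: "int^2^2 \<Rightarrow> int^2^2" where
  "adj2 A = M2 (A$2$2) (- A$1$2) (- A$2$1) (A$1$1)"

lemma adj2_nth [simp]: "adj2 A $ 1 $ 1 = A$2$2" "adj2 A $ 1 $ 2 = - A$1$2"
  "adj2 A $ 2 $ 1 = - A$2$1" "adj2 A $ 2 $ 2 = A$1$1"
  by (simp_all add: adj2_def)

lemma det_adj2 [simp]: "det (adj2 A) = det A"
  by (simp add: det_2)

lemma adj2_mult: "adj2 A ** A = mat (det A)" "A ** adj2 A = mat (det A)"
  by (simp_all add: mat2_eq_iff matmul_nth det_2 algebra_simps)

lemma adj2_matmul: "adj2 (A ** B) = adj2 B ** adj2 A"
  by (simp add: mat2_eq_iff matmul_nth algebra_simps)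

lemma adj2_adj2 [simp]: "adj2 (adj2 A) = A"
  by (simp add: mat2_eq_iff)

lemma adj2_cancel:
  assumes "det A = 1"
  shows "adj2 A ** (A ** B) = B" "A ** (adj2 A ** B) = B" "(B ** A) ** adj2 A = B" "(B ** adj2 A) ** A = B"
  using assms by (simp_all add: matrix_mul_assoc adj2_mult)
     (simp_all add: matrix_mul_assoc[symmetric] adj2_mult)

lemma matmul_uminus: "(- A) ** B = - (A ** B)" "A ** (- B) = - (A ** B)" for A B :: "int^2^2"
  by (simp_all add: mat2_eq_iff matmul_nth)

lemma SL2Z_mult: "A \<in> SL2Z \<Longrightarrow> B \<in> SL2Z \<Longrightarrow> A ** B \<in> SL2Z"
  by (simp add: SL2Z_def det_mul)

lemma SL2Z_adj2: "A \<in> SL2Z \<Longrightarrow> adj2 A \<in> SL2Z"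
  by (simp add: SL2Z_def)

lemma SL2Z_one: "mat 1 \<in> SL2Z"
  by (simp add: SL2Z_def)

lemma SL2Z_uminus: "A \<in> SL2Z \<Longrightarrow> - A \<in> SL2Z"
  by (simp add: SL2Z_def det_2)

lemma Gamma0_SL2Z: "A \<in> Gamma0 N \<Longrightarrow> A \<in> SL2Z"
  by (simp add: Gamma0_def)

lemma Gamma0_mult: "A \<in> Gamma0 N \<Longrightarrow> B \<in> Gamma0 N \<Longrightarrow> A ** B \<in> Gamma0 N"
  by (simp add: Gamma0_def SL2Z_mult matmul_nth)

lemma Gamma0_adj2: "A \<in> Gamma0 N \<Longrightarrow> adj2 A \<in> Gamma0 N"
  by (simp add: Gamma0_def SL2Z_adj2)

lemma Gamma0_one: "mat 1 \<in> Gamma0 N"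
  by (simp add: Gamma0_def SL2Z_one)

lemma Gamma0_uminus: "A \<in> Gamma0 N \<Longrightarrow> - A \<in> Gamma0 N"
  by (simp add: Gamma0_def SL2Z_uminus)

lemma SL2Z_det: "A \<in> SL2Z \<Longrightarrow> det A = 1"
  by (simp add: SL2Z_def)

lemma Gamma0_det: "A \<in> Gamma0 N \<Longrightarrow> det A = 1"
  by (simp add: Gamma0_def SL2Z_def)

lemma Gamma0_cancel:
  assumes "G \<in> Gamma0 N"
  shows "adj2 G ** (G ** B) = B" "G ** (adj2 G ** B) = (B :: int^2^2)"
  using adj2_cancel[OF Gamma0_det[OF assms]] by simp_all

definition transl :: "int \<Rightarrow> int^2^2" where
  "transl k = M2 1 k 0 1"

lemma transl_nth [simp]: "transl k $ 1 $ 1 = 1" "transl k $ 1 $ 2 = k" "transl k $ 2 $ 1 = 0" "transl k $ 2 $ 2 = 1"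
  by (simp_all add: transl_def)

lemma transl_SL2Z: "transl k \<in> SL2Z"
  by (simp add: SL2Z_def transl_def)

lemma transl_Gamma0: "transl k \<in> Gamma0 N"
  by (simp add: Gamma0_def transl_SL2Z)

subsection \<open>The upper half plane\<close>

text \<open>The automorphy factor: \<open>moebius A\<close> has derivative \<open>det A / (den A)\<^sup>2\<close>, which \<open>moebius_diff\<close>
  expresses without derivatives.\<close>

definition den :: "int^2^2 \<Rightarrow> complex \<Rightarrow> complex" where
  "den A \<tau> = of_int (A$2$1) * \<tau> + of_int (A$2$2)"

lemma open_uhp: "open uhp"
  unfolding uhp_def by (simp add: open_halfspace_Im_gt)

lemma convex_uhp: "convex uhp"
  unfolding uhp_def by (simp add: convex_halfspace_Im_gt)

lemma connected_uhp: "connected uhp"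
  using convex_uhp by (rule convex_connected)

lemma lin_nonzero:
  assumes "\<tau> \<in> uhp" "(c, d) \<noteq> (0, 0)"
  shows "of_int c * \<tau> + of_int d \<noteq> 0"
proof
  assume eq: "of_int c * \<tau> + of_int d = 0"
  then have "Im (of_int c * \<tau> + of_int d) = 0" by simp
  then have "of_int c * Im \<tau> = 0" by simp
  with assms have "c = 0" by (simp add: uhp_def)
  with eq assms show False by simp
qed

lemma den_nonzero:
  assumes "\<tau> \<in> uhp" "det A \<noteq> 0"
  shows "den A \<tau> \<noteq> 0"
  unfolding den_def using assms by (intro lin_nonzero) (auto simp: det_2)

lemma moebius_den: "moebius A \<tau> = (of_int (A$1$1) * \<tau> + of_int (A$1$2)) / den A \<tau>"
  by (simp add: moebius_def den_def)

lemma Im_moebius: "Im (moebius A \<tau>) = of_int (det A) * Im \<tau> / (cmod (den A \<tau>))\<^sup>2"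
proof -
  have "Im ((of_int (A$1$1) * \<tau> + of_int (A$1$2)) * cnj (den A \<tau>)) = of_int (det A) * Im \<tau>"
    by (simp add: den_def det_2 algebra_simps)
  then show ?thesis
    unfolding moebius_den by (simp add: complex_div_cnj[of _ "den A \<tau>"] Im_divide_of_real flip: of_real_power)
qed

lemma moebius_in_uhp:
  assumes "\<tau> \<in> uhp" "det A > 0"
  shows "moebius A \<tau> \<in> uhp"
  using assms den_nonzero[of \<tau> A] unfolding uhp_def by (simp add: Im_moebius)

lemma moebius_in_uhp_SL2Z: "\<tau> \<in> uhp \<Longrightarrow> A \<in> SL2Z \<Longrightarrow> moebius A \<tau> \<in> uhp"
  by (rule moebius_in_uhp) (simp_all add: SL2Z_def)

lemma moebius_in_uhp_Gamma0: "\<tau> \<in> uhp \<Longrightarrow> A \<in> Gamma0 N \<Longrightarrow> moebius A \<tau> \<in> uhp"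
  by (rule moebius_in_uhp_SL2Z) (simp_all add: Gamma0_SL2Z)

lemma den_mult:
  assumes "\<tau> \<in> uhp" "det B \<noteq> 0"
  shows "den (A ** B) \<tau> = den A (moebius B \<tau>) * den B \<tau>"
  using den_nonzero[OF assms] unfolding moebius_den
  by (simp add: den_def[of A] den_def[of "A ** B"] matmul_nth field_simps)
     (simp add: den_def algebra_simps)

lemma moebius_mult:
  assumes "\<tau> \<in> uhp" "det B \<noteq> 0"
  shows "moebius (A ** B) \<tau> = moebius A (moebius B \<tau>)"
proof -
  have "(of_int ((A ** B)$1$1) * \<tau> + of_int ((A ** B)$1$2)) =
      (of_int (A$1$1) * moebius B \<tau> + of_int (A$1$2)) * den B \<tau>"
    using den_nonzero[OF assms] unfolding moebius_den
    by (simp add: matmul_nth field_simps) (simp add: den_def algebra_simps)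
  then show ?thesis
    using den_nonzero[OF assms]
    by (simp add: moebius_den[of "A ** B"] moebius_den[of A] den_mult[OF assms])
qed

lemma moebius_mat [simp]: "k \<noteq> 0 \<Longrightarrow> moebius (mat k) \<tau> = \<tau>"
  by (simp add: moebius_def)

lemma moebius_uminus [simp]: "moebius (- A) \<tau> = moebius A \<tau>"
proof -
  have "moebius (- A) \<tau> = (- (of_int (A$1$1) * \<tau> + of_int (A$1$2))) / (- (of_int (A$2$1) * \<tau> + of_int (A$2$2)))"
    unfolding moebius_def by (simp add: algebra_simps)
  then show ?thesis by (simp only: moebius_def) (simp only: minus_divide_left[symmetric] minus_divide_right[symmetric] minus_minus)
qed

lemma moebius_transl [simp]: "moebius (transl k) \<tau> = \<tau> + of_int k"
  by (simp add: moebius_def)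

lemma moebius_adj2:
  assumes "\<tau> \<in> uhp" "det A \<noteq> 0"
  shows "moebius (adj2 A) (moebius A \<tau>) = \<tau>" "moebius A (moebius (adj2 A) \<tau>) = \<tau>"
  using assms by (simp_all add: moebius_mult[symmetric] adj2_mult)

lemma moebius_diff:
  assumes "\<tau> \<in> uhp" "\<tau>' \<in> uhp" "det A \<noteq> 0"
  shows "moebius A \<tau> - moebius A \<tau>' = of_int (det A) * (\<tau> - \<tau>') / (den A \<tau> * den A \<tau>')"
proof -
  have "(moebius A \<tau> - moebius A \<tau>') * (den A \<tau> * den A \<tau>') = of_int (det A) * (\<tau> - \<tau>')"
    using den_nonzero[OF assms(1,3)] den_nonzero[OF assms(2,3)] unfolding moebius_den
    by (simp add: field_simps) (simp add: den_def det_2 algebra_simps)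
  then show ?thesis
    using den_nonzero[OF assms(1,3)] den_nonzero[OF assms(2,3)] by (simp add: field_simps)
qed

lemma holomorphic_den [holomorphic_intros]: "den A holomorphic_on S"
  unfolding den_def[abs_def] by (intro holomorphic_intros)

lemma holomorphic_moebius: "det A \<noteq> 0 \<Longrightarrow> moebius A holomorphic_on uhp"
  unfolding moebius_den[abs_def] using den_nonzero
  by (intro holomorphic_intros) auto

lemma holomorphic_compose_moebius:
  assumes "f holomorphic_on uhp" "det A > 0"
  shows "(\<lambda>\<tau>. f (moebius A \<tau>)) holomorphic_on uhp"
  using holomorphic_on_compose_gen[OF holomorphic_moebius assms(1), of A] moebius_in_uhp assms(2)
  by (simp add: o_def image_subset_iff)

lemma continuous_moebius: "det A \<noteq> 0 \<Longrightarrow> \<tau> \<in> uhp \<Longrightarrow> isCont (moebius A) \<tau>"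
  using holomorphic_moebius[THEN holomorphic_on_imp_continuous_on] open_uhp
  by (simp add: continuous_on_eq_continuous_at)

subsection \<open>The action on cusps\<close>

text \<open>Homogeneous coordinates on the projective line over the rationals. They turn the case
  distinctions in the action on cusps into linear algebra.\<close>

definition proj :: "int \<Rightarrow> int \<Rightarrow> cusp" where
  "proj p q = (if q = 0 then None else Some (of_int p / of_int q))"

lemma cusp_act_proj:
  assumes "(p, q) \<noteq> (0, 0)" "det A \<noteq> 0"
  shows "cusp_act A (proj p q) = proj (A$1$1 * p + A$1$2 * q) (A$2$1 * p + A$2$2 * q)"
proof (cases "q = 0")
  case True
  with assms show ?thesis by (auto simp: proj_def)
next
  case False
  have *: "x * (of_int p / of_int q) + y = (x * of_int p + y * of_int q) / of_int q" for x y :: rat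
    using False by (simp add: field_simps)
  have "(of_int (A$2$1) * of_int p + of_int (A$2$2) * of_int q = (0::rat)) \<longleftrightarrow> A$2$1 * p + A$2$2 * q = 0"
    by (simp flip: of_int_mult of_int_add)
  moreover have "proj p q = Some (of_int p / of_int q)"
    using False by (simp add: proj_def)
  ultimately show ?thesis
    using False by (simp only: cusp_act.simps *) (simp add: proj_def)
qed

lemma cusp_cases:
  obtains p q where "s = proj p q" "coprime p q" "q \<ge> 0" "cusp_denom s = nat q"
proof (cases s)
  case None
  then show ?thesis using that[of 1 0] by (simp add: proj_def)
next
  case (Some x)
  obtain p q where pq: "quotient_of x = (p, q)" by force
  then have "q > 0" "coprime p q" "x = of_int p / of_int q"
    using quotient_of_denom_pos quotient_of_coprime quotient_of_div by blast+
  then show ?thesis using that[of p q] Some pq by (simp add: proj_def)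
qed

lemma matrix_column_exists:
  assumes "coprime p q"
  obtains A where "A \<in> SL2Z" "A$1$1 = p" "A$2$1 = q"
proof -
  obtain u v where "u * p + v * q = 1"
    using bezout_int[of p q] assms by auto
  then show ?thesis using that[of "M2 p (-v) q u"] by (simp add: SL2Z_def algebra_simps)
qed

lemma cusp_act_None: "cusp_act A None = proj (A$1$1) (A$2$1)"
  by (simp add: proj_def)

lemma det_nonzero_col: "det A \<noteq> 0 \<Longrightarrow> (A$1$1, A$2$1) \<noteq> (0, 0)" for A :: "int^2^2"
  by (auto simp: det_2)

lemma cusp_act_mult_None:
  assumes "det A \<noteq> 0" "det B \<noteq> 0"
  shows "cusp_act (A ** B) None = cusp_act A (cusp_act B None)"
  unfolding cusp_act_None
  by (subst cusp_act_proj[OF det_nonzero_col]) (use assms in \<open>simp_all add: matmul_nth\<close>)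

lemma cusp_eq_matrix:
  obtains A where "A \<in> SL2Z" "s = cusp_act A None" "A$2$1 \<ge> 0" "cusp_denom s = nat (A$2$1)"
proof -
  obtain p q where pq: "s = proj p q" "coprime p q" "q \<ge> 0" "cusp_denom s = nat q"
    by (rule cusp_cases)
  obtain A where "A \<in> SL2Z" "A$1$1 = p" "A$2$1 = q"
    using matrix_column_exists[OF pq(2)] .
  with pq that show ?thesis by (simp only: cusp_act_None)
qed

lemma cusp_act_mult:
  assumes "det A \<noteq> 0" "det B \<noteq> 0"
  shows "cusp_act (A ** B) s = cusp_act A (cusp_act B s)"
proof -
  obtain C where "C \<in> SL2Z" "s = cusp_act C None" using cusp_eq_matrix .
  then show ?thesis
    using assms by (simp add: cusp_act_mult_None[symmetric] det_mul SL2Z_det matrix_mul_assoc del: cusp_act.simps)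
qed

lemma cusp_act_mat: 
  assumes "k \<noteq> 0"
  shows "cusp_act (mat k) s = s"
  using assms by (cases s) auto

lemma cusp_equiv_matrix_iff:
  assumes "det A \<noteq> 0" "det B = 1"
  shows "cusp_act A None = cusp_act B None \<longleftrightarrow> (adj2 B ** A)$2$1 = 0"
proof -
  have "(adj2 B ** A)$2$1 = 0 \<longleftrightarrow> cusp_act (adj2 B ** A) None = None" by simp
  also have "\<dots> \<longleftrightarrow> cusp_act (adj2 B) (cusp_act A None) = None"
    using assms by (subst cusp_act_mult) auto
  also have "\<dots> \<longleftrightarrow> cusp_act A None = cusp_act B None"
  proof
    assume "cusp_act (adj2 B) (cusp_act A None) = None"
    then have "cusp_act B (cusp_act (adj2 B) (cusp_act A None)) = cusp_act B None" by (simp only:)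
    then show "cusp_act A None = cusp_act B None"
      using assms by (subst (asm) cusp_act_mult[symmetric]) (auto simp: adj2_mult cusp_act_mat simp del: cusp_act.simps)
  next
    assume "cusp_act A None = cusp_act B None"
    then have "cusp_act (adj2 B) (cusp_act A None) = cusp_act (adj2 B) (cusp_act B None)" by (simp only:)
    also have "\<dots> = None" using assms by (subst cusp_act_mult[symmetric]) (auto simp: adj2_mult cusp_act_mat simp del: cusp_act.simps)
    finally show "cusp_act (adj2 B) (cusp_act A None) = None" .
  qed
  finally show ?thesis by blast
qed

lemma cusp_equiv_refl: "cusp_equiv N s s"
  unfolding cusp_equiv_def by (rule bexI[OF _ Gamma0_one]) (simp add: cusp_act_mat)

lemma cusp_equiv_sym: "cusp_equiv N s t \<Longrightarrow> cusp_equiv N t s"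
  unfolding cusp_equiv_def
proof (elim bexE)
  fix A assume A: "A \<in> Gamma0 N" "t = cusp_act A s"
  then have "s = cusp_act (adj2 A) t"
    by (simp add: cusp_act_mult[symmetric] Gamma0_det adj2_mult cusp_act_mat)
  with A show "\<exists>A\<in>Gamma0 N. s = cusp_act A t" using Gamma0_adj2 by blast
qed

lemma cusp_equiv_trans: "cusp_equiv N s t \<Longrightarrow> cusp_equiv N t u \<Longrightarrow> cusp_equiv N s u"
  unfolding cusp_equiv_def
proof (elim bexE)
  fix A B assume A: "A \<in> Gamma0 N" "t = cusp_act A s" and B: "B \<in> Gamma0 N" "u = cusp_act B t"
  then have "u = cusp_act (B ** A) s" by (simp add: cusp_act_mult Gamma0_det)
  with A B show "\<exists>A\<in>Gamma0 N. u = cusp_act A s" using Gamma0_mult by blast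
qed

lemma upper_triangular_SL2Z:
  assumes "A \<in> SL2Z" "A$2$1 = 0"
  shows "A = transl (A$1$1 * A$1$2) \<or> A = - transl (A$1$1 * A$1$2)"
proof -
  have "A$1$1 * A$2$2 = 1" using assms by (simp add: SL2Z_def det_2)
  then have "A$1$1 = 1 \<and> A$2$2 = 1 \<or> A$1$1 = -1 \<and> A$2$2 = -1"
    by (metis zmult_eq_1_iff)
  then show ?thesis using assms by (auto simp: mat2_eq_iff)
qed

lemma cusp_stabilizer_coset:
  assumes "A \<in> SL2Z" "B \<in> SL2Z" "cusp_act A None = cusp_act B None"
  obtains k where "A = B ** transl k \<or> A = - (B ** transl k)"
proof -
  have "(adj2 B ** A)$2$1 = 0"
    using assms by (subst cusp_equiv_matrix_iff[symmetric]) (auto simp: SL2Z_det)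
  then have *: "adj2 B ** A = transl k \<or> adj2 B ** A = - transl k"
    if "k = (adj2 B ** A)$1$1 * (adj2 B ** A)$1$2" for k
    unfolding that by (intro upper_triangular_SL2Z SL2Z_mult SL2Z_adj2 assms)
  define k where "k = (adj2 B ** A)$1$1 * (adj2 B ** A)$1$2"
  have "A = B ** (adj2 B ** A)" using assms by (simp add: adj2_cancel SL2Z_det)
  with *[OF k_def] have "A = B ** transl k \<or> A = - (B ** transl k)"
    by (metis matmul_uminus(2))
  then show ?thesis by (rule that)
qed

section \<open>Reduction theory\<close>

text \<open>The index is finite because the lower left entry of \<open>A B\<^sup>-\<^sup>1\<close> only depends on the bottom rows.\<close>

lemma Gamma0_coset_by_bottom_row:
  assumes "A \<in> SL2Z" "B \<in> SL2Z" "A$2$1 mod int N = B$2$1 mod int N" "A$2$2 mod int N = B$2$2 mod int N"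
  shows "A ** adj2 B \<in> Gamma0 N"
proof -
  have "(A$2$1 * B$2$2) mod int N = (A$2$2 * B$2$1) mod int N"
    by (metis (no_types) assms(3,4) mod_mult_cong mult.commute)
  then have "int N dvd A$2$1 * B$2$2 - A$2$2 * B$2$1"
    by (simp add: mod_eq_dvd_iff)
  then show ?thesis
    using assms by (simp add: Gamma0_def SL2Z_mult SL2Z_adj2 matmul_nth)
qed

lemma SL2Z_sequence_in_one_coset:
  fixes A :: "nat \<Rightarrow> int^2^2"
  assumes "N > 0" "\<And>k. A k \<in> SL2Z"
  obtains B r where "B \<in> SL2Z" "strict_mono (r :: nat \<Rightarrow> nat)" "\<And>k. A (r k) ** adj2 B \<in> Gamma0 N"
proof -
  define res where "res k = (A k $ 2 $ 1 mod int N, A k $ 2 $ 2 mod int N)" for k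
  have "range res \<subseteq> {0..<int N} \<times> {0..<int N}"
    using assms(1) by (auto simp: res_def)
  then have "finite (range res)"
    by (rule finite_subset) simp
  then obtain k0 where k0: "infinite {k. res k = res k0}"
    using pigeonhole_infinite[of UNIV res] by auto
  obtain r where r: "strict_mono (r :: nat \<Rightarrow> nat)" "\<And>k. res (r k) = res k0"
    using infinite_enumerate[OF k0] by auto
  show ?thesis
  proof (rule that[of "A k0" r])
    show "A (r k) ** adj2 (A k0) \<in> Gamma0 N" for k
      using r(2)[of k] by (intro Gamma0_coset_by_bottom_row assms) (simp_all add: res_def)
  qed (use assms r in auto)
qed

lemma finite_bounded_matrices:
  "finite {A :: int^2^2. \<bar>A$1$1\<bar> \<le> m \<and> \<bar>A$1$2\<bar> \<le> m \<and> \<bar>A$2$1\<bar> \<le> m \<and> \<bar>A$2$2\<bar> \<le> m}"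
proof (rule finite_subset)
  show "{A :: int^2^2. \<bar>A$1$1\<bar> \<le> m \<and> \<bar>A$1$2\<bar> \<le> m \<and> \<bar>A$2$1\<bar> \<le> m \<and> \<bar>A$2$2\<bar> \<le> m} \<subseteq>
     (\<lambda>(a, b, c, d). M2 a b c d) ` ({-m..m} \<times> {-m..m} \<times> {-m..m} \<times> {-m..m})"
  proof
    fix A :: "int^2^2"
    assume "A \<in> {A. \<bar>A$1$1\<bar> \<le> m \<and> \<bar>A$1$2\<bar> \<le> m \<and> \<bar>A$2$1\<bar> \<le> m \<and> \<bar>A$2$2\<bar> \<le> m}"
    then show "A \<in> (\<lambda>(a, b, c, d). M2 a b c d) ` ({-m..m} \<times> {-m..m} \<times> {-m..m} \<times> {-m..m})"
      by (intro image_eqI[of _ _ "(A$1$1, A$1$2, A$2$1, A$2$2)"]) (auto simp: M2_eta)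
  qed
qed simp

text \<open>The imaginary part of \<open>c \<tau> + d\<close> controls \<open>c\<close>, and then the absolute value controls \<open>d\<close>.\<close>

lemma lattice_point_bounds:
  assumes "Im \<tau> \<ge> y" "y > 0" "cmod \<tau> \<le> M" "cmod (of_int c * \<tau> + of_int d) \<le> R"
  shows "\<bar>of_int c\<bar> \<le> R / y" "\<bar>of_int d\<bar> \<le> R + R / y * M"
proof -
  have "\<bar>of_int c\<bar> * y \<le> \<bar>of_int c\<bar> * Im \<tau>"
    using assms by (intro mult_left_mono) auto
  also have "\<dots> = \<bar>Im (of_int c * \<tau> + of_int d)\<bar>"
    using assms by (simp add: abs_mult)
  also have "\<dots> \<le> R"
    using abs_Im_le_cmod[of "of_int c * \<tau> + of_int d"] assms(4) by (rule order_trans)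
  finally show c: "\<bar>of_int c\<bar> \<le> R / y" using assms by (simp add: field_simps)
  have "\<bar>of_int d\<bar> = cmod ((of_int c * \<tau> + of_int d) - of_int c * \<tau>)" by simp
  also have "\<dots> \<le> R + cmod (of_int c * \<tau>)"
    using assms(4) by (intro order_trans[OF norm_triangle_ineq4]) simp
  also have "cmod (of_int c * \<tau>) \<le> R / y * M"
    unfolding norm_mult using c assms by (intro mult_mono) auto
  finally show "\<bar>of_int d\<bar> \<le> R + R / y * M" by simp
qed

text \<open>Proper discontinuity: the entries of a matrix moving one point of a compact region into the
  region are bounded, because both rows are lattice points of bounded norm.\<close>

lemma finite_returning_matrices:
  assumes "y > 0"
  shows "finite {A \<in> SL2Z. \<exists>\<tau>. Im \<tau> \<ge> y \<and> cmod \<tau> \<le> M \<and> Im (moebius A \<tau>) \<ge> y \<and> cmod (moebius A \<tau>) \<le> M}"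
proof -
  define R where "R = sqrt (M / y)"
  define R' where "R' = M * R"
  define m where "m = \<lceil>max (max (R / y) (R + R / y * M)) (max (R' / y) (R' + R' / y * M))\<rceil>"
  have "A \<in> {A. \<bar>A$1$1\<bar> \<le> m \<and> \<bar>A$1$2\<bar> \<le> m \<and> \<bar>A$2$1\<bar> \<le> m \<and> \<bar>A$2$2\<bar> \<le> m}"
    if A: "A \<in> SL2Z" and t: "Im \<tau> \<ge> y" "cmod \<tau> \<le> M" "Im (moebius A \<tau>) \<ge> y" "cmod (moebius A \<tau>) \<le> M" for A \<tau>
  proof -
    have uhp: "\<tau> \<in> uhp" using t assms by (simp add: uhp_def)
    have d0: "den A \<tau> \<noteq> 0" using den_nonzero[OF uhp] A by (simp add: SL2Z_det)
    have "Im (moebius A \<tau>) * (cmod (den A \<tau>))\<^sup>2 = Im \<tau>"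
      using d0 A by (simp add: Im_moebius SL2Z_det)
    then have "y * (cmod (den A \<tau>))\<^sup>2 \<le> Im \<tau>"
      using mult_right_mono[OF t(3), of "(cmod (den A \<tau>))\<^sup>2"] by simp
    also have "Im \<tau> \<le> M" using abs_Im_le_cmod[of \<tau>] t(2) by linarith
    finally have "(cmod (den A \<tau>))\<^sup>2 \<le> M / y" using assms by (simp add: field_simps)
    then have R: "cmod (den A \<tau>) \<le> R" unfolding R_def by (rule real_le_rsqrt)
    have "cmod (of_int (A$1$1) * \<tau> + of_int (A$1$2)) = cmod (moebius A \<tau>) * cmod (den A \<tau>)"
      using d0 by (simp add: moebius_den norm_divide)
    also have "\<dots> \<le> R'" unfolding R'_def
      using R t(4) by (intro mult_mono) (auto intro: order_trans[OF norm_ge_zero])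
    finally have R': "cmod (of_int (A$1$1) * \<tau> + of_int (A$1$2)) \<le> R'" .
    have le: "\<bar>real_of_int x\<bar> \<le> of_int m \<Longrightarrow> \<bar>x\<bar> \<le> m" for x by linarith
    have m: "of_int m \<ge> max (max (R / y) (R + R / y * M)) (max (R' / y) (R' + R' / y * M))"
      unfolding m_def by (rule le_of_int_ceiling)
    show ?thesis
      using lattice_point_bounds[OF t(1) assms t(2) R[unfolded den_def]]
        lattice_point_bounds[OF t(1) assms t(2) R'] m
      by (auto intro!: le)
  qed
  then show ?thesis
    by (intro finite_subset[OF _ finite_bounded_matrices[of m]]) auto
qed

lemma pigeonhole_sequence:
  fixes f :: "nat \<Rightarrow> 'a"
  assumes "finite F" "\<And>k. k \<ge> K \<Longrightarrow> f k \<in> F"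
  obtains a r where "a \<in> F" "strict_mono (r :: nat \<Rightarrow> nat)" "\<And>k. f (r k) = a"
proof -
  have "finite (f ` {K..})" using assms by (intro finite_subset[OF _ assms(1)]) auto
  then obtain k0 where k0: "k0 \<in> {K..}" "infinite {k\<in>{K..}. f k = f k0}"
    using pigeonhole_infinite[of "{K..}" f] by (auto simp: infinite_Ici)
  obtain r where r: "strict_mono (r :: nat \<Rightarrow> nat)" "\<And>k. r k \<in> {k\<in>{K..}. f k = f k0}"
    using infinite_enumerate[OF k0(2)] by auto
  show ?thesis by (rule that[of "f k0" r]) (use k0 r assms(2) in auto)
qed

text \<open>Along convergent sequences of equivalent points the relating matrices take finitely many
  values, so a subsequence is related by a single one, which also relates the limits.\<close>

lemma limit_of_equivalent_points:
  assumes "z \<longlonglongrightarrow> z0" "z0 \<in> uhp" "w \<longlonglongrightarrow> w0" "w0 \<in> uhp"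
    and "\<And>k. G k \<in> SL2Z" "\<And>k. w k = moebius (G k) (z k)"
  obtains H r where "H \<in> SL2Z" "strict_mono (r :: nat \<Rightarrow> nat)" "\<And>k. G (r k) = H" "moebius H z0 = w0"
proof -
  define y where "y = min (Im z0) (Im w0) / 2"
  have y: "y > 0" "y < Im z0" "y < Im w0" using assms by (auto simp: y_def uhp_def)
  define M where "M = max (cmod z0) (cmod w0) + 1"
  have "eventually (\<lambda>k. Im (z k) > y \<and> cmod (z k) < M \<and> Im (w k) > y \<and> cmod (w k) < M) sequentially"
    using order_tendstoD(1)[OF tendsto_Im[OF assms(1)] y(2)] order_tendstoD(1)[OF tendsto_Im[OF assms(3)] y(3)]
      order_tendstoD(2)[OF tendsto_norm[OF assms(1)], of M] order_tendstoD(2)[OF tendsto_norm[OF assms(3)], of M]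
    by (auto simp: M_def eventually_conj_iff)
  then obtain K where K: "\<And>k. k \<ge> K \<Longrightarrow> Im (z k) > y \<and> cmod (z k) < M \<and> Im (w k) > y \<and> cmod (w k) < M"
    by (auto simp: eventually_sequentially)
  obtain H r where H: "H \<in> {A \<in> SL2Z. \<exists>\<tau>. Im \<tau> \<ge> y \<and> cmod \<tau> \<le> M \<and> Im (moebius A \<tau>) \<ge> y \<and> cmod (moebius A \<tau>) \<le> M}"
    and r: "strict_mono (r :: nat \<Rightarrow> nat)" "\<And>k. G (r k) = H"
  proof (rule pigeonhole_sequence[OF finite_returning_matrices[OF y(1), of M]])
    fix k assume "k \<ge> K"
    with K[of k] show "G k \<in> {A \<in> SL2Z. \<exists>\<tau>. Im \<tau> \<ge> y \<and> cmod \<tau> \<le> M \<and> Im (moebius A \<tau>) \<ge> y \<and> cmod (moebius A \<tau>) \<le> M}"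
      using assms(5,6) by (auto intro!: exI[of _ "z k"] less_imp_le)
  qed blast
  have HS: "H \<in> SL2Z" using H by simp
  have "(\<lambda>k. moebius H (z (r k))) \<longlonglongrightarrow> moebius H z0"
    using LIMSEQ_subseq_LIMSEQ[OF assms(1) r(1)] continuous_moebius[of H z0] assms(2) SL2Z_det[OF HS]
    by (intro isCont_tendsto_compose[of z0 "moebius H"]) (auto simp: o_def)
  moreover have "(\<lambda>k. moebius H (z (r k))) \<longlonglongrightarrow> w0"
    using LIMSEQ_subseq_LIMSEQ[OF assms(3) r(1)] by (simp add: o_def assms(6) r(2))
  ultimately have "moebius H z0 = w0" by (rule LIMSEQ_unique)
  with HS r show ?thesis by (rule that)
qed

lemma finite_small_lattice_points:
  assumes "\<tau> \<in> uhp"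
  shows "finite {(c, d). cmod (of_int c * \<tau> + of_int d) \<le> R}"
proof -
  define m where "m = \<lceil>max (R / Im \<tau>) (R + R / Im \<tau> * cmod \<tau>)\<rceil>"
  have m: "of_int m \<ge> max (R / Im \<tau>) (R + R / Im \<tau> * cmod \<tau>)"
    unfolding m_def by (rule le_of_int_ceiling)
  have "{(c, d). cmod (of_int c * \<tau> + of_int d) \<le> R} \<subseteq> {-m..m} \<times> {-m..m}"
  proof safe
    fix c d assume *: "cmod (of_int c * \<tau> + of_int d) \<le> R"
    have "Im \<tau> > 0" using assms by (simp add: uhp_def)
    from lattice_point_bounds[OF order_refl this order_refl *] m
    have "\<bar>real_of_int c\<bar> \<le> of_int m" "\<bar>real_of_int d\<bar> \<le> of_int m" by auto
    then show "c \<in> {-m..m}" "d \<in> {-m..m}" by auto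
  qed
  then show ?thesis by (rule finite_subset) simp
qed

text \<open>Among the points of an orbit one with minimal \<open>|c \<tau> + d|\<close> has maximal imaginary part; after
  a translation it lies in the standard fundamental domain, since inversion cannot raise it further.\<close>

lemma fundamental_domain_reduction:
  assumes "\<tau> \<in> uhp"
  obtains A z where "A \<in> SL2Z" "z \<in> uhp" "\<tau> = moebius A z" "\<bar>Re z\<bar> \<le> 1/2" "cmod z \<ge> 1"
proof -
  define V where "V = {cmod (den A \<tau>) | A. A \<in> SL2Z} \<inter> {..1}"
  have "V \<subseteq> (\<lambda>(c, d). cmod (of_int c * \<tau> + of_int d)) ` {(c, d). cmod (of_int c * \<tau> + of_int d) \<le> 1}"
  proof
    fix v assume "v \<in> V"
    then obtain A where "v = cmod (den A \<tau>)" "cmod (den A \<tau>) \<le> 1" by (auto simp: V_def)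
    then show "v \<in> (\<lambda>(c, d). cmod (of_int c * \<tau> + of_int d)) ` {(c, d). cmod (of_int c * \<tau> + of_int d) \<le> 1}"
      by (intro image_eqI[of _ _ "(A$2$1, A$2$2)"]) (auto simp: den_def)
  qed
  then have fin: "finite V"
    by (rule finite_subset) (intro finite_imageI finite_small_lattice_points assms)
  have "cmod (den (mat 1) \<tau>) = 1" by (simp add: den_def)
  then have "1 \<in> V" unfolding V_def using SL2Z_one by force
  then have ne: "V \<noteq> {}" by blast
  obtain A where A: "A \<in> SL2Z" "cmod (den A \<tau>) = Min V"
    using Min_in[OF fin ne] by (auto simp: V_def)
  have min: "cmod (den A \<tau>) \<le> cmod (den B \<tau>)" if "B \<in> SL2Z" for B
  proof (cases "cmod (den B \<tau>) \<le> 1")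
    case True
    with that have "cmod (den B \<tau>) \<in> V" by (auto simp: V_def)
    then show ?thesis unfolding A(2) using fin by (rule Min_le[rotated])
  next
    case False
    have "Min V \<le> 1" using fin \<open>1 \<in> V\<close> by (rule Min_le)
    then show ?thesis using False A(2) by linarith
  qed
  define k where "k = round (Re (moebius A \<tau>))"
  define B where "B = transl (- k) ** A"
  have B: "B \<in> SL2Z" unfolding B_def by (intro SL2Z_mult transl_SL2Z A)
  define z where "z = moebius B \<tau>"
  have zu: "z \<in> uhp" unfolding z_def by (intro moebius_in_uhp_SL2Z assms B)
  have z: "z = moebius A \<tau> - of_int k"
    unfolding z_def B_def using assms A by (subst moebius_mult) (auto simp: SL2Z_det)
  have re: "\<bar>Re z\<bar> \<le> 1/2"
    using of_int_round_abs_le[of "Re (moebius A \<tau>)"] by (simp add: z k_def abs_minus_commute)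
  \<comment> \<open>Inversion multiplies the automorphy factor by \<open>z\<close>, so minimality forces \<open>|z| \<ge> 1\<close>.\<close>
  define S where "S = M2 0 (-1) 1 0"
  have den_S: "den S w = w" for w by (simp add: den_def S_def)
  have "S ** B \<in> SL2Z" by (intro SL2Z_mult B) (simp add: S_def SL2Z_def)
  then have "cmod (den A \<tau>) \<le> cmod (den (S ** B) \<tau>)" by (rule min)
  also have "den (S ** B) \<tau> = z * den B \<tau>"
    using assms B den_S by (subst den_mult) (auto simp: z_def SL2Z_det)
  also have "den B \<tau> = den A \<tau>"
    by (simp add: B_def den_def matmul_nth)
  finally have "cmod (den A \<tau>) * 1 \<le> cmod (den A \<tau>) * cmod z"
    by (simp add: norm_mult mult.commute)
  moreover have "cmod (den A \<tau>) > 0"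
    using den_nonzero[OF assms, of A] A(1) by (simp add: SL2Z_det)
  ultimately have "cmod z \<ge> 1" by (simp only: mult_le_cancel_left_pos)
  moreover have "\<tau> = moebius (adj2 B) z"
    unfolding z_def using assms B by (simp add: moebius_adj2 SL2Z_det)
  ultimately show ?thesis using that[of "adj2 B" z] SL2Z_adj2[OF B] zu re by blast
qed

lemma eventually_at_i_infinity:
  "eventually P at_i_infinity \<longleftrightarrow> (\<exists>r. \<forall>\<tau>. Im \<tau> > r \<longrightarrow> P \<tau>)"
  by (auto simp: eventually_filtercomap eventually_at_top_dense)

lemma at_i_infinity_neq_bot [simp]: "at_i_infinity \<noteq> bot"
proof
  assume "at_i_infinity = bot"
  then have "eventually (\<lambda>_. False) at_i_infinity" by simp
  then obtain r where r: "\<forall>\<tau>. \<not> Im \<tau> > r" by (auto simp: eventually_at_i_infinity)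
  have "Im (Complex 0 (r + 1)) > r" by simp
  with r show False by blast
qed

lemma eventually_uhp: "eventually (\<lambda>\<tau>. \<tau> \<in> uhp) at_i_infinity"
  unfolding eventually_at_i_infinity uhp_def by (intro exI[of _ 0]) auto

text \<open>Compactness of the modular curve, stated for sequences in the upper half plane: up to the
  group and a fixed coset representative, a subsequence converges to a point of the upper half plane
  or to a cusp.\<close>

lemma modular_curve_compactness:
  fixes \<tau> :: "nat \<Rightarrow> complex"
  assumes "N > 0" "\<And>k. \<tau> k \<in> uhp"
  obtains A z G r where "A \<in> SL2Z" "strict_mono (r :: nat \<Rightarrow> nat)" "\<And>k. z k \<in> uhp"
    "\<And>k. G k \<in> Gamma0 N" "\<And>k. \<tau> (r k) = moebius (G k) (moebius A (z k))"
    "(\<exists>z0\<in>uhp. z \<longlonglongrightarrow> z0) \<or> filterlim z at_i_infinity sequentially"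
proof -
  have "\<exists>B z. B \<in> SL2Z \<and> z \<in> uhp \<and> \<tau> k = moebius B z \<and> \<bar>Re z\<bar> \<le> 1/2 \<and> cmod z \<ge> 1" for k
    using fundamental_domain_reduction[OF assms(2)[of k]] by metis
  then obtain B z where B: "\<And>k. B k \<in> SL2Z" and zu: "\<And>k. z k \<in> uhp"
    and t: "\<And>k. \<tau> k = moebius (B k) (z k)" and re: "\<And>k. \<bar>Re (z k)\<bar> \<le> 1/2" and ge1: "\<And>k. cmod (z k) \<ge> 1"
    by metis
  obtain A r where A: "A \<in> SL2Z" and r: "strict_mono (r :: nat \<Rightarrow> nat)" and G: "\<And>k. B (r k) ** adj2 A \<in> Gamma0 N"
    using SL2Z_sequence_in_one_coset[OF assms(1), of B] B by metis
  have t': "\<tau> (r k) = moebius (B (r k) ** adj2 A) (moebius A (z (r k)))" for k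
  proof -
    have "B (r k) = (B (r k) ** adj2 A) ** A" using A by (simp add: adj2_cancel SL2Z_det)
    then have "moebius (B (r k)) (z (r k)) = moebius ((B (r k) ** adj2 A) ** A) (z (r k))" by simp
    then show ?thesis unfolding t using zu A by (subst (asm) moebius_mult) (auto simp: SL2Z_det)
  qed
  \<comment> \<open>Either a subsequence stays in a compact part of the fundamental domain, or the imaginary parts tend to infinity.\<close>
  show ?thesis
  proof (cases "\<exists>M. infinite {k. Im (z (r k)) \<le> M}")
    case True
    then obtain M where M: "infinite {k. Im (z (r k)) \<le> M}" by blast
    obtain r' where r': "strict_mono (r' :: nat \<Rightarrow> nat)" "\<And>k. Im (z (r (r' k))) \<le> M"
      using infinite_enumerate[OF M] by auto
    have im: "Im (z k) \<ge> 1/2" for k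
    proof (rule ccontr)
      assume "\<not> Im (z k) \<ge> 1/2"
      then have "\<bar>Im (z k)\<bar> < 1/2" using zu[of k] by (simp add: uhp_def)
      then have "(Im (z k))\<^sup>2 < (1/2)\<^sup>2" using power_strict_mono[of "\<bar>Im (z k)\<bar>" "1/2" 2] by simp
      moreover have "(Re (z k))\<^sup>2 \<le> (1/2)\<^sup>2" using re[of k] by (simp add: abs_le_square_iff[symmetric])
      ultimately have "(cmod (z k))\<^sup>2 < 1" unfolding cmod_power2 by (simp add: power_divide)
      with ge1[of k] show False by (metis abs_norm_cancel abs_square_less_1 not_less)
    qed
    define C where "C = cbox (Complex (-1/2) (1/2)) (Complex (1/2) M)"
    have "z (r (r' k)) \<in> C" for k
      unfolding C_def using re[of "r (r' k)"] im[of "r (r' k)"] r'(2)[of k] by (auto simp: in_cbox_complex_iff)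
    moreover have "seq_compact C" unfolding C_def by (intro compact_imp_seq_compact compact_cbox)
    ultimately obtain z0 r'' where z0: "z0 \<in> C" "strict_mono (r'' :: nat \<Rightarrow> nat)" "((\<lambda>k. z (r (r' k))) \<circ> r'') \<longlonglongrightarrow> z0"
      by (metis seq_compactE)
    show ?thesis
    proof (rule that[of A "\<lambda>k. r (r' (r'' k))" "\<lambda>k. z (r (r' (r'' k)))" "\<lambda>k. B (r (r' (r'' k))) ** adj2 A"])
      show "strict_mono (\<lambda>k. r (r' (r'' k)))" using r r'(1) z0(2) by (auto simp: strict_mono_def)
      have "z0 \<in> uhp" using z0(1) unfolding C_def uhp_def by (auto simp: in_cbox_complex_iff)
      then show "(\<exists>z0\<in>uhp. (\<lambda>k. z (r (r' (r'' k)))) \<longlonglongrightarrow> z0) \<or> filterlim (\<lambda>k. z (r (r' (r'' k)))) at_i_infinity sequentially"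
        using z0(3) by (auto simp: o_def)
    qed (use A zu G t' in auto)
  next
    case False
    show ?thesis
    proof (rule that[of A r "\<lambda>k. z (r k)" "\<lambda>k. B (r k) ** adj2 A"])
      have "eventually (\<lambda>k. Im (z (r k)) > M) sequentially" for M
        using False unfolding cofinite_eq_sequentially[symmetric] eventually_cofinite by (simp add: not_less)
      then have "filterlim (\<lambda>k. Im (z (r k))) at_top sequentially"
        unfolding filterlim_at_top_dense by blast
      then show "(\<exists>z0\<in>uhp. (\<lambda>k. z (r k)) \<longlonglongrightarrow> z0) \<or> filterlim (\<lambda>k. z (r k)) at_i_infinity sequentially"
        by (simp add: filterlim_filtercomap_iff o_def)
    qed (use A r zu G t' in auto)
  qed
qed

section \<open>Expansions at the cusps\<close>

definition qpar :: "nat \<Rightarrow> complex \<Rightarrow> complex" where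
  "qpar h \<tau> = exp (2 * of_real pi * \<i> * \<tau> / of_nat h)"

lemma norm_qpar: "norm (qpar h \<tau>) = exp (- 2 * pi * Im \<tau> / of_nat h)"
  by (simp add: qpar_def)

lemma qpar_nonzero [simp]: "qpar h \<tau> \<noteq> 0"
  by (simp add: qpar_def)

lemma qpar_in_ball: "h > 0 \<Longrightarrow> \<tau> \<in> uhp \<Longrightarrow> qpar h \<tau> \<in> ball 0 1"
  by (simp add: norm_qpar uhp_def)

lemma holomorphic_qpar [holomorphic_intros]: "qpar h holomorphic_on S"
  unfolding qpar_def[abs_def] by (cases "h = 0") (auto intro!: holomorphic_intros)

lemma tendsto_qpar:
  assumes "h > 0"
  shows "filterlim (qpar h) (at 0) at_i_infinity"
proof -
  have "filterlim (\<lambda>\<tau>. - 2 * pi * Im \<tau> / of_nat h) at_bot at_i_infinity"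
  proof -
    have "filterlim (\<lambda>\<tau>. (- 2 * pi / of_nat h) * Im \<tau>) at_bot at_i_infinity"
      using assms by (intro filterlim_tendsto_neg_mult_at_bot[OF tendsto_const] filterlim_filtercomap)
        (auto simp: divide_neg_pos)
    then show ?thesis by (simp add: field_simps)
  qed
  then have "((\<lambda>\<tau>. exp (- 2 * pi * Im \<tau> / of_nat h)) \<longlongrightarrow> 0) at_i_infinity"
    by (rule filterlim_compose[OF exp_at_bot])
  then have "((\<lambda>\<tau>. norm (qpar h \<tau>)) \<longlongrightarrow> 0) at_i_infinity"
    by (simp add: norm_qpar)
  then have "(qpar h \<longlongrightarrow> 0) at_i_infinity"
    by (simp add: tendsto_norm_zero_iff)
  then show ?thesis by (simp add: filterlim_at)
qed

lemma qpar_eqD: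
  assumes "qpar h \<tau> = qpar h \<tau>'" "h > 0"
  obtains k :: int where "\<tau> = \<tau>' + of_nat h * of_int k"
proof -
  have "exp (2 * of_real pi * \<i> * \<tau> / of_nat h) = exp (2 * of_real pi * \<i> * \<tau>' / of_nat h)"
    using assms(1) unfolding qpar_def .
  then obtain k :: int where "2 * of_real pi * \<i> * \<tau> / of_nat h =
      2 * of_real pi * \<i> * \<tau>' / of_nat h + of_real (of_int (2 * k) * pi) * \<i>"
    unfolding exp_eq by blast
  then have "2 * of_real pi * \<i> * \<tau> = 2 * of_real pi * \<i> * (\<tau>' + of_nat h * of_int k)"
    using assms(2) by (simp add: field_simps)
  then have "\<tau> = \<tau>' + of_nat h * of_int k" by simp
  then show ?thesis by (rule that)
qed

text \<open>Any choice of logarithm is allowed, since two branches are needed to see that a periodic function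
  is holomorphic in the parameter.\<close>

lemma qpar_log:
  assumes "h > 0" "exp w = q" "\<tau> = of_nat h * w / (2 * of_real pi * \<i>)"
  shows "qpar h \<tau> = q" "Im \<tau> = - of_nat h * ln (norm q) / (2 * pi)"
proof -
  show "qpar h \<tau> = q" using assms by (simp add: qpar_def)
  have "norm q = exp (Re w)" using assms(2) by auto
  then have "ln (norm q) = Re w" by simp
  moreover have "Im \<tau> = - of_nat h * Re w / (2 * pi)"
    unfolding assms(3) by (simp add: Im_divide power2_eq_square)
  ultimately show "Im \<tau> = - of_nat h * ln (norm q) / (2 * pi)" by simp
qed

lemma qpar_preimage:
  assumes "h > 0" "q \<in> ball 0 1 - {0}" "exp w = q" "\<tau> = of_nat h * w / (2 * of_real pi * \<i>)"
  shows "\<tau> \<in> uhp" "qpar h \<tau> = q"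
proof -
  have q: "0 < norm q" "norm q < 1" using assms(2) by auto
  note * = qpar_log[OF assms(1,3,4)]
  show "qpar h \<tau> = q" by (rule *)
  have "ln (norm q) < 0" using q by simp
  then show "\<tau> \<in> uhp" using assms(1) unfolding uhp_def by (simp add: *(2) divide_neg_pos mult_pos_neg)
qed

lemma qpar_surj:
  assumes "h > 0" "q \<in> ball 0 1 - {0}"
  obtains \<tau> where "\<tau> \<in> uhp" "qpar h \<tau> = q" "Im \<tau> = - of_nat h * ln (norm q) / (2 * pi)"
proof -
  define \<tau> where "\<tau> = of_nat h * Ln q / (2 * of_real pi * \<i>)"
  have e: "exp (Ln q) = q" using assms by auto
  show ?thesis
    using that[of \<tau>] qpar_preimage[OF assms e \<tau>_def] qpar_log[OF assms(1) e \<tau>_def] by blast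
qed

lemma periodic_multiple:
  fixes f :: "complex \<Rightarrow> complex"
  assumes per: "\<And>\<tau>. \<tau> \<in> uhp \<Longrightarrow> f (\<tau> + of_nat h) = f \<tau>" and "\<tau> \<in> uhp"
  shows "f (\<tau> + of_nat h * of_int k) = f \<tau>"
proof -
  have up: "f (\<tau> + of_nat h * of_nat m) = f \<tau>" if "\<tau> \<in> uhp" for m :: nat and \<tau>
  proof (induction m)
    case (Suc m)
    have "\<tau> + of_nat h * of_nat m \<in> uhp" using that by (simp add: uhp_def)
    from per[OF this] Suc show ?case by (simp add: algebra_simps)
  qed simp
  show ?thesis
  proof (cases "k \<ge> 0")
    case True
    then show ?thesis using up[OF assms(2), of "nat k"] by simp
  next
    case False
    define m where "m = nat (- k)"
    have k: "of_int k = - (of_nat m :: complex)" using False by (simp add: m_def)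
    have "\<tau> - of_nat h * of_nat m \<in> uhp" using assms(2) by (simp add: uhp_def)
    from up[OF this, of m] show ?thesis by (simp add: k)
  qed
qed

text \<open>The principal logarithm gives a formula for the function of the parameter. Near a point on the
  cut a shifted branch gives the same values by periodicity and is holomorphic there.\<close>

lemma periodic_descends:
  fixes f :: "complex \<Rightarrow> complex"
  assumes hol: "f holomorphic_on uhp" and h: "h > 0"
    and per: "\<And>\<tau>. \<tau> \<in> uhp \<Longrightarrow> f (\<tau> + of_nat h) = f \<tau>"
  obtains G where "G holomorphic_on ball 0 1 - {0}" "\<And>\<tau>. \<tau> \<in> uhp \<Longrightarrow> f \<tau> = G (qpar h \<tau>)"
proof -
  define G where "G q = f (of_nat h * Ln q / (2 * of_real pi * \<i>))" for q
  have G: "f \<tau> = G (qpar h \<tau>)" if "\<tau> \<in> uhp" for \<tau>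
  proof -
    define \<tau>' where "\<tau>' = of_nat h * Ln (qpar h \<tau>) / (2 * of_real pi * \<i>)"
    have q: "qpar h \<tau> \<in> ball 0 1 - {0}" using qpar_in_ball[OF h that] by simp
    have "exp (Ln (qpar h \<tau>)) = qpar h \<tau>" by simp
    from qpar_preimage[OF h q this \<tau>'_def] have *: "\<tau>' \<in> uhp" "qpar h \<tau> = qpar h \<tau>'" by simp_all
    obtain k :: int where "\<tau> = \<tau>' + of_nat h * of_int k" using qpar_eqD[OF *(2) h] .
    then have "f \<tau> = f \<tau>'" using periodic_multiple[of f h, OF per *(1)] by simp
    then show ?thesis by (simp add: G_def \<tau>'_def)
  qed
  have "G field_differentiable (at q0)" if q0: "q0 \<in> ball 0 1 - {0}" for q0
  proof -
    define U where "U = (ball 0 1 - {0}) \<inter> {q. q / q0 \<notin> \<real>\<^sub>\<le>\<^sub>0}"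
    define s where "s q = of_nat h * (Ln q0 + Ln (q / q0)) / (2 * of_real pi * \<i>)" for q
    have eq: "{q. q / q0 \<notin> \<real>\<^sub>\<le>\<^sub>0} = (\<lambda>q. q / q0) -` (- \<real>\<^sub>\<le>\<^sub>0)" by auto
    have "open U" unfolding U_def eq using q0
      by (intro open_Int open_vimage continuous_intros) (auto intro!: open_delete)
    have "q0 \<in> U" using q0 unfolding U_def by auto
    have s: "s q \<in> uhp \<and> qpar h (s q) = q" if "q \<in> U" for q
    proof -
      have "q \<in> ball 0 1 - {0}" using that by (simp add: U_def)
      moreover have "exp (Ln q0 + Ln (q / q0)) = q"
        using q0 calculation by (simp add: exp_add)
      ultimately show ?thesis using qpar_preimage[OF h _ _ s_def] by blast
    qed
    have "s holomorphic_on U"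
      unfolding s_def[abs_def] using q0 by (intro holomorphic_intros) (auto simp: U_def)
    then have "(f \<circ> s) holomorphic_on U"
      using s by (intro holomorphic_on_compose_gen[OF _ hol]) auto
    then have "G holomorphic_on U"
      using s G by (subst holomorphic_cong[OF refl, of U G "f \<circ> s"]) auto
    then show ?thesis using \<open>open U\<close> \<open>q0 \<in> U\<close> by (simp add: holomorphic_on_open field_differentiable_def)
  qed
  then have "G holomorphic_on ball 0 1 - {0}"
    by (simp add: holomorphic_on_def field_differentiable_at_within)
  then show ?thesis using G by (rule that)
qed

text \<open>A limit at the cusp makes the puncture removable.\<close>

lemma periodic_expansion:
  fixes f :: "complex \<Rightarrow> complex"
  assumes hol: "f holomorphic_on uhp" and h: "h > 0"
    and per: "\<And>\<tau>. \<tau> \<in> uhp \<Longrightarrow> f (\<tau> + of_nat h) = f \<tau>"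
    and lim: "(f \<longlongrightarrow> L) at_i_infinity"
  obtains G where "G holomorphic_on ball 0 1" "G 0 = L" "\<And>\<tau>. \<tau> \<in> uhp \<Longrightarrow> f \<tau> = G (qpar h \<tau>)"
proof -
  obtain G where G: "G holomorphic_on ball 0 1 - {0}" "\<And>\<tau>. \<tau> \<in> uhp \<Longrightarrow> f \<tau> = G (qpar h \<tau>)"
    using periodic_descends[of f h, OF hol h per] by blast
  have "(G \<longlongrightarrow> L) (at 0)"
    unfolding tendsto_iff
  proof (intro allI impI)
    fix e :: real assume "e > 0"
    then have "eventually (\<lambda>\<tau>. dist (f \<tau>) L < e) at_i_infinity" using lim by (simp add: tendsto_iff)
    then obtain r where r: "\<And>\<tau>. Im \<tau> > r \<Longrightarrow> dist (f \<tau>) L < e" by (auto simp: eventually_at_i_infinity)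
    define d where "d = min 1 (exp (- 2 * pi * r / of_nat h))"
    have "d > 0" by (simp add: d_def)
    moreover have "dist (G q) L < e" if "q \<noteq> 0" "dist q 0 < d" for q
    proof -
      have q: "q \<in> ball 0 1 - {0}" "norm q < exp (- 2 * pi * r / of_nat h)" using that by (auto simp: d_def)
      obtain \<tau> where \<tau>: "\<tau> \<in> uhp" "qpar h \<tau> = q" using qpar_surj[OF h q(1)] by metis
      have "exp (- 2 * pi * Im \<tau> / of_nat h) < exp (- 2 * pi * r / of_nat h)"
        using q(2) \<tau>(2) norm_qpar[of h \<tau>] by simp
      then have "- 2 * pi * Im \<tau> / of_nat h < - 2 * pi * r / of_nat h" by (simp only: exp_less_cancel_iff)
      then have "Im \<tau> > r" using h by (simp add: divide_less_cancel field_simps)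
      from r[OF this] show ?thesis using G(2)[OF \<tau>(1)] \<tau>(2) by simp
    qed
    ultimately show "\<forall>\<^sub>F q in at 0. dist (G q) L < e" unfolding eventually_at by blast
  qed
  then have "(\<lambda>q. if q = 0 then L else G q) holomorphic_on ball 0 1"
    by (intro removable_singularity G(1)) auto
  then show ?thesis using G(2) by (intro that[of "\<lambda>q. if q = 0 then L else G q"]) auto
qed

text \<open>The lower left entry of \<open>A T\<^sup>k A\<^sup>-\<^sup>1\<close> is \<open>- k c\<^sup>2\<close>, where \<open>c\<close> is the lower left entry of \<open>A\<close>. This is
  where the widths of the cusps come from.\<close>

lemma conj_transl_Gamma0:
  assumes "A \<in> SL2Z" "int N dvd k * (A$2$1)\<^sup>2"
  shows "A ** transl k ** adj2 A \<in> Gamma0 N"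
proof -
  have "(A ** transl k ** adj2 A)$2$1 = - (k * (A$2$1)\<^sup>2)"
    by (simp add: matmul_nth power2_eq_square algebra_simps)
  then show ?thesis using assms by (simp add: Gamma0_def SL2Z_mult SL2Z_adj2 transl_SL2Z)
qed

lemma invariant_at_cusp_periodic:
  assumes inv: "\<And>G \<tau>. G \<in> Gamma0 N \<Longrightarrow> \<tau> \<in> uhp \<Longrightarrow> f (moebius G \<tau>) = f \<tau>"
    and A: "A \<in> SL2Z" "int N dvd k * (A$2$1)\<^sup>2" and \<tau>: "\<tau> \<in> uhp"
  shows "f (moebius A (\<tau> + of_int k)) = f (moebius A \<tau>)"
proof -
  have "moebius (A ** transl k ** adj2 A) (moebius A \<tau>) = moebius (A ** transl k ** adj2 A ** A) \<tau>"
    using \<tau> A by (subst moebius_mult) (auto simp: SL2Z_det)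
  also have "A ** transl k ** adj2 A ** A = A ** transl k"
    using A by (simp add: adj2_cancel SL2Z_det)
  also have "moebius \<dots> \<tau> = moebius A (\<tau> + of_int k)"
    using \<tau> by (subst moebius_mult) (auto simp: SL2Z_det[OF transl_SL2Z])
  finally show ?thesis
    using inv[OF conj_transl_Gamma0[OF A], of "moebius A \<tau>"] moebius_in_uhp_SL2Z[OF \<tau> A(1)] by simp
qed

section \<open>Liouville's theorem on the modular curve\<close>

text \<open>The maximum of the modulus is attained by compactness, either in the upper half plane or at a
  cusp; in the local parameter there the cusp is an interior point as well.\<close>

lemma modular_Liouville:
  assumes N: "N > 0" and hol: "f holomorphic_on uhp"
    and inv: "\<And>G \<tau>. G \<in> Gamma0 N \<Longrightarrow> \<tau> \<in> uhp \<Longrightarrow> f (moebius G \<tau>) = f \<tau>"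
    and lim: "\<And>A. A \<in> SL2Z \<Longrightarrow> \<exists>L. ((\<lambda>\<tau>. f (moebius A \<tau>)) \<longlongrightarrow> L) at_i_infinity"
  obtains c where "\<And>\<tau>. \<tau> \<in> uhp \<Longrightarrow> f \<tau> = c"
proof -
  \<comment> \<open>Possible limits of \<open>f\<close> along sequences: values at points and limits at cusps.\<close>
  define V where "V = f ` uhp \<union> {L. \<exists>A\<in>SL2Z. ((\<lambda>\<tau>. f (moebius A \<tau>)) \<longlongrightarrow> L) at_i_infinity}"
  have seq: "\<exists>v\<in>V. \<exists>r. strict_mono (r :: nat \<Rightarrow> nat) \<and> (\<lambda>k. f (\<tau> (r k))) \<longlonglongrightarrow> v"
    if \<tau>: "\<And>k. \<tau> k \<in> uhp" for \<tau> :: "nat \<Rightarrow> complex"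
  proof -
    obtain A z G r where A: "A \<in> SL2Z" and r: "strict_mono (r :: nat \<Rightarrow> nat)" and z: "\<And>k. z k \<in> uhp"
      and G: "\<And>k. G k \<in> Gamma0 N" "\<And>k. \<tau> (r k) = moebius (G k) (moebius A (z k))"
      and conv: "(\<exists>z0\<in>uhp. z \<longlonglongrightarrow> z0) \<or> filterlim z at_i_infinity sequentially"
      using modular_curve_compactness[of N \<tau>, OF N \<tau>] by metis
    have eq: "f (\<tau> (r k)) = f (moebius A (z k))" for k
      unfolding G(2) by (intro inv G moebius_in_uhp_SL2Z z A)
    from conv show ?thesis
    proof
      assume "\<exists>z0\<in>uhp. z \<longlonglongrightarrow> z0"
      then obtain z0 where z0: "z0 \<in> uhp" "z \<longlonglongrightarrow> z0" by blast
      have "continuous_on uhp (\<lambda>\<tau>. f (moebius A \<tau>))"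
        using holomorphic_compose_moebius[OF hol, of A] A
        by (intro holomorphic_on_imp_continuous_on) (auto simp: SL2Z_det)
      then have "isCont (\<lambda>\<tau>. f (moebius A \<tau>)) z0"
        using z0 open_uhp by (simp add: continuous_on_eq_continuous_at)
      then have "(\<lambda>k. f (\<tau> (r k))) \<longlonglongrightarrow> f (moebius A z0)"
        unfolding eq using z0(2) by (rule isCont_tendsto_compose)
      moreover have "f (moebius A z0) \<in> V"
        unfolding V_def using moebius_in_uhp_SL2Z[OF z0(1) A] by blast
      ultimately show ?thesis using r by blast
    next
      assume "filterlim z at_i_infinity sequentially"
      moreover obtain L where "((\<lambda>\<tau>. f (moebius A \<tau>)) \<longlongrightarrow> L) at_i_infinity" using lim[OF A] by blast
      ultimately have "(\<lambda>k. f (\<tau> (r k))) \<longlonglongrightarrow> L" and "L \<in> V"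
        unfolding eq V_def using A by (auto intro: filterlim_compose)
      then show ?thesis using r by blast
    qed
  qed
  have bdd: "bdd_above ((norm \<circ> f) ` uhp)"
  proof (rule ccontr)
    assume "\<not> ?thesis"
    then have "\<exists>\<tau>\<in>uhp. norm (f \<tau>) > real k" for k
      unfolding bdd_above_def by (auto simp: not_le)
    then obtain \<tau> where \<tau>: "\<And>k. \<tau> k \<in> uhp" "\<And>k. norm (f (\<tau> k)) > real k" by metis
    obtain v r where r: "strict_mono (r :: nat \<Rightarrow> nat)" "(\<lambda>k. f (\<tau> (r k))) \<longlonglongrightarrow> v"
      using seq[of \<tau>] \<tau>(1) by blast
    from r(2) have "Bseq (\<lambda>k. f (\<tau> (r k)))" by (intro convergent_imp_Bseq convergentI)
    then obtain K where K: "\<And>k. norm (f (\<tau> (r k))) \<le> K" by (auto simp: Bseq_def)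
    have "real (nat \<lceil>K\<rceil>) < norm (f (\<tau> (r (nat \<lceil>K\<rceil>))))"
      using \<tau>(2)[of "r (nat \<lceil>K\<rceil>)"] seq_suble[OF r(1), of "nat \<lceil>K\<rceil>"] by linarith
    with K[of "nat \<lceil>K\<rceil>"] show False by linarith
  qed
  define s where "s = (SUP \<tau>\<in>uhp. norm (f \<tau>))"
  have bdd': "bdd_above ((\<lambda>\<tau>. norm (f \<tau>)) ` uhp)" using bdd by (simp add: o_def)
  have ne: "uhp \<noteq> {}" unfolding uhp_def by (auto intro: exI[of _ \<i>])
  have le_s: "norm (f \<tau>) \<le> s" if "\<tau> \<in> uhp" for \<tau>
    unfolding s_def by (rule cSUP_upper[OF that bdd'])
  have "\<exists>\<tau>\<in>uhp. norm (f \<tau>) > s - 1 / real (Suc k)" for k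
    unfolding s_def using less_cSUP_iff[OF ne bdd', of "(SUP \<tau>\<in>uhp. norm (f \<tau>)) - 1 / real (Suc k)"] by simp
  then obtain \<tau> where \<tau>: "\<And>k. \<tau> k \<in> uhp" "\<And>k. norm (f (\<tau> k)) > s - 1 / real (Suc k)" by metis
  have lims: "(\<lambda>k. norm (f (\<tau> k))) \<longlonglongrightarrow> s"
  proof (rule tendsto_sandwich)
    show "(\<lambda>k. s - 1 / real (Suc k)) \<longlonglongrightarrow> s"
      using tendsto_diff[OF tendsto_const LIMSEQ_Suc[OF lim_1_over_n]] by simp
    show "\<forall>\<^sub>F k in sequentially. s - 1 / real (Suc k) \<le> norm (f (\<tau> k))"
      using \<tau>(2) by (intro always_eventually) (auto intro: less_imp_le)
    show "\<forall>\<^sub>F k in sequentially. norm (f (\<tau> k)) \<le> s"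
      using \<tau>(1) le_s by (intro always_eventually) auto
  qed simp
  obtain v r where v: "v \<in> V" and r: "strict_mono (r :: nat \<Rightarrow> nat)" "(\<lambda>k. f (\<tau> (r k))) \<longlonglongrightarrow> v"
    using seq[of \<tau>] \<tau>(1) by blast
  have "(\<lambda>k. norm (f (\<tau> (r k)))) \<longlonglongrightarrow> norm v" by (intro tendsto_norm r)
  moreover have "(\<lambda>k. norm (f (\<tau> (r k)))) \<longlonglongrightarrow> s"
    using LIMSEQ_subseq_LIMSEQ[OF lims r(1)] by (simp add: o_def)
  ultimately have vs: "norm v = s" by (rule LIMSEQ_unique)
  have "f constant_on uhp"
    using v unfolding V_def
  proof
    assume "v \<in> f ` uhp"
    then obtain \<tau>0 where "\<tau>0 \<in> uhp" "v = f \<tau>0" by blast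
    then show ?thesis
      using maximum_modulus_principle[OF hol open_uhp connected_uhp open_uhp subset_refl] le_s vs by blast
  next
    assume "v \<in> {L. \<exists>A\<in>SL2Z. ((\<lambda>\<tau>. f (moebius A \<tau>)) \<longlongrightarrow> L) at_i_infinity}"
    then obtain A where A: "A \<in> SL2Z" "((\<lambda>\<tau>. f (moebius A \<tau>)) \<longlongrightarrow> v) at_i_infinity" by blast
    have per: "f (moebius A (\<tau> + of_nat N)) = f (moebius A \<tau>)" if "\<tau> \<in> uhp" for \<tau>
      using invariant_at_cusp_periodic[of N f A "int N" \<tau>] inv A that by simp
    have holA: "(\<lambda>\<tau>. f (moebius A \<tau>)) holomorphic_on uhp"
      using A by (intro holomorphic_compose_moebius hol) (simp add: SL2Z_det)
    obtain G where G: "G holomorphic_on ball 0 1" "G 0 = v" "\<And>\<tau>. \<tau> \<in> uhp \<Longrightarrow> f (moebius A \<tau>) = G (qpar N \<tau>)"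
      using periodic_expansion[OF holA N per A(2)] by blast
    have Gle: "norm (G q) \<le> s" if q: "q \<in> ball 0 1" for q
    proof (cases "q = 0")
      case False
      then obtain \<tau> where t: "\<tau> \<in> uhp" "qpar N \<tau> = q" using qpar_surj[OF N, of q] q by blast
      have "norm (f (moebius A \<tau>)) \<le> s" using le_s moebius_in_uhp_SL2Z[OF t(1) A(1)] by blast
      then show ?thesis using G(3)[OF t(1)] t(2) by simp
    qed (use G vs in simp)
    have "G constant_on ball 0 1"
      by (rule maximum_modulus_principle[OF G(1) open_ball connected_ball open_ball subset_refl, where \<xi> = 0])
        (use Gle G(2) vs in auto)
    then obtain c where c: "\<And>q. q \<in> ball 0 1 \<Longrightarrow> G q = c" unfolding constant_on_def by blast
    have "f \<tau> = c" if "\<tau> \<in> uhp" for \<tau>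
    proof -
      have t: "moebius (adj2 A) \<tau> \<in> uhp" using that A by (intro moebius_in_uhp_SL2Z SL2Z_adj2)
      have "f \<tau> = f (moebius A (moebius (adj2 A) \<tau>))"
        using that A by (simp add: moebius_adj2 SL2Z_det)
      then show ?thesis using G(3)[OF t] c qpar_in_ball[OF N t] by simp
    qed
    then show ?thesis unfolding constant_on_def by blast
  qed
  then show ?thesis using that unfolding constant_on_def by blast
qed

section \<open>The Hauptmodul is a bijection\<close>

definition Gamma0_related :: "nat \<Rightarrow> complex \<Rightarrow> complex \<Rightarrow> bool" where
  "Gamma0_related N \<tau> \<tau>' \<longleftrightarrow> (\<exists>G\<in>Gamma0 N. \<tau>' = moebius G \<tau>)"

lemma Gamma0_related_sym: "\<tau> \<in> uhp \<Longrightarrow> Gamma0_related N \<tau> \<tau>' \<Longrightarrow> Gamma0_related N \<tau>' \<tau>"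
  unfolding Gamma0_related_def
proof (elim bexE)
  fix G assume "\<tau> \<in> uhp" "G \<in> Gamma0 N" "\<tau>' = moebius G \<tau>"
  then show "\<exists>G\<in>Gamma0 N. \<tau> = moebius G \<tau>'"
    by (intro bexI[of _ "adj2 G"] Gamma0_adj2) (simp_all add: moebius_adj2 Gamma0_det)
qed

lemma Gamma0_related_trans:
  "\<tau> \<in> uhp \<Longrightarrow> Gamma0_related N \<tau> \<tau>' \<Longrightarrow> Gamma0_related N \<tau>' \<tau>'' \<Longrightarrow> Gamma0_related N \<tau> \<tau>''"
  unfolding Gamma0_related_def
proof (elim bexE)
  fix G H assume "\<tau> \<in> uhp" "G \<in> Gamma0 N" "\<tau>' = moebius G \<tau>" "H \<in> Gamma0 N" "\<tau>'' = moebius H \<tau>'"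
  then show "\<exists>G\<in>Gamma0 N. \<tau>'' = moebius G \<tau>"
    by (intro bexI[of _ "H ** G"] Gamma0_mult) (simp_all add: moebius_mult Gamma0_det)
qed

lemma Gamma0_related_shift: "Gamma0_related N \<tau> (\<tau> + of_int k)"
  unfolding Gamma0_related_def by (intro bexI[of _ "transl k"] transl_Gamma0) simp

text \<open>The quotient is Hausdorff: equivalent points arbitrarily near two given points would make
  the latter equivalent.\<close>

lemma unrelated_neighbourhoods:
  assumes "\<tau>1 \<in> uhp" "\<tau>2 \<in> uhp" "\<not> Gamma0_related N \<tau>1 \<tau>2"
  obtains r where "r > 0" "\<And>x y. x \<in> ball \<tau>1 r \<inter> uhp \<Longrightarrow> y \<in> ball \<tau>2 r \<inter> uhp \<Longrightarrow> \<not> Gamma0_related N x y"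
proof (rule ccontr)
  assume contra: "\<not> thesis"
  have "\<exists>x y. x \<in> ball \<tau>1 (1 / real (Suc k)) \<inter> uhp \<and> y \<in> ball \<tau>2 (1 / real (Suc k)) \<inter> uhp \<and> Gamma0_related N x y" for k
    using that[of "1 / real (Suc k)"] contra by fastforce
  then obtain x y where x: "\<And>k. x k \<in> ball \<tau>1 (1 / real (Suc k)) \<inter> uhp"
    and y: "\<And>k. y k \<in> ball \<tau>2 (1 / real (Suc k)) \<inter> uhp" and xy: "\<And>k. Gamma0_related N (x k) (y k)" by metis
  have lim0: "(\<lambda>k. 1 / real (Suc k)) \<longlonglongrightarrow> 0" using LIMSEQ_Suc[OF lim_1_over_n] by simp
  have xlim: "x \<longlonglongrightarrow> \<tau>1"
    by (rule metric_tendsto_imp_tendsto[OF lim0]) (use x in \<open>auto intro!: always_eventually less_imp_le simp: dist_commute\<close>)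
  have ylim: "y \<longlonglongrightarrow> \<tau>2"
    by (rule metric_tendsto_imp_tendsto[OF lim0]) (use y in \<open>auto intro!: always_eventually less_imp_le simp: dist_commute\<close>)
  obtain G where G: "\<And>k. G k \<in> Gamma0 N" "\<And>k. y k = moebius (G k) (x k)"
    using xy unfolding Gamma0_related_def by metis
  obtain H and r :: "nat \<Rightarrow> nat" where "\<And>k. G (r k) = H" "moebius H \<tau>1 = \<tau>2"
    by (rule limit_of_equivalent_points[OF xlim assms(1) ylim assms(2) Gamma0_SL2Z[OF G(1)] G(2)]) blast
  then have "H \<in> Gamma0 N" using G(1) by metis
  then show False using assms(3) \<open>moebius H \<tau>1 = \<tau>2\<close> unfolding Gamma0_related_def by blast
qed

text \<open>A matrix not fixing infinity maps points high up to points low down, so neighbourhoods of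
  distinct cusps, and of a cusp and a point, can be separated.\<close>

lemma Im_moebius_le:
  assumes "B \<in> SL2Z" "B$2$1 \<noteq> 0" "z \<in> uhp"
  shows "Im (moebius B z) * Im z \<le> 1"
proof -
  have z: "Im z > 0" using assms by (simp add: uhp_def)
  have "\<bar>Im (den B z)\<bar> = \<bar>of_int (B$2$1)\<bar> * Im z" using z by (simp add: den_def abs_mult)
  moreover have "\<bar>real_of_int (B$2$1)\<bar> \<ge> 1" using assms(2) by linarith
  ultimately have "Im z \<le> \<bar>Im (den B z)\<bar>" using mult_right_mono[of 1 "\<bar>real_of_int (B$2$1)\<bar>" "Im z"] z by simp
  then have "Im z \<le> cmod (den B z)" using abs_Im_le_cmod[of "den B z"] by linarith
  then have "Im z * Im z \<le> (cmod (den B z))\<^sup>2" using z unfolding power2_eq_square by (intro mult_mono) auto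
  moreover have "cmod (den B z) > 0" using den_nonzero[OF assms(3), of B] assms(1) by (simp add: SL2Z_det)
  ultimately show ?thesis using assms(1) by (simp add: Im_moebius SL2Z_det divide_simps)
qed

locale genus_zero_hauptmodul =
  fixes N :: nat and j :: "complex \<Rightarrow> complex"
  assumes N_pos: "N > 0" and hauptmodul: "hauptmodul N j"
begin

lemma j_hol: "j holomorphic_on uhp"
  using hauptmodul by (simp add: hauptmodul_def)

lemma j_inv: "G \<in> Gamma0 N \<Longrightarrow> \<tau> \<in> uhp \<Longrightarrow> j (moebius G \<tau>) = j \<tau>"
  using hauptmodul by (auto simp: hauptmodul_def generates_function_field_def modular_function_def)

lemma j_related: "\<tau> \<in> uhp \<Longrightarrow> Gamma0_related N \<tau> \<tau>' \<Longrightarrow> j \<tau>' = j \<tau>"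
  unfolding Gamma0_related_def using j_inv by blast

text \<open>A matrix stands for the cusp to which it maps infinity. At the cusps inequivalent to infinity the
  Hauptmodul has a finite value.\<close>

definition finite_cusp :: "int^2^2 \<Rightarrow> bool" where
  "finite_cusp A \<longleftrightarrow> \<not> cusp_equiv N None (cusp_act A None)"

lemma j_limit: "A \<in> SL2Z \<Longrightarrow> finite_cusp A \<Longrightarrow> \<exists>L. ((\<lambda>\<tau>. j (moebius A \<tau>)) \<longlongrightarrow> L) at_i_infinity"
  using hauptmodul unfolding hauptmodul_def finite_cusp_def by blast

lemma j_expansion:
  obtains h where "h holomorphic_on ball 0 1" "\<And>\<tau>. \<tau> \<in> uhp \<Longrightarrow> j \<tau> = inverse (qpar 1 \<tau>) + h (qpar 1 \<tau>)"
proof -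
  obtain c :: "nat \<Rightarrow> int" where c: "\<And>\<tau>. \<tau> \<in> uhp \<Longrightarrow>
      (\<lambda>m. of_int (c m) * (exp (2 * of_real pi * \<i> * \<tau>)) ^ Suc m) sums (j \<tau> - inverse (exp (2 * of_real pi * \<i> * \<tau>)))"
    using hauptmodul unfolding hauptmodul_def Let_def by blast
  have c': "(\<lambda>m. of_int (c m) * (qpar 1 \<tau>) ^ Suc m) sums (j \<tau> - inverse (qpar 1 \<tau>))" if "\<tau> \<in> uhp" for \<tau>
    using c[OF that] by (simp add: qpar_def)
  define a :: "nat \<Rightarrow> complex" where "a m = (case m of 0 \<Rightarrow> 0 | Suc m \<Rightarrow> of_int (c m))" for m
  define h where "h q = suminf (\<lambda>m. a m * q ^ m)" for q
  have a: "(\<lambda>m. a m * (qpar 1 \<tau>) ^ m) sums (j \<tau> - inverse (qpar 1 \<tau>))" if "\<tau> \<in> uhp" for \<tau>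
  proof -
    have "(\<lambda>m. a (Suc m) * (qpar 1 \<tau>) ^ Suc m) sums (j \<tau> - inverse (qpar 1 \<tau>))"
      using c'[OF that] by (simp add: a_def)
    from sums_Suc[OF this] show ?thesis by (simp add: a_def)
  qed
  have "(\<lambda>m. a m * q ^ m) sums h q" if q: "q \<in> ball 0 1" for q
  proof (cases "q = 0")
    case True
    have "(\<lambda>m. a m * 0 ^ m) sums a 0" using powser_sums_zero[of a] .
    then show ?thesis using True by (simp add: h_def sums_iff)
  next
    case False
    then obtain \<tau> where "\<tau> \<in> uhp" "qpar 1 \<tau> = q" using qpar_surj[of 1 q] q by auto
    then show ?thesis using a[of \<tau>] by (simp add: h_def sums_iff)
  qed
  then have "h holomorphic_on ball 0 1"
    by (intro power_series_holomorphic[of 0 1 a h]) simp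
  moreover have "j \<tau> = inverse (qpar 1 \<tau>) + h (qpar 1 \<tau>)" if "\<tau> \<in> uhp" for \<tau>
    using sums_unique[OF a[OF that]] by (simp add: h_def algebra_simps)
  ultimately show ?thesis by (rule that)
qed

lemma j_qpar_limit: "((\<lambda>\<tau>. j \<tau> * qpar 1 \<tau>) \<longlongrightarrow> 1) at_i_infinity"
proof -
  obtain h where h: "h holomorphic_on ball 0 1" "\<And>\<tau>. \<tau> \<in> uhp \<Longrightarrow> j \<tau> = inverse (qpar 1 \<tau>) + h (qpar 1 \<tau>)"
    using j_expansion by blast
  have "isCont h 0" using holomorphic_on_imp_continuous_on[OF h(1)] by (simp add: continuous_on_eq_continuous_at)
  then have "((\<lambda>q. 1 + q * h q) \<longlongrightarrow> 1 + 0 * h 0) (at 0)"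
    by (intro tendsto_intros) (simp_all add: isCont_def)
  from filterlim_compose[OF this tendsto_qpar[of 1]]
  have "((\<lambda>\<tau>. 1 + qpar 1 \<tau> * h (qpar 1 \<tau>)) \<longlongrightarrow> 1) at_i_infinity" by simp
  then show ?thesis
  proof (rule Lim_transform_eventually)
    show "\<forall>\<^sub>F \<tau> in at_i_infinity. 1 + qpar 1 \<tau> * h (qpar 1 \<tau>) = j \<tau> * qpar 1 \<tau>"
      using eventually_uhp by eventually_elim (simp add: h(2) algebra_simps)
  qed
qed

lemma j_at_infinity: "filterlim j at_infinity at_i_infinity"
proof -
  have "((\<lambda>\<tau>. inverse (j \<tau> * qpar 1 \<tau>) * qpar 1 \<tau>) \<longlongrightarrow> inverse 1 * 0) at_i_infinity"
    using tendsto_qpar[of 1] by (intro tendsto_intros j_qpar_limit) (auto simp: filterlim_at)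
  then have "((\<lambda>\<tau>. inverse (j \<tau>)) \<longlongrightarrow> 0) at_i_infinity"
    by (simp add: field_simps)
  moreover have "\<forall>\<^sub>F \<tau> in at_i_infinity. j \<tau> \<noteq> 0"
  proof -
    have "\<forall>\<^sub>F \<tau> in at_i_infinity. j \<tau> * qpar 1 \<tau> \<noteq> 0"
      by (rule tendsto_imp_eventually_ne[OF j_qpar_limit]) simp
    then show ?thesis by eventually_elim auto
  qed
  ultimately have "filterlim (\<lambda>\<tau>. inverse (j \<tau>)) (at 0) at_i_infinity"
    by (simp add: filterlim_at)
  then have "filterlim (\<lambda>\<tau>. inverse (inverse (j \<tau>))) at_infinity at_i_infinity"
    by (rule filterlim_compose[OF filterlim_inverse_at_infinity])
  then show ?thesis by simp
qed

lemma infinite_cusp_matrix: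
  assumes "A \<in> SL2Z" "\<not> finite_cusp A"
  obtains G k where "G \<in> Gamma0 N" "\<And>\<tau>. \<tau> \<in> uhp \<Longrightarrow> moebius A \<tau> = moebius G (\<tau> + of_int k)"
proof -
  obtain G where G: "G \<in> Gamma0 N" "cusp_act A None = cusp_act G None"
    using assms unfolding finite_cusp_def cusp_equiv_def by auto
  obtain k where k: "A = G ** transl k \<or> A = - (G ** transl k)"
    using cusp_stabilizer_coset[OF assms(1) Gamma0_SL2Z[OF G(1)] G(2)] .
  have "moebius A \<tau> = moebius G (\<tau> + of_int k)" if "\<tau> \<in> uhp" for \<tau>
  proof -
    have "moebius (G ** transl k) \<tau> = moebius G (\<tau> + of_int k)"
      using that by (subst moebius_mult) (auto simp: SL2Z_det[OF transl_SL2Z])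
    with k show ?thesis by auto
  qed
  with G(1) show ?thesis by (rule that)
qed

lemma j_infinite_cusp:
  assumes "A \<in> SL2Z" "\<not> finite_cusp A"
  obtains k where "\<And>\<tau>. \<tau> \<in> uhp \<Longrightarrow> j (moebius A \<tau>) = j (\<tau> + of_int k)"
proof -
  obtain G k where G: "G \<in> Gamma0 N" "\<And>\<tau>. \<tau> \<in> uhp \<Longrightarrow> moebius A \<tau> = moebius G (\<tau> + of_int k)"
    using infinite_cusp_matrix[OF assms] by metis
  have "\<tau> + of_int k \<in> uhp" if "\<tau> \<in> uhp" for \<tau> using that by (simp add: uhp_def)
  then show ?thesis using that[of k] G j_inv by simp
qed

lemma filterlim_shift_at_i_infinity: "filterlim (\<lambda>\<tau>. \<tau> + of_int k) at_i_infinity at_i_infinity"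
  by (simp add: filterlim_filtercomap_iff o_def filterlim_filtercomap)

lemma j_pole_at_infinite_cusp:
  assumes "A \<in> SL2Z" "\<not> finite_cusp A"
  shows "filterlim (\<lambda>\<tau>. j (moebius A \<tau>)) at_infinity at_i_infinity"
proof -
  obtain k where k: "\<And>\<tau>. \<tau> \<in> uhp \<Longrightarrow> j (moebius A \<tau>) = j (\<tau> + of_int k)" using j_infinite_cusp[OF assms] by blast
  have "filterlim (\<lambda>\<tau>. j (\<tau> + of_int k)) at_infinity at_i_infinity"
    by (rule filterlim_compose[OF j_at_infinity filterlim_shift_at_i_infinity])
  then show ?thesis
    by (rule filterlim_mono_eventually) (use eventually_uhp in \<open>auto elim!: eventually_mono simp: k\<close>)
qed

lemma j_nonconstant: "\<not> j constant_on uhp"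
proof
  assume "j constant_on uhp"
  then obtain c where c: "\<And>\<tau>. \<tau> \<in> uhp \<Longrightarrow> j \<tau> = c" unfolding constant_on_def by blast
  have "filterlim (\<lambda>_. c) at_infinity at_i_infinity"
    by (rule filterlim_mono_eventually[OF j_at_infinity])
      (use eventually_uhp in \<open>auto elim!: eventually_mono simp: c\<close>)
  moreover have "((\<lambda>_::complex. c) \<longlongrightarrow> c) at_i_infinity" by simp
  ultimately show False
    using not_tendsto_and_filterlim_at_infinity[of at_i_infinity] by auto
qed

lemma not_finite_cusp_one: "\<not> finite_cusp (mat 1)"
  by (simp add: finite_cusp_def cusp_equiv_refl)

lemma open_j_image: "open U \<Longrightarrow> U \<subseteq> uhp \<Longrightarrow> open (j ` U)"
  using open_mapping_thm[OF j_hol open_uhp connected_uhp _ _ j_nonconstant] .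

text \<open>Otherwise \<open>1 / (j - c)\<close> would be holomorphic with limits at all cusps, hence constant; but it is
  nowhere zero and tends to zero at infinity.\<close>

lemma j_surjective:
  "(\<exists>\<tau>\<in>uhp. j \<tau> = c) \<or> (\<exists>A\<in>SL2Z. finite_cusp A \<and> ((\<lambda>\<tau>. j (moebius A \<tau>)) \<longlongrightarrow> c) at_i_infinity)"
proof (rule ccontr)
  assume contra: "\<not> ?thesis"
  then have ne: "\<And>\<tau>. \<tau> \<in> uhp \<Longrightarrow> j \<tau> \<noteq> c" by blast
  define f where "f \<tau> = inverse (j \<tau> - c)" for \<tau>
  have inf: "((\<lambda>\<tau>. f (moebius A \<tau>)) \<longlongrightarrow> 0) at_i_infinity" if A: "A \<in> SL2Z" "\<not> finite_cusp A" for A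
  proof -
    have "filterlim (\<lambda>\<tau>. j (moebius A \<tau>) + (- c)) at_infinity at_i_infinity"
      by (rule tendsto_add_filterlim_at_infinity'[OF j_pole_at_infinite_cusp[OF A] tendsto_const])
    from filterlim_compose[OF tendsto_inverse_0 this] show ?thesis by (simp add: f_def)
  qed
  have "\<exists>L. ((\<lambda>\<tau>. f (moebius A \<tau>)) \<longlongrightarrow> L) at_i_infinity" if A: "A \<in> SL2Z" for A
  proof (cases "finite_cusp A")
    case True
    then obtain L where L: "((\<lambda>\<tau>. j (moebius A \<tau>)) \<longlongrightarrow> L) at_i_infinity" using j_limit[OF A] by blast
    then have "L \<noteq> c" using contra A True by blast
    then have "((\<lambda>\<tau>. f (moebius A \<tau>)) \<longlongrightarrow> inverse (L - c)) at_i_infinity"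
      unfolding f_def by (intro tendsto_intros L) simp
    then show ?thesis by blast
  qed (use inf A in blast)
  moreover have "f holomorphic_on uhp"
    unfolding f_def[abs_def] using ne by (intro holomorphic_intros j_hol) auto
  ultimately obtain d where d: "\<And>\<tau>. \<tau> \<in> uhp \<Longrightarrow> f \<tau> = d"
    using modular_Liouville[OF N_pos, of f] j_inv by (auto simp: f_def)
  have "(f \<longlongrightarrow> 0) at_i_infinity" using inf[OF SL2Z_one not_finite_cusp_one] by simp
  moreover have "(f \<longlongrightarrow> d) at_i_infinity"
    by (rule tendsto_eventually) (use eventually_uhp in \<open>auto elim!: eventually_mono simp: d\<close>)
  ultimately have "d = 0" using tendsto_unique[OF at_i_infinity_neq_bot] by metis
  moreover have "\<i> \<in> uhp" by (simp add: uhp_def)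
  ultimately show False using d[of \<i>] ne[of \<i>] by (simp add: f_def)
qed

end

lemma locally_injective_at_regular_point:
  assumes "f holomorphic_on S" "z \<in> S" "open S" "deriv f z \<noteq> 0"
  shows "\<exists>r>0. ball z r \<subseteq> S \<and> inj_on f (ball z r)"
  by (rule has_complex_derivative_locally_injective[OF assms]) blast

context genus_zero_hauptmodul
begin

subsection \<open>Injectivity on the upper half plane\<close>

text \<open>The pole at infinity is simple, so \<open>1 / j\<close> has a simple zero in the parameter there and is
  injective near it.\<close>

lemma j_injective_near_infinity:
  obtains y where "y > 0" "\<And>\<tau> \<tau>'. Im \<tau> > y \<Longrightarrow> Im \<tau>' > y \<Longrightarrow> j \<tau> = j \<tau>' \<Longrightarrow> Gamma0_related N \<tau> \<tau>'"
proof -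
  obtain h where h: "h holomorphic_on ball 0 1" "\<And>\<tau>. \<tau> \<in> uhp \<Longrightarrow> j \<tau> = inverse (qpar 1 \<tau>) + h (qpar 1 \<tau>)"
    using j_expansion by blast
  \<comment> \<open>The function \<open>1 / j\<close> in the parameter \<open>q\<close>.\<close>
  define P where "P q = q / (1 + q * h q)" for q
  have "isCont h 0" using holomorphic_on_imp_continuous_on[OF h(1)] by (simp add: continuous_on_eq_continuous_at)
  then have "isCont (\<lambda>q. 1 + q * h q) 0" by (intro continuous_intros)
  then have "((\<lambda>q. 1 + q * h q) \<longlongrightarrow> 1) (nhds 0)"
    by (simp add: isCont_def tendsto_nhds_iff)
  then have "\<forall>\<^sub>F q in nhds 0. 1 + q * h q \<noteq> 0"
    by (rule tendsto_imp_eventually_ne) simp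
  then obtain R0 where R0: "R0 > 0" "\<And>q. q \<in> ball 0 R0 \<Longrightarrow> 1 + q * h q \<noteq> 0"
    unfolding eventually_nhds_metric by (auto simp: dist_commute)
  define R where "R = min R0 1"
  have R: "R > 0" "R \<le> 1" "\<And>q. q \<in> ball 0 R \<Longrightarrow> 1 + q * h q \<noteq> 0" using R0 by (auto simp: R_def)
  have hR: "h holomorphic_on ball 0 R" by (rule holomorphic_on_subset[OF h(1)]) (use R in auto)
  have P: "P holomorphic_on ball 0 R"
    unfolding P_def[abs_def] by (intro holomorphic_intros hR) (use R in auto)
  have "deriv P 0 = 1"
  proof (rule DERIV_imp_deriv)
    have dh: "(h has_field_derivative deriv h 0) (at 0)"
      using hR R by (intro holomorphic_derivI[OF _ open_ball]) auto
    have "((\<lambda>q. 1 + q * h q) has_field_derivative 0 + (1 * h 0 + deriv h 0 * 0)) (at 0)"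
      by (intro DERIV_add DERIV_const DERIV_mult DERIV_ident dh)
    from DERIV_divide[OF DERIV_ident this] show "(P has_field_derivative 1) (at 0)"
      unfolding P_def[abs_def] by simp
  qed
  then have dP: "deriv P 0 \<noteq> 0" by simp
  have zR: "0 \<in> ball (0::complex) R" using R(1) by simp
  obtain r where r: "r > 0" "ball (0::complex) r \<subseteq> ball 0 R" "inj_on P (ball 0 r)"
    using locally_injective_at_regular_point[OF P zR open_ball dP] by auto
  define y where "y = max 1 (- ln r / (2 * pi))"
  show ?thesis
  proof (rule that[of y])
    show "y > 0" by (simp add: y_def)
    have *: "\<tau> \<in> uhp \<and> qpar 1 \<tau> \<in> ball 0 r \<and> inverse (j \<tau>) = P (qpar 1 \<tau>)" if "Im \<tau> > y" for \<tau>
    proof -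
      have "Im \<tau> > 0" using that by (simp add: y_def)
      then have u: "\<tau> \<in> uhp" by (simp add: uhp_def)
      have "- ln r / (2 * pi) < Im \<tau>" using that by (simp add: y_def)
      then have "- 2 * pi * Im \<tau> < ln r" by (simp add: field_simps)
      then have "exp (- 2 * pi * Im \<tau>) < r" using r(1) by (metis exp_less_cancel_iff exp_ln)
      then have q: "qpar 1 \<tau> \<in> ball 0 r" by (simp add: norm_qpar)
      have "1 + qpar 1 \<tau> * h (qpar 1 \<tau>) \<noteq> 0" using q r(2) R(3) by blast
      then have "inverse (j \<tau>) = P (qpar 1 \<tau>)"
        unfolding h(2)[OF u] P_def by (simp add: field_simps)
      with u q show ?thesis by blast
    qed
    fix \<tau> \<tau>' assume t: "Im \<tau> > y" "Im \<tau>' > y" "j \<tau> = j \<tau>'"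
    then have "P (qpar 1 \<tau>) = P (qpar 1 \<tau>')" using *[of \<tau>] *[of \<tau>'] by simp
    then have "qpar 1 \<tau>' = qpar 1 \<tau>" using *[OF t(1)] *[OF t(2)] r(3) by (auto dest: inj_onD)
    then obtain k :: int where "\<tau>' = \<tau> + of_nat 1 * of_int k" using qpar_eqD[of 1 \<tau>' \<tau>] by auto
    then show "Gamma0_related N \<tau> \<tau>'" using Gamma0_related_shift[of N \<tau> k] by simp
  qed
qed

definition double_values :: "complex set" where
  "double_values = {j \<tau> | \<tau> \<tau>'. \<tau> \<in> uhp \<and> \<tau>' \<in> uhp \<and> j \<tau> = j \<tau>' \<and> \<not> Gamma0_related N \<tau> \<tau>'}"

text \<open>At these values the fibre may degenerate: a sequence of two distinct points in a fibre may
  merge or escape to a cusp.\<close>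

definition exceptional_values :: "complex set" where
  "exceptional_values = j ` {\<tau> \<in> uhp. deriv j \<tau> = 0} \<union>
     {L. \<exists>A\<in>SL2Z. ((\<lambda>\<tau>. j (moebius A \<tau>)) \<longlongrightarrow> L) at_i_infinity}"

text \<open>Both preimages persist for nearby values by the open mapping theorem, and they stay
  inequivalent.\<close>

lemma open_double_values: "open double_values"
  unfolding open_subopen[of double_values]
proof
  fix c assume "c \<in> double_values"
  then obtain \<tau> \<tau>' where t: "\<tau> \<in> uhp" "\<tau>' \<in> uhp" "c = j \<tau>" "j \<tau> = j \<tau>'" "\<not> Gamma0_related N \<tau> \<tau>'"
    unfolding double_values_def by blast
  obtain r where r: "r > 0" "\<And>x y. x \<in> ball \<tau> r \<inter> uhp \<Longrightarrow> y \<in> ball \<tau>' r \<inter> uhp \<Longrightarrow> \<not> Gamma0_related N x y"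
    using unrelated_neighbourhoods[OF t(1,2,5)] by blast
  show "\<exists>T. open T \<and> c \<in> T \<and> T \<subseteq> double_values"
  proof (intro exI conjI)
    show "open (j ` (ball \<tau> r \<inter> uhp) \<inter> j ` (ball \<tau>' r \<inter> uhp))"
      by (intro open_Int open_j_image open_uhp open_ball) auto
    show "c \<in> j ` (ball \<tau> r \<inter> uhp) \<inter> j ` (ball \<tau>' r \<inter> uhp)"
      using t r(1) by (intro IntI) (metis IntI centre_in_ball imageI)+
    show "j ` (ball \<tau> r \<inter> uhp) \<inter> j ` (ball \<tau>' r \<inter> uhp) \<subseteq> double_values"
    proof
      fix v assume "v \<in> j ` (ball \<tau> r \<inter> uhp) \<inter> j ` (ball \<tau>' r \<inter> uhp)"
      then obtain x y where "x \<in> ball \<tau> r \<inter> uhp" "y \<in> ball \<tau>' r \<inter> uhp" "v = j x" "j x = j y" by auto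
      then show "v \<in> double_values"
        using r(2)[of x y] unfolding double_values_def by (intro CollectI exI[of _ x] exI[of _ y]) auto
    qed
  qed
qed

text \<open>Zeros of a nonzero derivative are isolated, and there are countably many integral matrices.\<close>

lemma countable_exceptional_values: "countable exceptional_values"
proof -
  have dj: "deriv j holomorphic_on uhp" by (intro holomorphic_deriv j_hol open_uhp)
  have "fsigma uhp"
    unfolding fsigma_Union_compact
    by (rule open_Union_compact_subsets[OF open_uhp]) (metis image_subset_iff mem_Collect_eq)
  have "countable {\<tau> \<in> uhp. deriv j \<tau> = 0}"
  proof (cases "deriv j constant_on uhp")
    case True
    then obtain c where c: "\<And>\<tau>. \<tau> \<in> uhp \<Longrightarrow> deriv j \<tau> = c" unfolding constant_on_def by blast
    have "c \<noteq> 0"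
    proof
      assume "c = 0"
      then have "(j has_field_derivative 0) (at \<tau>)" if "\<tau> \<in> uhp" for \<tau>
        using holomorphic_derivI[OF j_hol open_uhp that] c[OF that] by simp
      then have "j constant_on uhp"
        using DERIV_zero_connected_constant_on[OF connected_uhp open_uhp, of "{}" j] holomorphic_on_imp_continuous_on[OF j_hol]
        by auto
      then show False using j_nonconstant by blast
    qed
    then have "{\<tau> \<in> uhp. deriv j \<tau> = 0} = {}" using c by blast
    then show ?thesis by (metis countable_empty)
  next
    case False
    then show ?thesis
      by (intro holomorphic_countable_zeros dj open_uhp connected_uhp \<open>fsigma uhp\<close>)
  qed
  moreover have "countable {L. \<exists>A\<in>SL2Z. ((\<lambda>\<tau>. j (moebius A \<tau>)) \<longlongrightarrow> L) at_i_infinity}"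
  proof (rule countable_subset)
    show "{L. \<exists>A\<in>SL2Z. ((\<lambda>\<tau>. j (moebius A \<tau>)) \<longlongrightarrow> L) at_i_infinity} \<subseteq>
        range (\<lambda>(a, b, c, d). Lim at_i_infinity (\<lambda>\<tau>. j (moebius (M2 a b c d) \<tau>)))"
    proof safe
      fix L A assume "((\<lambda>\<tau>. j (moebius A \<tau>)) \<longlongrightarrow> L) at_i_infinity"
      then have "L = Lim at_i_infinity (\<lambda>\<tau>. j (moebius (M2 (A$1$1) (A$1$2) (A$2$1) (A$2$2)) \<tau>))"
        by (simp add: M2_eta tendsto_Lim)
      then show "L \<in> range (\<lambda>(a, b, c, d). Lim at_i_infinity (\<lambda>\<tau>. j (moebius (M2 a b c d) \<tau>)))"
        by (intro range_eqI[of _ _ "(A$1$1, A$1$2, A$2$1, A$2$2)"]) simp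
    qed
  qed simp
  ultimately show ?thesis unfolding exceptional_values_def by simp
qed

text \<open>A sequence of points with convergent values cannot approach a cusp unless the limit is the
  value there.\<close>

lemma fiber_compactness:
  fixes \<tau> :: "nat \<Rightarrow> complex"
  assumes "\<And>k. \<tau> k \<in> uhp" "(\<lambda>k. j (\<tau> k)) \<longlonglongrightarrow> c" "c \<notin> exceptional_values"
  obtains r w w0 where "strict_mono (r :: nat \<Rightarrow> nat)" "\<And>k. w k \<in> uhp" "\<And>k. Gamma0_related N (\<tau> (r k)) (w k)"
    "w0 \<in> uhp" "w \<longlonglongrightarrow> w0" "j w0 = c"
proof -
  obtain A z G r where A: "A \<in> SL2Z" and r: "strict_mono (r :: nat \<Rightarrow> nat)" and z: "\<And>k. z k \<in> uhp"
    and G: "\<And>k. G k \<in> Gamma0 N" "\<And>k. \<tau> (r k) = moebius (G k) (moebius A (z k))"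
    and conv: "(\<exists>z0\<in>uhp. z \<longlonglongrightarrow> z0) \<or> filterlim z at_i_infinity sequentially"
    using modular_curve_compactness[of N \<tau>, OF N_pos assms(1)] by metis
  have Az: "moebius A (z k) \<in> uhp" for k by (intro moebius_in_uhp_SL2Z z A)
  have eq: "j (\<tau> (r k)) = j (moebius A (z k))" for k unfolding G(2) by (intro j_inv G Az)
  have lim: "(\<lambda>k. j (moebius A (z k))) \<longlonglongrightarrow> c"
    using LIMSEQ_subseq_LIMSEQ[OF assms(2) r] by (simp add: o_def eq)
  from conv show ?thesis
  proof
    assume "\<exists>z0\<in>uhp. z \<longlonglongrightarrow> z0"
    then obtain z0 where z0: "z0 \<in> uhp" "z \<longlonglongrightarrow> z0" by blast
    define w0 where "w0 = moebius A z0"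
    have w0: "w0 \<in> uhp" unfolding w0_def by (intro moebius_in_uhp_SL2Z z0 A)
    have w: "(\<lambda>k. moebius A (z k)) \<longlonglongrightarrow> w0"
      unfolding w0_def using continuous_moebius[of A z0] A z0
      by (intro isCont_tendsto_compose[of z0 "moebius A"]) (auto simp: SL2Z_det)
    have "isCont j w0" using holomorphic_on_imp_continuous_on[OF j_hol] open_uhp w0
      by (simp add: continuous_on_eq_continuous_at)
    then have "(\<lambda>k. j (moebius A (z k))) \<longlonglongrightarrow> j w0" using w by (rule isCont_tendsto_compose)
    then have "j w0 = c" using lim by (rule LIMSEQ_unique)
    moreover have "Gamma0_related N (\<tau> (r k)) (moebius A (z k))" for k
      by (rule Gamma0_related_sym[OF Az]) (use G in \<open>auto simp: Gamma0_related_def\<close>)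
    ultimately show ?thesis using that[OF r Az _ w0 w] by simp
  next
    assume inf: "filterlim z at_i_infinity sequentially"
    show ?thesis
    proof (cases "finite_cusp A")
      case True
      then obtain L where L: "((\<lambda>\<tau>. j (moebius A \<tau>)) \<longlongrightarrow> L) at_i_infinity" using j_limit[OF A] by blast
      have "c = L" by (rule LIMSEQ_unique[OF lim filterlim_compose[OF L inf]])
      then have "c \<in> exceptional_values"
        unfolding exceptional_values_def using L A by (intro UnI2 CollectI bexI[of _ A]) auto
      then show ?thesis using assms(3) by contradiction
    next
      case False
      have "filterlim (\<lambda>k. j (moebius A (z k))) at_infinity sequentially"
        by (rule filterlim_compose[OF j_pole_at_infinite_cusp[OF A False] inf])
      from not_tendsto_and_filterlim_at_infinity[OF sequentially_bot lim this] show ?thesis ..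
    qed
  qed
qed

text \<open>Two inequivalent preimages converge along a subsequence. If the limits are equivalent, they may be
  taken equal, and then local injectivity of \<open>j\<close> contradicts inequivalence.\<close>

lemma double_values_relatively_closed: "closure double_values \<subseteq> double_values \<union> exceptional_values"
proof
  fix c assume "c \<in> closure double_values"
  then obtain v where v: "\<And>k. v k \<in> double_values" "v \<longlonglongrightarrow> c" unfolding closure_sequential by blast
  have "\<exists>\<tau> \<tau>'. v k = j \<tau> \<and> \<tau> \<in> uhp \<and> \<tau>' \<in> uhp \<and> j \<tau> = j \<tau>' \<and> \<not> Gamma0_related N \<tau> \<tau>'" for k
    using v(1)[of k] unfolding double_values_def by blast
  then obtain \<tau> \<tau>' where t: "\<And>k. v k = j (\<tau> k)" "\<And>k. \<tau> k \<in> uhp" "\<And>k. \<tau>' k \<in> uhp"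
    "\<And>k. j (\<tau> k) = j (\<tau>' k)" "\<And>k. \<not> Gamma0_related N (\<tau> k) (\<tau>' k)" by metis
  show "c \<in> double_values \<union> exceptional_values"
  proof (rule ccontr)
    assume "\<not> ?thesis"
    then have ce: "c \<notin> exceptional_values" and cd: "c \<notin> double_values" by auto
    have lim: "(\<lambda>k. j (\<tau> k)) \<longlonglongrightarrow> c" using v(2) unfolding t(1)[abs_def] .
    obtain r w w0 where r: "strict_mono (r :: nat \<Rightarrow> nat)" and w: "\<And>k. w k \<in> uhp" "\<And>k. Gamma0_related N (\<tau> (r k)) (w k)"
      "w0 \<in> uhp" "w \<longlonglongrightarrow> w0" "j w0 = c"
      using fiber_compactness[OF t(2) lim ce] by blast
    have lim': "(\<lambda>k. j (\<tau>' (r k))) \<longlonglongrightarrow> c"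
      using LIMSEQ_subseq_LIMSEQ[OF lim r] by (simp add: o_def t(4))
    obtain r' x x0 where r': "strict_mono (r' :: nat \<Rightarrow> nat)" and x: "\<And>k. x k \<in> uhp"
      "\<And>k. Gamma0_related N (\<tau>' (r (r' k))) (x k)" "x0 \<in> uhp" "x \<longlonglongrightarrow> x0" "j x0 = c"
      using fiber_compactness[of "\<lambda>k. \<tau>' (r k)", OF t(3) lim' ce] by blast
    have "Gamma0_related N w0 x0"
      using cd w x unfolding double_values_def by auto
    then obtain G where G: "G \<in> Gamma0 N" "x0 = moebius G w0" unfolding Gamma0_related_def by blast
    define y where "y k = moebius G (w (r' k))" for k
    have yu: "y k \<in> uhp" for k unfolding y_def by (intro moebius_in_uhp_Gamma0[OF w(1) G(1)])
    have ylim: "y \<longlonglongrightarrow> x0"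
      unfolding y_def[abs_def] G(2)
      using LIMSEQ_subseq_LIMSEQ[OF w(4) r'] continuous_moebius[of G w0] w(3) G(1)
      by (intro isCont_tendsto_compose[of w0 "moebius G"]) (auto simp: Gamma0_det o_def)
    have jy: "j (y k) = j (x k)" for k
    proof -
      have "j (y k) = j (w (r' k))" unfolding y_def by (intro j_inv G w)
      also have "\<dots> = j (\<tau> (r (r' k)))" by (intro j_related w t)
      also have "\<dots> = j (\<tau>' (r (r' k)))" by (rule t)
      also have "\<dots> = j (x k)" by (intro j_related[symmetric] x t)
      finally show ?thesis .
    qed
    have "deriv j x0 \<noteq> 0" using ce x(3,5) unfolding exceptional_values_def by blast
    then obtain e where e: "e > 0" "ball x0 e \<subseteq> uhp" "inj_on j (ball x0 e)"
      using locally_injective_at_regular_point[OF j_hol x(3) open_uhp] by blast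
    have "\<forall>\<^sub>F k in sequentially. y k \<in> ball x0 e \<and> x k \<in> ball x0 e"
      using tendstoD[OF ylim e(1)] tendstoD[OF x(4) e(1)] by eventually_elim (simp add: dist_commute)
    then obtain k where k: "y k \<in> ball x0 e" "x k \<in> ball x0 e" by (auto simp: eventually_sequentially)
    have yx: "y k = x k" using inj_onD[OF e(3) jy k] .
    have "Gamma0_related N (\<tau> (r (r' k))) (w (r' k))" by (rule w)
    moreover have "Gamma0_related N (w (r' k)) (x k)"
      unfolding yx[symmetric] y_def Gamma0_related_def using G by blast
    moreover have "Gamma0_related N (x k) (\<tau>' (r (r' k)))" by (rule Gamma0_related_sym[OF _ x(2)]) (rule t)
    ultimately have "Gamma0_related N (\<tau> (r (r' k))) (\<tau>' (r (r' k)))"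
      by (blast intro: Gamma0_related_trans[OF t(2)] Gamma0_related_trans[OF w(1)])
    then show False using t(5) by blast
  qed
qed

text \<open>By compactness a subsequence converges up to equivalence, and infinity is the only place where \<open>j\<close> is
  unbounded.\<close>

lemma representatives_near_infinity:
  fixes \<tau> :: "nat \<Rightarrow> complex"
  assumes "\<And>k. \<tau> k \<in> uhp" "filterlim (\<lambda>k. j (\<tau> k)) at_infinity sequentially"
  obtains r x where "strict_mono (r :: nat \<Rightarrow> nat)" "\<And>k. x k \<in> uhp" "\<And>k. Gamma0_related N (\<tau> (r k)) (x k)"
    "filterlim x at_i_infinity sequentially"
proof -
  obtain A z G r where A: "A \<in> SL2Z" and r: "strict_mono (r :: nat \<Rightarrow> nat)" and z: "\<And>k. z k \<in> uhp"
    and G: "\<And>k. G k \<in> Gamma0 N" "\<And>k. \<tau> (r k) = moebius (G k) (moebius A (z k))"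
    and conv: "(\<exists>z0\<in>uhp. z \<longlonglongrightarrow> z0) \<or> filterlim z at_i_infinity sequentially"
    using modular_curve_compactness[of N \<tau>, OF N_pos assms(1)] by metis
  have Az: "moebius A (z k) \<in> uhp" for k by (intro moebius_in_uhp_SL2Z z A)
  have eq: "j (\<tau> (r k)) = j (moebius A (z k))" for k unfolding G(2) by (intro j_inv G Az)
  have lim: "filterlim (\<lambda>k. j (moebius A (z k))) at_infinity sequentially"
    using filterlim_compose[OF assms(2) filterlim_subseq[OF r]] by (simp add: eq)
  note no = not_tendsto_and_filterlim_at_infinity[OF sequentially_bot _ lim]
  have inf: "filterlim z at_i_infinity sequentially"
    using conv
  proof
    assume "\<exists>z0\<in>uhp. z \<longlonglongrightarrow> z0"
    then obtain z0 where z0: "z0 \<in> uhp" "z \<longlonglongrightarrow> z0" by blast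
    have "continuous_on uhp (\<lambda>\<tau>. j (moebius A \<tau>))"
      using holomorphic_compose_moebius[OF j_hol, of A] A
      by (intro holomorphic_on_imp_continuous_on) (auto simp: SL2Z_det)
    then have "isCont (\<lambda>\<tau>. j (moebius A \<tau>)) z0"
      using z0 open_uhp by (simp add: continuous_on_eq_continuous_at)
    from isCont_tendsto_compose[OF this z0(2)] show ?thesis using no by blast
  qed
  have "\<not> finite_cusp A"
  proof
    assume "finite_cusp A"
    then obtain L where L: "((\<lambda>\<tau>. j (moebius A \<tau>)) \<longlongrightarrow> L) at_i_infinity" using j_limit[OF A] by blast
    from filterlim_compose[OF L inf] show False by (rule no)
  qed
  then obtain H m where H: "H \<in> Gamma0 N" "\<And>\<tau>. \<tau> \<in> uhp \<Longrightarrow> moebius A \<tau> = moebius H (\<tau> + of_int m)"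
    using infinite_cusp_matrix[OF A] by metis
  show ?thesis
  proof (rule that[of r "\<lambda>k. z k + of_int m"])
    show zm: "z k + of_int m \<in> uhp" for k using z[of k] by (simp add: uhp_def)
    show "Gamma0_related N (\<tau> (r k)) (z k + of_int m)" for k
    proof (rule Gamma0_related_sym[OF zm])
      have "\<tau> (r k) = moebius (G k ** H) (z k + of_int m)"
        using zm H(1) by (subst moebius_mult) (auto simp: G(2) H(2)[OF z] Gamma0_det)
      then show "Gamma0_related N (z k + of_int m) (\<tau> (r k))"
        unfolding Gamma0_related_def using Gamma0_mult[OF G(1) H(1)] by blast
    qed
    show "filterlim (\<lambda>k. z k + of_int m) at_i_infinity sequentially"
      by (rule filterlim_compose[OF filterlim_shift_at_i_infinity inf])
  qed (rule r)
qed

text \<open>Points with large values have representatives near infinity, where \<open>j\<close> is injective.\<close>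

lemma bounded_double_values: "bounded double_values"
proof (rule ccontr)
  assume "\<not> bounded double_values"
  then have "\<exists>v\<in>double_values. norm v > real k" for k
    unfolding bounded_iff by (auto simp: not_le)
  then have "\<exists>\<tau> \<tau>'. norm (j \<tau>) > real k \<and> \<tau> \<in> uhp \<and> \<tau>' \<in> uhp \<and> j \<tau> = j \<tau>' \<and> \<not> Gamma0_related N \<tau> \<tau>'" for k
    unfolding double_values_def by fastforce
  then obtain \<tau> \<tau>' where t: "\<And>k. norm (j (\<tau> k)) > real k" "\<And>k. \<tau> k \<in> uhp" "\<And>k. \<tau>' k \<in> uhp"
    "\<And>k. j (\<tau> k) = j (\<tau>' k)" "\<And>k. \<not> Gamma0_related N (\<tau> k) (\<tau>' k)" by metis
  have "filterlim (\<lambda>k. norm (j (\<tau> k))) at_top sequentially"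
    by (rule filterlim_at_top_mono[OF filterlim_real_sequentially])
      (use t(1) in \<open>auto intro!: always_eventually less_imp_le\<close>)
  then have lim: "filterlim (\<lambda>k. j (\<tau> k)) at_infinity sequentially"
    by (simp add: filterlim_at_infinity_conv_norm_at_top)
  obtain r x where r: "strict_mono (r :: nat \<Rightarrow> nat)" and x: "\<And>k. x k \<in> uhp" "\<And>k. Gamma0_related N (\<tau> (r k)) (x k)"
    "filterlim x at_i_infinity sequentially" using representatives_near_infinity[OF t(2) lim] by blast
  have lim': "filterlim (\<lambda>k. j (\<tau>' (r k))) at_infinity sequentially"
    using filterlim_compose[OF lim filterlim_subseq[OF r]] by (simp add: t(4))
  obtain r' x' where r': "strict_mono (r' :: nat \<Rightarrow> nat)" and x': "\<And>k. x' k \<in> uhp"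
    "\<And>k. Gamma0_related N (\<tau>' (r (r' k))) (x' k)" "filterlim x' at_i_infinity sequentially"
    using representatives_near_infinity[of "\<lambda>k. \<tau>' (r k)", OF t(3) lim'] by blast
  obtain y where y: "\<And>\<tau> \<tau>'. Im \<tau> > y \<Longrightarrow> Im \<tau>' > y \<Longrightarrow> j \<tau> = j \<tau>' \<Longrightarrow> Gamma0_related N \<tau> \<tau>'"
    using j_injective_near_infinity by metis
  have ev: "\<forall>\<^sub>F \<tau> in at_i_infinity. Im \<tau> > y" by (auto simp: eventually_at_i_infinity)
  have "\<forall>\<^sub>F k in sequentially. Im (x (r' k)) > y \<and> Im (x' k) > y"
    using filterlim_compose[OF x(3) filterlim_subseq[OF r']] x'(3) ev
    by (intro eventually_conj) (auto simp: filterlim_iff)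
  then obtain k where k: "Im (x (r' k)) > y" "Im (x' k) > y" by (auto simp: eventually_sequentially)
  have "j (x (r' k)) = j (\<tau> (r (r' k)))" by (intro j_related x t)
  also have "\<dots> = j (\<tau>' (r (r' k)))" by (rule t)
  also have "\<dots> = j (x' k)" by (intro j_related[symmetric] x' t)
  finally have "Gamma0_related N (x (r' k)) (x' k)" using y k by blast
  moreover have "Gamma0_related N (x' k) (\<tau>' (r (r' k)))" by (rule Gamma0_related_sym[OF _ x'(2)]) (rule t)
  ultimately have "Gamma0_related N (\<tau> (r (r' k))) (\<tau>' (r (r' k)))"
    using Gamma0_related_trans[OF t(2)] Gamma0_related_trans[OF x(1)] x(2)[of "r' k"] by blast
  then show False using t(5) by blast
qed

text \<open>The values taken at two inequivalent points form an open and bounded set that is relatively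
  closed outside a countable set of exceptional values. The complement of a countable set in the
  plane is connected and unbounded, so no value is taken twice.\<close>

theorem j_injective:
  assumes "\<tau> \<in> uhp" "\<tau>' \<in> uhp" "j \<tau> = j \<tau>'"
  shows "Gamma0_related N \<tau> \<tau>'"
proof -
  let ?C = "- exceptional_values"
  have conn: "connected ?C"
    using path_connected_complement_countable[OF _ countable_exceptional_values]
    by (intro path_connected_imp_connected) simp
  have op: "openin (top_of_set ?C) (?C \<inter> double_values)"
    using open_double_values by (auto simp: openin_open)
  have "?C \<inter> double_values = ?C \<inter> closure double_values"
    using double_values_relatively_closed closure_subset[of double_values] by blast
  then have cl: "closedin (top_of_set ?C) (?C \<inter> double_values)"
    using closed_closure by (auto simp: closedin_closed)
  from conn op cl have "?C \<inter> double_values = {} \<or> ?C \<inter> double_values = ?C"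
    unfolding connected_clopen by blast
  then have sub: "double_values \<subseteq> exceptional_values"
  proof
    assume "?C \<inter> double_values = ?C"
    then have "?C \<subseteq> double_values" by blast
    then have "bounded ?C" using bounded_double_values bounded_subset by blast
    then obtain R where R: "?C \<subseteq> ball 0 R" using bounded_subset_ballD[of ?C 0] by blast
    \<comment> \<open>A ball outside the bound consists of exceptional values only, but it is uncountable.\<close>
    define v :: complex where "v = of_real (\<bar>R\<bar> + 1)"
    have "ball v 1 \<subseteq> exceptional_values"
    proof (rule ccontr)
      assume "\<not> ?thesis"
      then obtain w where w: "w \<in> ball v 1" "w \<in> ball 0 R" using R by blast
      then have "dist v 0 < 1 + R" using dist_triangle2[of v 0 w] by (auto simp: dist_commute)
      then show False by (simp add: v_def)
    qed
    then have "countable (ball v 1)" by (rule countable_subset[OF _ countable_exceptional_values])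
    then show ?thesis using uncountable_ball[of 1 v] by simp
  qed blast
  show ?thesis
  proof (rule ccontr)
    assume "\<not> ?thesis"
    then have "j \<tau> \<in> double_values" using assms unfolding double_values_def by blast
    then obtain e where "e > 0" "ball (j \<tau>) e \<subseteq> double_values"
      using open_double_values open_contains_ball by metis
    then have "ball (j \<tau>) e \<subseteq> exceptional_values" using sub by blast
    then have "countable (ball (j \<tau>) e)" by (rule countable_subset[OF _ countable_exceptional_values])
    then show False using uncountable_ball[OF \<open>e > 0\<close>] by blast
  qed
qed

subsection \<open>Values at the cusps\<close>

lemma cusp_expansion:
  assumes A: "A \<in> SL2Z" and L: "((\<lambda>\<tau>. j (moebius A \<tau>)) \<longlongrightarrow> L) at_i_infinity"
  obtains G where "G holomorphic_on ball 0 1" "G 0 = L" "\<And>\<tau>. \<tau> \<in> uhp \<Longrightarrow> j (moebius A \<tau>) = G (qpar N \<tau>)"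
    "\<not> G constant_on ball 0 1"
proof -
  have per: "j (moebius A (\<tau> + of_nat N)) = j (moebius A \<tau>)" if "\<tau> \<in> uhp" for \<tau>
    using invariant_at_cusp_periodic[of N j A "int N" \<tau>] j_inv A that by simp
  have "(\<lambda>\<tau>. j (moebius A \<tau>)) holomorphic_on uhp"
    using A by (intro holomorphic_compose_moebius j_hol) (simp add: SL2Z_det)
  then obtain G where G: "G holomorphic_on ball 0 1" "G 0 = L" "\<And>\<tau>. \<tau> \<in> uhp \<Longrightarrow> j (moebius A \<tau>) = G (qpar N \<tau>)"
    using periodic_expansion[OF _ N_pos per L] by blast
  have "\<not> G constant_on ball 0 1"
  proof
    assume "G constant_on ball 0 1"
    then obtain c where c: "\<And>q. q \<in> ball 0 1 \<Longrightarrow> G q = c" unfolding constant_on_def by blast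
    have "j \<tau> = c" if "\<tau> \<in> uhp" for \<tau>
    proof -
      have t: "moebius (adj2 A) \<tau> \<in> uhp" using that A by (intro moebius_in_uhp_SL2Z SL2Z_adj2)
      have "j \<tau> = j (moebius A (moebius (adj2 A) \<tau>))"
        using that A by (simp add: moebius_adj2 SL2Z_det)
      then show ?thesis using G(3)[OF t] c qpar_in_ball[OF N_pos t] by simp
    qed
    then show False using j_nonconstant unfolding constant_on_def by blast
  qed
  with G show ?thesis by (rule that)
qed

text \<open>All values near \<open>L\<close> are taken at points high up, by the open mapping theorem in the local
  parameter.\<close>

lemma cusp_neighbourhood_image:
  assumes A: "A \<in> SL2Z" and L: "((\<lambda>\<tau>. j (moebius A \<tau>)) \<longlongrightarrow> L) at_i_infinity"
  shows "\<exists>W. open W \<and> L \<in> W \<and> (\<forall>v\<in>W - {L}. \<exists>\<tau>\<in>uhp. Im \<tau> > y \<and> v = j (moebius A \<tau>))"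
proof -
  obtain G where G: "G holomorphic_on ball 0 1" "G 0 = L" "\<And>\<tau>. \<tau> \<in> uhp \<Longrightarrow> j (moebius A \<tau>) = G (qpar N \<tau>)"
    "\<not> G constant_on ball 0 1" using cusp_expansion[OF A L] by blast
  define e where "e = min 1 (exp (- 2 * pi * y / of_nat N))"
  have e: "e > 0" by (simp add: e_def)
  show ?thesis
  proof (intro exI[of _ "G ` ball 0 e"] conjI ballI)
    show "open (G ` ball 0 e)"
      by (rule open_mapping_thm[OF G(1) open_ball connected_ball open_ball _ G(4)]) (auto simp: e_def)
    show "L \<in> G ` ball 0 e" using G(2) e by force
    fix v assume "v \<in> G ` ball 0 e - {L}"
    then obtain q where q: "q \<in> ball 0 e" "v = G q" and "v \<noteq> L" by blast
    then have q0: "q \<noteq> 0" using G(2) by auto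
    have "q \<in> ball 0 1 - {0}" using q(1) q0 by (auto simp: e_def)
    then obtain \<tau> where t: "\<tau> \<in> uhp" "qpar N \<tau> = q" using qpar_surj[OF N_pos] by metis
    have "exp (- 2 * pi * Im \<tau> / of_nat N) < exp (- 2 * pi * y / of_nat N)"
      using q(1) t(2) norm_qpar[of N \<tau>] by (simp add: e_def)
    then have "- 2 * pi * Im \<tau> / of_nat N < - 2 * pi * y / of_nat N" by (simp only: exp_less_cancel_iff)
    then have "Im \<tau> > y" using N_pos by (simp add: divide_less_cancel field_simps)
    then show "\<exists>\<tau>\<in>uhp. Im \<tau> > y \<and> v = j (moebius A \<tau>)" using t q(2) G(3) by auto
  qed
qed

lemma open_contains_other:
  fixes U :: "complex set"
  assumes "open U" "L \<in> U"
  obtains v where "v \<in> U" "v \<noteq> L"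
proof -
  obtain e where "e > 0" "ball L e \<subseteq> U" using assms open_contains_ball by blast
  moreover have "L + of_real (e / 2) \<in> ball L e" using \<open>e > 0\<close> by (simp add: dist_norm norm_divide)
  ultimately have "L + of_real (e / 2) \<in> U" by blast
  then show ?thesis using \<open>e > 0\<close> by (intro that) auto
qed

text \<open>Values near a common value would be taken both near the point and near the cusp, at points
  that are inequivalent since their imaginary parts are too far apart.\<close>

lemma cusp_value_not_attained:
  assumes A: "A \<in> SL2Z" and L: "((\<lambda>\<tau>. j (moebius A \<tau>)) \<longlongrightarrow> L) at_i_infinity" and t: "\<tau>0 \<in> uhp"
  shows "j \<tau>0 \<noteq> L"
proof
  assume eq: "j \<tau>0 = L"
  \<comment> \<open>Points above height \<open>y\<close> are equivalent to points of height above \<open>y\<close> or below \<open>1 / y\<close> only, whereas heights near the given point lie between \<open>Im \<tau>0 / 2\<close> and \<open>2 * Im \<tau>0\<close>.\<close>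
  define y where "y = max (2 * Im \<tau>0) (2 / Im \<tau>0)"
  obtain W where W: "open W" "L \<in> W" "\<forall>v\<in>W - {L}. \<exists>\<tau>\<in>uhp. Im \<tau> > y \<and> v = j (moebius A \<tau>)"
    using cusp_neighbourhood_image[OF A L, of y] by blast
  define U where "U = uhp \<inter> {\<tau>. Im \<tau> > Im \<tau>0 / 2} \<inter> {\<tau>. Im \<tau> < 2 * Im \<tau>0}"
  have U: "open U" "\<tau>0 \<in> U" "U \<subseteq> uhp"
    unfolding U_def by (intro open_Int open_uhp open_halfspace_Im_gt open_halfspace_Im_lt) (use t in \<open>auto simp: uhp_def\<close>)
  have "open (j ` U \<inter> W)" "L \<in> j ` U \<inter> W" using open_j_image[OF U(1,3)] W(1,2) U(2) eq by auto
  then obtain v where v: "v \<in> j ` U \<inter> W" "v \<noteq> L" by (rule open_contains_other)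
  then obtain x where x: "x \<in> U" "v = j x" by blast
  obtain z where z: "z \<in> uhp" "Im z > y" "v = j (moebius A z)" using W(3) v by blast
  have "Gamma0_related N (moebius A z) x"
    using x z U(3) by (intro j_injective moebius_in_uhp_SL2Z A) auto
  then obtain G where G: "G \<in> Gamma0 N" "x = moebius G (moebius A z)" unfolding Gamma0_related_def by blast
  define B where "B = G ** A"
  have B: "B \<in> SL2Z" unfolding B_def by (intro SL2Z_mult A Gamma0_SL2Z[OF G(1)])
  have xB: "x = moebius B z" unfolding B_def G(2) using z(1) A by (subst moebius_mult) (auto simp: SL2Z_det)
  have t0: "Im \<tau>0 > 0" using t by (simp add: uhp_def)
  have xi: "Im x > Im \<tau>0 / 2" "Im x < 2 * Im \<tau>0" using x(1) by (auto simp: U_def)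
  show False
  proof (cases "B$2$1 = 0")
    case True
    then have "x = z + of_int (B$1$1 * B$1$2)" unfolding xB
      using upper_triangular_SL2Z[OF B True] by (metis moebius_transl moebius_uminus)
    then show False using xi z(2) by (simp add: y_def)
  next
    case False
    have "Im \<tau>0 / 2 * (2 / Im \<tau>0) < Im x * Im z"
      using xi(1) z(2) t0 by (intro mult_strict_mono) (auto simp: y_def)
    then show False using Im_moebius_le[OF B False z(1)] t0 by (simp add: xB)
  qed
qed

lemma cusp_values_distinct:
  assumes A: "A \<in> SL2Z" and L: "((\<lambda>\<tau>. j (moebius A \<tau>)) \<longlongrightarrow> L) at_i_infinity"
    and A': "A' \<in> SL2Z" and L': "((\<lambda>\<tau>. j (moebius A' \<tau>)) \<longlongrightarrow> L) at_i_infinity"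
  shows "cusp_equiv N (cusp_act A None) (cusp_act A' None)"
proof -
  obtain W where W: "open W" "L \<in> W" "\<forall>v\<in>W - {L}. \<exists>\<tau>\<in>uhp. Im \<tau> > 1 \<and> v = j (moebius A \<tau>)"
    using cusp_neighbourhood_image[OF A L, of 1] by blast
  obtain W' where W': "open W'" "L \<in> W'" "\<forall>v\<in>W' - {L}. \<exists>\<tau>\<in>uhp. Im \<tau> > 1 \<and> v = j (moebius A' \<tau>)"
    using cusp_neighbourhood_image[OF A' L', of 1] by blast
  have "open (W \<inter> W')" "L \<in> W \<inter> W'" using W(1,2) W'(1,2) by auto
  then obtain v where v: "v \<in> W \<inter> W'" "v \<noteq> L" by (rule open_contains_other)
  obtain z where z: "z \<in> uhp" "Im z > 1" "v = j (moebius A z)" using W(3) v by blast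
  obtain z' where z': "z' \<in> uhp" "Im z' > 1" "v = j (moebius A' z')" using W'(3) v by blast
  have "Gamma0_related N (moebius A z) (moebius A' z')"
    using z z' by (intro j_injective moebius_in_uhp_SL2Z A A') auto
  then obtain G where G: "G \<in> Gamma0 N" "moebius A' z' = moebius G (moebius A z)" unfolding Gamma0_related_def by blast
  define B where "B = adj2 A' ** (G ** A)"
  have B: "B \<in> SL2Z" unfolding B_def by (intro SL2Z_mult SL2Z_adj2 A A' Gamma0_SL2Z[OF G(1)])
  have "z' = moebius (adj2 A') (moebius A' z')" using z' A' by (simp add: moebius_adj2 SL2Z_det)
  also have "\<dots> = moebius B z"
    unfolding G(2) B_def using z(1) A G(1) moebius_in_uhp_SL2Z[OF z(1) A]
    by (simp add: moebius_mult SL2Z_det Gamma0_det det_mul)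
  finally have zB: "z' = moebius B z" .
  have "B$2$1 = 0"
  proof (rule ccontr)
    assume "B$2$1 \<noteq> 0"
    from Im_moebius_le[OF B this z(1)] have "Im z' * Im z \<le> 1" by (simp add: zB)
    moreover have "1 * 1 < Im z' * Im z" using z(2) z'(2) by (intro mult_strict_mono) auto
    ultimately show False by simp
  qed
  then have "cusp_act (G ** A) None = cusp_act A' None"
    unfolding B_def using A A' G(1) by (subst cusp_equiv_matrix_iff) (auto simp: SL2Z_det Gamma0_det det_mul)
  then have "cusp_act A' None = cusp_act G (cusp_act A None)"
    using A G(1) by (simp add: cusp_act_mult SL2Z_det Gamma0_det del: cusp_act.simps)
  then show ?thesis unfolding cusp_equiv_def using G(1) by blast
qed

end

section \<open>Exponential asymptotics at a cusp\<close>

definition cexp :: "real \<Rightarrow> complex \<Rightarrow> complex" where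
  "cexp \<kappa> \<tau> = exp (2 * of_real pi * \<i> * of_real \<kappa> * \<tau>)"

text \<open>The relation \<open>f \<tau> \<sim> C exp (2 \<pi> \<i> \<kappa> \<tau>)\<close> as \<open>\<tau>\<close> tends to infinity. Vanishing orders at cusps are
  measured by real exponents, because composing with \<open>\<tau> \<mapsto> (a \<tau> + b) / d\<close> multiplies them by \<open>a / d\<close>. With \<open>C = 0\<close> it
  is an upper bound.\<close>

definition cusp_asymp :: "(complex \<Rightarrow> complex) \<Rightarrow> real \<Rightarrow> complex \<Rightarrow> bool" where
  "cusp_asymp f \<kappa> C \<longleftrightarrow> ((\<lambda>\<tau>. f \<tau> * cexp (- \<kappa>) \<tau>) \<longlongrightarrow> C) at_i_infinity"

lemma cexp_nonzero [simp]: "cexp \<kappa> \<tau> \<noteq> 0"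
  by (simp add: cexp_def)

lemma cexp_add: "cexp (\<kappa> + \<kappa>') \<tau> = cexp \<kappa> \<tau> * cexp \<kappa>' \<tau>"
  by (simp add: cexp_def flip: exp_add) (simp add: algebra_simps)

lemma cexp_0 [simp]: "cexp 0 \<tau> = 1"
  by (simp add: cexp_def)

lemma norm_cexp: "norm (cexp \<kappa> \<tau>) = exp (- 2 * pi * \<kappa> * Im \<tau>)"
  by (simp add: cexp_def)

lemma qpar_power: "h > 0 \<Longrightarrow> qpar h \<tau> ^ m = cexp (real m / real h) \<tau>"
  by (simp add: qpar_def cexp_def flip: exp_of_nat_mult) (simp add: field_simps)

lemma cexp_tendsto_0:
  assumes "\<kappa> > 0"
  shows "(cexp \<kappa> \<longlongrightarrow> 0) at_i_infinity"
proof -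
  have "filterlim (\<lambda>\<tau>. (- 2 * pi * \<kappa>) * Im \<tau>) at_bot at_i_infinity"
    using assms by (intro filterlim_tendsto_neg_mult_at_bot[OF tendsto_const] filterlim_filtercomap) auto
  then have "((\<lambda>\<tau>. exp ((- 2 * pi * \<kappa>) * Im \<tau>)) \<longlongrightarrow> 0) at_i_infinity"
    by (rule filterlim_compose[OF exp_at_bot])
  then have "((\<lambda>\<tau>. norm (cexp \<kappa> \<tau>)) \<longlongrightarrow> 0) at_i_infinity"
    by (simp add: norm_cexp)
  then show ?thesis by (simp add: tendsto_norm_zero_iff)
qed

lemma cusp_asymp_cong:
  assumes "\<forall>\<^sub>F \<tau> in at_i_infinity. f \<tau> = g \<tau>" "cusp_asymp f \<kappa> C"
  shows "cusp_asymp g \<kappa> C"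
  using assms(2) unfolding cusp_asymp_def
  by (rule Lim_transform_eventually) (use assms(1) in eventually_elim, simp)

lemma cusp_asymp_const: "cusp_asymp (\<lambda>_. c) 0 c"
  by (simp add: cusp_asymp_def)

lemma cusp_asymp_0_iff: "cusp_asymp f 0 C \<longleftrightarrow> (f \<longlongrightarrow> C) at_i_infinity"
  by (simp add: cusp_asymp_def)

lemma cusp_asymp_mult:
  assumes "cusp_asymp f \<kappa> C" "cusp_asymp g \<kappa>' C'"
  shows "cusp_asymp (\<lambda>\<tau>. f \<tau> * g \<tau>) (\<kappa> + \<kappa>') (C * C')"
proof -
  have eq: "f \<tau> * cexp (- \<kappa>) \<tau> * (g \<tau> * cexp (- \<kappa>') \<tau>) = f \<tau> * g \<tau> * cexp (- (\<kappa> + \<kappa>')) \<tau>" for \<tau>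
    using cexp_add[of "- \<kappa>" "- \<kappa>'" \<tau>] by simp
  show ?thesis using tendsto_mult[OF assms[unfolded cusp_asymp_def]] unfolding cusp_asymp_def eq .
qed

lemma cusp_asymp_power: "cusp_asymp f \<kappa> C \<Longrightarrow> cusp_asymp (\<lambda>\<tau>. f \<tau> ^ m) (real m * \<kappa>) (C ^ m)"
proof (induction m)
  case 0
  then show ?case using cusp_asymp_const[of 1] by simp
next
  case (Suc m)
  then show ?case using cusp_asymp_mult[OF Suc.prems Suc.IH[OF Suc.prems]] by (simp add: algebra_simps)
qed

lemma cusp_asymp_prod:
  assumes "finite I" "\<And>i. i \<in> I \<Longrightarrow> cusp_asymp (f i) (\<kappa> i) (C i)"
  shows "cusp_asymp (\<lambda>\<tau>. \<Prod>i\<in>I. f i \<tau>) (\<Sum>i\<in>I. \<kappa> i) (\<Prod>i\<in>I. C i)"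
  using assms
proof (induction I rule: finite_induct)
  case empty
  then show ?case using cusp_asymp_const[of 1] by simp
next
  case (insert i I)
  then show ?case using cusp_asymp_mult[of "f i" "\<kappa> i" "C i"] by simp
qed

lemma cusp_asymp_smaller:
  assumes "cusp_asymp f \<kappa> C" "\<kappa>' < \<kappa>"
  shows "cusp_asymp f \<kappa>' 0"
proof -
  have "((\<lambda>\<tau>. f \<tau> * cexp (- \<kappa>) \<tau> * cexp (\<kappa> - \<kappa>') \<tau>) \<longlongrightarrow> C * 0) at_i_infinity"
    using assms by (intro tendsto_mult cexp_tendsto_0) (auto simp: cusp_asymp_def)
  moreover have eq: "f \<tau> * cexp (- \<kappa>) \<tau> * cexp (\<kappa> - \<kappa>') \<tau> = f \<tau> * cexp (- \<kappa>') \<tau>" for \<tau>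
    using cexp_add[of "- \<kappa>" "\<kappa> - \<kappa>'" \<tau>] by simp
  ultimately show ?thesis unfolding cusp_asymp_def eq by simp
qed

lemma cusp_asymp_diff:
  "cusp_asymp f \<kappa> C \<Longrightarrow> cusp_asymp g \<kappa> C' \<Longrightarrow> cusp_asymp (\<lambda>\<tau>. f \<tau> - g \<tau>) \<kappa> (C - C')"
  unfolding cusp_asymp_def using tendsto_diff by (fastforce simp: left_diff_distrib)

text \<open>The smaller exponent dominates. No cancellation can occur as long as the exponents differ.\<close>

lemma cusp_asymp_diff_left:
  "cusp_asymp f \<kappa> C \<Longrightarrow> cusp_asymp g \<kappa>' C' \<Longrightarrow> \<kappa> < \<kappa>' \<Longrightarrow> cusp_asymp (\<lambda>\<tau>. f \<tau> - g \<tau>) \<kappa> C"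
  using cusp_asymp_diff[OF _ cusp_asymp_smaller, of f \<kappa> C g \<kappa>' C'] by simp

lemma cusp_asymp_diff_right:
  "cusp_asymp f \<kappa> C \<Longrightarrow> cusp_asymp g \<kappa>' C' \<Longrightarrow> \<kappa>' < \<kappa> \<Longrightarrow> cusp_asymp (\<lambda>\<tau>. f \<tau> - g \<tau>) \<kappa>' (- C')"
  using cusp_asymp_diff[OF cusp_asymp_smaller, of f \<kappa> C \<kappa>' g C'] by simp

lemma cusp_asymp_unique:
  assumes "cusp_asymp f \<kappa> C" "cusp_asymp f \<kappa>' C'" "C \<noteq> 0" "C' \<noteq> 0"
  shows "\<kappa> = \<kappa>'" "C = C'"
proof -
  have uniq: "D = D'" if "cusp_asymp f \<mu> D" "cusp_asymp f \<mu> D'" for D D' \<mu>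
    using tendsto_unique[OF at_i_infinity_neq_bot] that unfolding cusp_asymp_def by blast
  show "\<kappa> = \<kappa>'"
  proof (rule ccontr)
    assume "\<kappa> \<noteq> \<kappa>'"
    then consider "\<kappa> < \<kappa>'" | "\<kappa>' < \<kappa>" by linarith
    then show False
    proof cases
      case 1
      then show False using uniq[OF assms(1) cusp_asymp_smaller[OF assms(2)]] assms(3) by blast
    next
      case 2
      then show False using uniq[OF assms(2) cusp_asymp_smaller[OF assms(1)]] assms(4) by blast
    qed
  qed
  then show "C = C'" using uniq assms by blast
qed

lemma filterlim_affine_at_i_infinity:
  assumes "a > 0" "d > 0"
  shows "filterlim (\<lambda>\<tau>. (of_int a * \<tau> + of_int b) / of_int d) at_i_infinity at_i_infinity"
proof -
  have "filterlim (\<lambda>\<tau>. (of_int a / of_int d) * Im \<tau>) at_top at_i_infinity"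
    using assms by (intro filterlim_tendsto_pos_mult_at_top[OF tendsto_const] filterlim_filtercomap) auto
  moreover have "Im ((of_int a * \<tau> + of_int b) / of_int d) = (of_int a / of_int d) * Im \<tau>" for \<tau>
    using Im_divide_of_real[of "of_int a * \<tau> + of_int b" "of_int d"] by simp
  ultimately show ?thesis unfolding filterlim_filtercomap_iff o_def by simp
qed

lemma cusp_asymp_affine:
  assumes "cusp_asymp f \<kappa> C" "a > 0" "d > 0"
  shows "cusp_asymp (\<lambda>\<tau>. f ((of_int a * \<tau> + of_int b) / of_int d)) (\<kappa> * of_int a / of_int d)
    (C * cexp \<kappa> (of_int b / of_int d))"
proof -
  have "((\<lambda>\<tau>. f ((of_int a * \<tau> + of_int b) / of_int d) * cexp (- \<kappa>) ((of_int a * \<tau> + of_int b) / of_int d)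
      * cexp \<kappa> (of_int b / of_int d)) \<longlongrightarrow> C * cexp \<kappa> (of_int b / of_int d)) at_i_infinity"
    using filterlim_compose[OF assms(1)[unfolded cusp_asymp_def] filterlim_affine_at_i_infinity[OF assms(2,3), of b]]
    by (intro tendsto_intros) simp
  moreover have "cexp (- \<kappa>) ((of_int a * \<tau> + of_int b) / of_int d) * cexp \<kappa> (of_int b / of_int d) =
      cexp (- (\<kappa> * of_int a / of_int d)) \<tau>" for \<tau>
    using assms(3) by (simp add: cexp_def flip: exp_add) (simp add: field_simps)
  ultimately show ?thesis by (simp add: cusp_asymp_def mult.assoc)
qed

section \<open>Functions with poles at infinity only are polynomials in the Hauptmodul\<close>

context genus_zero_hauptmodul
begin

lemma j_asymp_infinity: "cusp_asymp j (-1) 1"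
  using j_qpar_limit by (simp add: cusp_asymp_def cexp_def qpar_def)

text \<open>Induction on the order of the pole at infinity: subtracting a multiple of a power of \<open>j\<close> lowers it,
  and a function without a pole is constant by Liouville's theorem.\<close>

lemma polynomial_in_j:
  assumes "f holomorphic_on uhp" "\<And>G \<tau>. G \<in> Gamma0 N \<Longrightarrow> \<tau> \<in> uhp \<Longrightarrow> f (moebius G \<tau>) = f \<tau>"
    and "\<And>A. A \<in> SL2Z \<Longrightarrow> finite_cusp A \<Longrightarrow> \<exists>L. ((\<lambda>\<tau>. f (moebius A \<tau>)) \<longlongrightarrow> L) at_i_infinity"
    and "cusp_asymp f (- real k) C"
  shows "\<exists>P. \<forall>\<tau>\<in>uhp. f \<tau> = poly P (j \<tau>)"
  using assms
proof (induction k arbitrary: f C)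
  case 0
  have "\<exists>L. ((\<lambda>\<tau>. f (moebius A \<tau>)) \<longlongrightarrow> L) at_i_infinity" if A: "A \<in> SL2Z" for A
  proof (cases "finite_cusp A")
    case False
    obtain G k where G: "G \<in> Gamma0 N" "\<And>\<tau>. \<tau> \<in> uhp \<Longrightarrow> moebius A \<tau> = moebius G (\<tau> + of_int k)"
      using infinite_cusp_matrix[OF A False] by metis
    have "((\<lambda>\<tau>. f (\<tau> + of_int k)) \<longlongrightarrow> C) at_i_infinity"
      using "0.prems"(4) by (intro filterlim_compose[OF _ filterlim_shift_at_i_infinity]) (simp add: cusp_asymp_def)
    then have "((\<lambda>\<tau>. f (moebius A \<tau>)) \<longlongrightarrow> C) at_i_infinity"
    proof (rule Lim_transform_eventually)
      show "\<forall>\<^sub>F \<tau> in at_i_infinity. f (\<tau> + of_int k) = f (moebius A \<tau>)"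
        using eventually_uhp
      proof eventually_elim
        case (elim \<tau>)
        then have "\<tau> + of_int k \<in> uhp" by (simp add: uhp_def)
        then show ?case using "0.prems"(2)[OF G(1)] G(2)[OF elim] by simp
      qed
    qed
    then show ?thesis by blast
  qed (use 0 A in blast)
  then obtain c where "\<And>\<tau>. \<tau> \<in> uhp \<Longrightarrow> f \<tau> = c"
    using modular_Liouville[OF N_pos "0.prems"(1,2)] by blast
  then show ?case by (intro exI[of _ "[:c:]"]) simp
next
  case (Suc k)
  \<comment> \<open>Removing the leading term makes \<open>g q\<^sup>k\<^sup>+\<^sup>1\<close> vanish at \<open>q = 0\<close>, so that one factor \<open>q\<close> can be divided out.\<close>
  define g where "g \<tau> = f \<tau> - C * j \<tau> ^ Suc k" for \<tau>
  have hol: "g holomorphic_on uhp"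
    unfolding g_def[abs_def] by (intro holomorphic_intros Suc.prems(1) j_hol)
  have inv: "g (moebius G \<tau>) = g \<tau>" if "G \<in> Gamma0 N" "\<tau> \<in> uhp" for G \<tau>
    using that by (simp add: g_def Suc.prems(2) j_inv)
  have lim: "\<exists>L. ((\<lambda>\<tau>. g (moebius A \<tau>)) \<longlongrightarrow> L) at_i_infinity" if A: "A \<in> SL2Z" "finite_cusp A" for A
  proof -
    obtain L where "((\<lambda>\<tau>. f (moebius A \<tau>)) \<longlongrightarrow> L) at_i_infinity" using Suc.prems(3)[OF A] by blast
    moreover obtain L' where "((\<lambda>\<tau>. j (moebius A \<tau>)) \<longlongrightarrow> L') at_i_infinity" using j_limit[OF A] by blast
    ultimately have "((\<lambda>\<tau>. g (moebius A \<tau>)) \<longlongrightarrow> L - C * L' ^ Suc k) at_i_infinity"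
      unfolding g_def by (intro tendsto_intros)
    then show ?thesis by blast
  qed
  have "cusp_asymp (\<lambda>\<tau>. C * j \<tau> ^ Suc k) (0 + real (Suc k) * (-1)) (C * 1 ^ Suc k)"
    by (intro cusp_asymp_mult cusp_asymp_const cusp_asymp_power j_asymp_infinity)
  then have "cusp_asymp g (- real (Suc k)) (C - C)"
    unfolding g_def[abs_def] by (intro cusp_asymp_diff Suc.prems(4)) simp
  then have g0: "((\<lambda>\<tau>. g \<tau> * qpar 1 \<tau> ^ Suc k) \<longlongrightarrow> 0) at_i_infinity"
    by (simp add: cusp_asymp_def qpar_power add.commute del: power_Suc)
  have per: "g (\<tau> + of_nat 1) * qpar 1 (\<tau> + of_nat 1) ^ Suc k = g \<tau> * qpar 1 \<tau> ^ Suc k" if "\<tau> \<in> uhp" for \<tau>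
  proof -
    have "qpar 1 (\<tau> + 1) = qpar 1 \<tau>"
      by (simp add: qpar_def ring_distribs exp_add)
    moreover have "g (\<tau> + 1) = g \<tau>" using inv[OF transl_Gamma0[of 1] that] by simp
    ultimately show ?thesis by simp
  qed
  have holq: "(\<lambda>\<tau>. g \<tau> * qpar 1 \<tau> ^ Suc k) holomorphic_on uhp"
    by (intro holomorphic_intros hol)
  obtain G where G: "G holomorphic_on ball 0 1" "G 0 = 0"
    "\<And>\<tau>. \<tau> \<in> uhp \<Longrightarrow> g \<tau> * qpar 1 \<tau> ^ Suc k = G (qpar 1 \<tau>)"
    using periodic_expansion[OF holq zero_less_one per g0] by blast
  define G1 where "G1 q = (if q = 0 then deriv G 0 else G q / q)" for q
  have "(G has_field_derivative deriv G 0) (at 0)"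
    by (rule holomorphic_derivI[OF G(1) open_ball]) simp
  then have "((\<lambda>q. G q / q) \<longlongrightarrow> deriv G 0) (at 0)"
    using G(2) by (simp add: has_field_derivative_iff)
  from filterlim_compose[OF this tendsto_qpar[of 1]]
  have "((\<lambda>\<tau>. G (qpar 1 \<tau>) / qpar 1 \<tau>) \<longlongrightarrow> deriv G 0) at_i_infinity" by simp
  then have "((\<lambda>\<tau>. g \<tau> * qpar 1 \<tau> ^ k) \<longlongrightarrow> deriv G 0) at_i_infinity"
  proof (rule Lim_transform_eventually)
    show "\<forall>\<^sub>F \<tau> in at_i_infinity. G (qpar 1 \<tau>) / qpar 1 \<tau> = g \<tau> * qpar 1 \<tau> ^ k"
      using eventually_uhp
    proof eventually_elim
      case (elim \<tau>)
      show ?case unfolding G(3)[OF elim, symmetric] by simp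
    qed
  qed
  then have "cusp_asymp g (- real k) (deriv G 0)" by (simp add: cusp_asymp_def qpar_power)
  then obtain P where P: "\<And>\<tau>. \<tau> \<in> uhp \<Longrightarrow> g \<tau> = poly P (j \<tau>)"
    using Suc.IH[OF hol inv lim] by blast
  have "f \<tau> = poly (P + Polynomial.monom C (Suc k)) (j \<tau>)" if "\<tau> \<in> uhp" for \<tau>
    using P[OF that] by (simp add: g_def poly_monom algebra_simps)
  then show ?case by blast
qed

lemma infinite_j_values: "infinite (j ` uhp)"
proof
  assume "finite (j ` uhp)"
  moreover have "open (j ` uhp)" by (rule open_j_image[OF open_uhp subset_refl])
  moreover have "j ` uhp \<noteq> {}" using open_uhp by (auto simp: uhp_def intro: exI[of _ \<i>])
  ultimately show False using finite_imp_not_open by blast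
qed

lemma poly_eq_if_eq_at_j:
  assumes "\<And>\<tau>. \<tau> \<in> uhp \<Longrightarrow> poly P (j \<tau>) = poly Q (j \<tau>)"
  shows "P = Q"
proof (rule ccontr)
  assume "P \<noteq> Q"
  then have "finite {x. poly (P - Q) x = 0}" by (intro poly_roots_finite) simp
  moreover have "j ` uhp \<subseteq> {x. poly (P - Q) x = 0}" using assms by auto
  ultimately show False using infinite_j_values finite_subset by blast
qed

end

section \<open>Hecke cosets\<close>

definition hecke_rel :: "nat \<Rightarrow> nat \<Rightarrow> ((int^2^2) \<times> (int^2^2)) set" where
  "hecke_rel N n = {(A, B). A \<in> hecke_matrices N n \<and> B \<in> hecke_matrices N n \<and> (\<exists>C\<in>Gamma0 N. B = C ** A)}"

lemma hecke_cosets_eq: "hecke_cosets N n = hecke_matrices N n // hecke_rel N n"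
  by (simp add: hecke_cosets_def hecke_rel_def)

lemma equiv_hecke_rel: "equiv (hecke_matrices N n) (hecke_rel N n)"
proof (intro equivI)
  show "refl_on (hecke_matrices N n) (hecke_rel N n)"
    unfolding refl_on_def hecke_rel_def using Gamma0_one by (auto intro!: bexI[of _ "mat 1"])
  show "sym (hecke_rel N n)"
  proof (rule symI)
    fix A B assume "(A, B) \<in> hecke_rel N n"
    then obtain C where C: "A \<in> hecke_matrices N n" "B \<in> hecke_matrices N n" "C \<in> Gamma0 N" "B = C ** A"
      by (auto simp: hecke_rel_def)
    then have "A = adj2 C ** B" by (simp add: Gamma0_cancel)
    then show "(B, A) \<in> hecke_rel N n" using C Gamma0_adj2[OF C(3)] unfolding hecke_rel_def by blast
  qed
  show "trans (hecke_rel N n)"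
  proof (rule transI)
    fix A B D assume "(A, B) \<in> hecke_rel N n" "(B, D) \<in> hecke_rel N n"
    then obtain C C' where C: "A \<in> hecke_matrices N n" "D \<in> hecke_matrices N n" "C \<in> Gamma0 N" "C' \<in> Gamma0 N" "D = C' ** (C ** A)"
      unfolding hecke_rel_def by blast
    then have "D = (C' ** C) ** A" by (simp add: matrix_mul_assoc)
    then show "(A, D) \<in> hecke_rel N n" using C Gamma0_mult[OF C(4,3)] unfolding hecke_rel_def by blast
  qed
  show "hecke_rel N n \<subseteq> hecke_matrices N n \<times> hecke_matrices N n"
    by (auto simp: hecke_rel_def)
qed

text \<open>A common divisor of the upper left entry and the level would divide the determinant.\<close>

lemma hecke_matrices_iff:
  assumes "coprime n N"
  shows "A \<in> hecke_matrices N n \<longleftrightarrow> det A = int n \<and> int N dvd A$2$1"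
proof -
  have "coprime (A$1$1) (int N)" if "det A = int n" "int N dvd A$2$1"
  proof (rule coprimeI)
    fix d assume d: "d dvd A$1$1" "d dvd int N"
    have "d dvd A$2$1" by (rule dvd_trans[OF d(2) that(2)])
    then have "d dvd det A" unfolding det_2 using d(1) by (intro dvd_diff dvd_mult2 dvd_mult) auto
    then have "d dvd int n" using that(1) by simp
    moreover have "coprime (int n) (int N)" using assms by simp
    ultimately show "is_unit d" using d(2) coprime_common_divisor by blast
  qed
  then show ?thesis by (auto simp: hecke_matrices_def)
qed

text \<open>The first column, divided by its greatest common divisor, is the first column of a unimodular
  matrix.\<close>

lemma column_decomposition:
  assumes "det B > 0"
  obtains A a b d where "A \<in> SL2Z" "a > 0" "d > 0" "a * d = det B" "B = A ** M2 a b 0 d"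
proof -
  define g where "g = gcd (B$1$1) (B$2$1)"
  have g0: "g \<noteq> 0" using assms by (auto simp: g_def det_2)
  then have g: "g > 0" unfolding g_def by (simp add: order_less_le)
  define p where "p = B$1$1 div g"
  define q where "q = B$2$1 div g"
  have pq: "B$1$1 = g * p" "B$2$1 = g * q" by (auto simp: p_def q_def g_def)
  have "coprime p q" unfolding p_def q_def g_def using g0 by (intro div_gcd_coprime) (auto simp: g_def)
  then obtain A where A: "A \<in> SL2Z" "A$1$1 = p" "A$2$1 = q" using matrix_column_exists by metis
  define U where "U = adj2 A ** B"
  have B: "B = A ** U" unfolding U_def using A by (simp add: adj2_cancel SL2Z_det)
  have dA: "p * A$2$2 - A$1$2 * q = 1" using SL2Z_det[OF A(1)] A by (simp add: det_2)
  have "U$2$1 = 0" by (simp add: U_def matmul_nth A pq)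
  moreover have "U$1$1 = g * (p * A$2$2 - A$1$2 * q)" by (simp add: U_def matmul_nth A pq algebra_simps)
  then have "U$1$1 = g" using dA by simp
  ultimately have U: "U = M2 g (U$1$2) 0 (U$2$2)" by (simp add: mat2_eq_iff)
  have "det B = det U" unfolding B using A by (simp add: det_mul SL2Z_det)
  then have gd: "g * (U$2$2) = det B" by (subst (asm) U) simp
  moreover have "U$2$2 > 0" using gd assms g by (metis zero_less_mult_pos)
  ultimately show ?thesis using that[of A g "U$2$2" "U$1$2"] A g B U by metis
qed

lemma moebius_upper [simp]: "moebius (M2 a b 0 d) \<tau> = (of_int a * \<tau> + of_int b) / of_int d"
  by (simp add: moebius_def)

text \<open>The least positive \<open>h\<close> for which \<open>N\<close> divides \<open>h c\<^sup>2\<close>.\<close>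

definition cusp_width :: "nat \<Rightarrow> int \<Rightarrow> int" where
  "cusp_width N c = int N div gcd (int N) (c\<^sup>2)"

lemma cusp_width_pos: "N > 0 \<Longrightarrow> cusp_width N c > 0"
  unfolding cusp_width_def by (simp add: pos_imp_zdiv_pos_iff zdvd_imp_le)

lemma cusp_width_dvd_iff:
  assumes "N > 0"
  shows "int N dvd k * c\<^sup>2 \<longleftrightarrow> cusp_width N c dvd k"
proof -
  define g where "g = gcd (int N) (c\<^sup>2)"
  have g: "g \<noteq> 0" using assms by (simp add: g_def)
  have N: "int N = g * cusp_width N c" by (simp add: cusp_width_def g_def)
  define y where "y = c\<^sup>2 div g"
  have c: "c\<^sup>2 = g * y" by (simp add: y_def g_def)
  have "coprime (cusp_width N c) y"
    unfolding cusp_width_def y_def g_def using assms by (intro div_gcd_coprime) simp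
  then have "cusp_width N c dvd k * y \<longleftrightarrow> cusp_width N c dvd k" by (rule coprime_dvd_mult_left_iff)
  moreover have "int N dvd k * c\<^sup>2 \<longleftrightarrow> g * cusp_width N c dvd g * (k * y)"
    unfolding N[symmetric] c by (simp add: ac_simps)
  ultimately show ?thesis using g by (simp add: dvd_times_left_cancel_iff) 
qed

locale hecke_correspondence = genus_zero_hauptmodul +
  fixes n :: nat
  assumes n_pos: "n > 0" and coprime_n: "coprime n N"
begin

abbreviation "M \<equiv> hecke_matrices N n"
abbreviation "cosets \<equiv> hecke_cosets N n"

definition coset_of :: "int^2^2 \<Rightarrow> (int^2^2) set" where
  "coset_of A = hecke_rel N n `` {A}"

lemma M_iff: "A \<in> M \<longleftrightarrow> det A = int n \<and> int N dvd A$2$1"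
  by (rule hecke_matrices_iff[OF coprime_n])

lemma M_det: "A \<in> M \<Longrightarrow> det A = int n"
  by (simp add: M_iff)

lemma M_det_pos: "A \<in> M \<Longrightarrow> det A > 0"
  using n_pos by (simp add: M_iff)

lemma M_left: "G \<in> Gamma0 N \<Longrightarrow> A \<in> M \<Longrightarrow> G ** A \<in> M"
  unfolding M_iff by (simp add: det_mul Gamma0_det matmul_nth) (simp add: Gamma0_def)

lemma M_right: "G \<in> Gamma0 N \<Longrightarrow> A \<in> M \<Longrightarrow> A ** G \<in> M"
  unfolding M_iff by (simp add: det_mul Gamma0_det matmul_nth) (simp add: Gamma0_def)

lemma M_adj2: "A \<in> M \<Longrightarrow> adj2 A \<in> M"
  unfolding M_iff by simp

lemma coset_of_in: "A \<in> M \<Longrightarrow> coset_of A \<in> cosets"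
  unfolding hecke_cosets_eq coset_of_def by (rule quotientI)

lemma in_coset_of: "A \<in> M \<Longrightarrow> A \<in> coset_of A"
  unfolding coset_of_def using equiv_hecke_rel by (rule equiv_class_self)

lemma cosetE:
  assumes "K \<in> cosets"
  obtains A where "A \<in> M" "K = coset_of A" "A \<in> K"
  using assms in_coset_of unfolding hecke_cosets_eq coset_of_def by (metis quotientE)

lemma coset_of_iff: "A \<in> M \<Longrightarrow> B \<in> coset_of A \<longleftrightarrow> (\<exists>C\<in>Gamma0 N. B = C ** A)"
  unfolding coset_of_def hecke_rel_def using M_left by auto

lemma coset_of_eqI: "A \<in> M \<Longrightarrow> C \<in> Gamma0 N \<Longrightarrow> coset_of (C ** A) = coset_of A"
  unfolding coset_of_def using equiv_hecke_rel[of N n] M_left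
  by (intro equiv_class_eq[symmetric]) (auto simp: hecke_rel_def)

lemma coset_eq:
  assumes "K \<in> cosets" "A \<in> K"
  shows "A \<in> M" "K = coset_of A"
proof -
  obtain B where B: "B \<in> M" "K = coset_of B" using cosetE[OF assms(1)] by metis
  then obtain C where C: "C \<in> Gamma0 N" "A = C ** B" using assms(2) coset_of_iff by blast
  show "A \<in> M" unfolding C(2) by (rule M_left[OF C(1) B(1)])
  show "K = coset_of A" unfolding C(2) B(2) by (rule coset_of_eqI[OF B(1) C(1), symmetric])
qed

lemma coset_left_closed:
  assumes "K \<in> cosets" "A \<in> K" "C \<in> Gamma0 N"
  shows "C ** A \<in> K"
  using coset_eq[OF assms(1,2)] coset_of_iff assms(3) by blast

definition jK :: "(int^2^2) set \<Rightarrow> complex \<Rightarrow> complex" where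
  "jK K \<tau> = j (moebius (SOME A. A \<in> K) \<tau>)"

text \<open>Two representatives of a coset differ by a group element on the left, under which \<open>j\<close> is invariant.\<close>

lemma jK_eq:
  assumes "K \<in> cosets" "A \<in> K" "\<tau> \<in> uhp"
  shows "jK K \<tau> = j (moebius A \<tau>)"
proof -
  have "(SOME A. A \<in> K) \<in> K" using assms(2) by (rule someI)
  then obtain C where C: "C \<in> Gamma0 N" "(SOME A. A \<in> K) = C ** A"
    using coset_eq[OF assms(1,2)] coset_of_iff by blast
  have A: "det A > 0" using coset_eq(1)[OF assms(1,2)] by (rule M_det_pos)
  then show ?thesis
    unfolding jK_def C(2) using assms(3) C(1) by (simp add: moebius_mult j_inv moebius_in_uhp)
qed

lemma holomorphic_jK: "K \<in> cosets \<Longrightarrow> jK K holomorphic_on uhp"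
proof -
  assume K: "K \<in> cosets"
  obtain A where A: "A \<in> M" "A \<in> K" using cosetE[OF K] by metis
  have "(\<lambda>\<tau>. j (moebius A \<tau>)) holomorphic_on uhp"
    by (rule holomorphic_compose_moebius[OF j_hol M_det_pos[OF A(1)]])
  then show ?thesis using jK_eq[OF K A(2)] by (subst holomorphic_cong[OF refl]) auto
qed

text \<open>Right multiplication by group elements permutes the Hecke cosets, which makes symmetric functions
  of the \<open>jK K\<close> invariant.\<close>

definition right_mult :: "int^2^2 \<Rightarrow> (int^2^2) set \<Rightarrow> (int^2^2) set" where
  "right_mult G K = (\<lambda>A. A ** G) ` K"

lemma right_mult_coset: "A \<in> M \<Longrightarrow> G \<in> Gamma0 N \<Longrightarrow> right_mult G (coset_of A) = coset_of (A ** G)"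
proof (intro equalityI subsetI)
  assume A: "A \<in> M" "G \<in> Gamma0 N"
  note AG = M_right[OF A(2,1)]
  fix B
  {
    assume "B \<in> right_mult G (coset_of A)"
    then obtain C where "C \<in> Gamma0 N" "B = C ** A ** G" unfolding right_mult_def using coset_of_iff[OF A(1)] by auto
    then show "B \<in> coset_of (A ** G)" unfolding coset_of_iff[OF AG] by (auto simp: matrix_mul_assoc)
  }
  assume "B \<in> coset_of (A ** G)"
  then obtain C where C: "C \<in> Gamma0 N" "B = C ** (A ** G)" unfolding coset_of_iff[OF AG] by blast
  then have "B = (C ** A) ** G" by (simp add: matrix_mul_assoc)
  moreover have "C ** A \<in> coset_of A" unfolding coset_of_iff[OF A(1)] using C(1) by blast
  ultimately show "B \<in> right_mult G (coset_of A)" unfolding right_mult_def by blast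
qed

lemma bij_right_mult:
  assumes "G \<in> Gamma0 N"
  shows "bij_betw (right_mult G) cosets cosets"
proof -
  have inv: "right_mult H (right_mult G K) = K" if "G \<in> Gamma0 N" "H = adj2 G" for G H K
    using adj2_cancel(3)[OF Gamma0_det[OF that(1)]] that(2) by (simp add: right_mult_def image_image)
  have into: "right_mult G ` cosets \<subseteq> cosets" if "G \<in> Gamma0 N" for G
  proof
    fix K assume "K \<in> right_mult G ` cosets"
    then obtain A where "A \<in> M" "K = right_mult G (coset_of A)" using cosetE by blast
    then show "K \<in> cosets" using right_mult_coset[of A G] that coset_of_in M_right by simp
  qed
  show ?thesis
    by (rule bij_betw_byWitness[of _ "right_mult (adj2 G)"])
      (use inv[OF assms] inv[OF Gamma0_adj2[OF assms]] into[OF assms] into[OF Gamma0_adj2[OF assms]] in auto)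
qed

lemma jK_moebius:
  assumes "K \<in> cosets" "G \<in> Gamma0 N" "\<tau> \<in> uhp"
  shows "jK K (moebius G \<tau>) = jK (right_mult G K) \<tau>"
proof -
  obtain A where A: "A \<in> M" "A \<in> K" using cosetE[OF assms(1)] by metis
  have K': "right_mult G K \<in> cosets" using bij_right_mult[OF assms(2)] assms(1) by (auto simp: bij_betw_def)
  have A': "A ** G \<in> right_mult G K" using A(2) by (auto simp: right_mult_def)
  show ?thesis
    using jK_eq[OF assms(1) A(2), of "moebius G \<tau>"] jK_eq[OF K' A' assms(3)] assms
    by (simp add: moebius_in_uhp_Gamma0[OF assms(3,2)] moebius_mult Gamma0_det)
qed

subsection \<open>Action on cusps\<close>

lemma infinite_cusp_iff:
  assumes "A \<in> SL2Z"
  shows "\<not> finite_cusp A \<longleftrightarrow> (\<exists>G\<in>Gamma0 N. (G ** A)$2$1 = 0)"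
proof -
  have "cusp_act A None = cusp_act G None \<longleftrightarrow> (adj2 G ** A)$2$1 = 0" if "G \<in> Gamma0 N" for G
    using that assms by (intro cusp_equiv_matrix_iff) (auto simp: SL2Z_det Gamma0_det)
  then have "\<not> finite_cusp A \<longleftrightarrow> (\<exists>G\<in>Gamma0 N. (adj2 G ** A)$2$1 = 0)"
    unfolding finite_cusp_def cusp_equiv_def by blast
  also have "\<dots> \<longleftrightarrow> (\<exists>G\<in>Gamma0 N. (G ** A)$2$1 = 0)"
    by (metis Gamma0_adj2 adj2_adj2)
  finally show ?thesis .
qed

text \<open>Hecke matrices fix the class of the cusp infinity: the reduced lower left entry remains
  divisible by the level, as the upper left entry is prime to it.\<close>

lemma M_upper_representative:
  assumes "A \<in> M"
  obtains G where "G \<in> Gamma0 N" "(G ** A)$2$1 = 0"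
proof -
  define g where "g = gcd (A$1$1) (A$2$1)"
  have "A$1$1 \<noteq> 0 \<or> A$2$1 \<noteq> 0" using M_det_pos[OF assms] by (auto simp: det_2)
  then have g0: "g \<noteq> 0" by (auto simp: g_def)
  define p where "p = A$1$1 div g"
  define q where "q = A$2$1 div g"
  have pq: "A$1$1 = g * p" "A$2$1 = g * q" by (auto simp: p_def q_def g_def)
  have "coprime p q" unfolding p_def q_def g_def using g0 by (intro div_gcd_coprime) (auto simp: g_def)
  then obtain B where B: "B \<in> SL2Z" "B$1$1 = p" "B$2$1 = q" using matrix_column_exists by metis
  have "coprime (A$1$1) (int N)" using assms by (simp add: hecke_matrices_def)
  then have "coprime g (int N)" unfolding pq by simp
  moreover have "int N dvd g * q" using assms unfolding pq(2)[symmetric] by (simp add: M_iff)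
  ultimately have "int N dvd q" by (simp add: coprime_commute coprime_dvd_mult_right_iff)
  then have "B \<in> Gamma0 N" using B by (simp add: Gamma0_def)
  then have "adj2 B \<in> Gamma0 N" by (rule Gamma0_adj2)
  moreover have "(adj2 B ** A)$2$1 = 0" by (simp add: matmul_nth B pq)
  ultimately show ?thesis by (rule that)
qed

text \<open>Both directions use that the adjugate of a Hecke matrix is again a Hecke matrix, so that
  Hecke matrices neither reach nor leave the class of infinity.\<close>

lemma finite_cusp_M_iff:
  assumes A: "A \<in> SL2Z" and X: "X \<in> M" and B: "B \<in> SL2Z" and eq: "X ** A = B ** M2 a b 0 d" and a: "a \<noteq> 0"
  shows "finite_cusp B \<longleftrightarrow> finite_cusp A"
proof -
  have "\<not> finite_cusp A" if inf: "\<not> finite_cusp B"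
  proof -
    obtain G where G: "G \<in> Gamma0 N" "(G ** B)$2$1 = 0" using inf infinite_cusp_iff[OF B] by blast
    obtain H where H: "H \<in> Gamma0 N" "(H ** adj2 (G ** X))$2$1 = 0"
      using M_upper_representative[OF M_adj2[OF M_left[OF G(1) X]]] .
    define V where "V = G ** X ** A"
    have V: "V = (G ** B) ** M2 a b 0 d" unfolding V_def using eq by (simp add: matrix_mul_assoc[symmetric])
    have V0: "V$2$1 = 0" unfolding V by (simp add: matmul_nth G(2)[unfolded matmul_nth])
    have dGX: "det (G ** X) = int n" using M_det[OF M_left[OF G(1) X]] .
    have "(H ** adj2 (G ** X)) ** V = H ** (adj2 (G ** X) ** (G ** X)) ** A"
      unfolding V_def by (simp add: matrix_mul_assoc)
    also have "\<dots> = H ** (mat (int n)) ** A" by (simp add: adj2_mult dGX)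
    finally have "(H ** mat (int n) ** A)$2$1 = ((H ** adj2 (G ** X)) ** V)$2$1" by simp
    also have "\<dots> = 0" unfolding matmul_nth[of "H ** adj2 (G ** X)" V] H(2) V0 by simp
    finally have "int n * (H ** A)$2$1 = 0" by (simp add: matmul_nth algebra_simps)
    then have "(H ** A)$2$1 = 0" using n_pos by simp
    then show ?thesis using infinite_cusp_iff[OF A] H(1) by blast
  qed
  moreover have "\<not> finite_cusp B" if inf: "\<not> finite_cusp A"
  proof -
    obtain G where G: "G \<in> Gamma0 N" "(G ** A)$2$1 = 0" using inf infinite_cusp_iff[OF A] by blast
    obtain H where H: "H \<in> Gamma0 N" "(H ** (X ** adj2 G))$2$1 = 0"
      using M_upper_representative[OF M_right[OF Gamma0_adj2[OF G(1)] X]] .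
    have "H ** (B ** M2 a b 0 d) = H ** X ** A" using eq by (simp add: matrix_mul_assoc[symmetric])
    also have "\<dots> = (H ** (X ** adj2 G)) ** (G ** A)"
    proof -
      have "A = adj2 G ** (G ** A)" using Gamma0_cancel(1)[OF G(1)] by simp
      then show ?thesis by (metis matrix_mul_assoc)
    qed
    finally have "((H ** B) ** M2 a b 0 d)$2$1 = ((H ** (X ** adj2 G)) ** (G ** A))$2$1"
      by (simp add: matrix_mul_assoc)
    also have "\<dots> = 0" unfolding matmul_nth[of "H ** (X ** adj2 G)" "G ** A"] H(2) G(2) by simp
    finally have "(H ** B)$2$1 * a = 0" unfolding matmul_nth[of "H ** B"] by simp
    then have "(H ** B)$2$1 = 0" using a by simp
    then show ?thesis using infinite_cusp_iff[OF B] H(1) by blast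
  qed
  ultimately show ?thesis by blast
qed

lemma jK_at_cusp:
  assumes K: "K \<in> cosets" and X: "X \<in> K" and A: "A \<in> SL2Z" and B: "B \<in> SL2Z"
    and eq: "X ** A = B ** M2 a b 0 d" and \<tau>: "\<tau> \<in> uhp"
  shows "jK K (moebius A \<tau>) = j (moebius B ((of_int a * \<tau> + of_int b) / of_int d))"
proof -
  have X': "det X = int n" using M_det[OF coset_eq(1)[OF K X]] .
  have "a * d = int n" using arg_cong[OF eq, of det] A B X' by (simp add: det_mul SL2Z_det)
  then have d: "det (M2 a b 0 d) \<noteq> 0" using n_pos by simp
  have "jK K (moebius A \<tau>) = j (moebius (X ** A) \<tau>)"
    using jK_eq[OF K X moebius_in_uhp_SL2Z[OF \<tau> A]] \<tau> A by (simp add: moebius_mult SL2Z_det)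
  also have "\<dots> = j (moebius B (moebius (M2 a b 0 d) \<tau>))"
    unfolding eq by (subst moebius_mult[OF \<tau> d]) simp
  finally show ?thesis by simp
qed

text \<open>The cosets fixing the class of the cusp \<open>A \<infinity>\<close> are represented by conjugates of upper
  triangular matrices; the translations of the stabilizer, generated by the width, reduce the upper
  right entry.\<close>

definition cusp_pairs :: "int^2^2 \<Rightarrow> (nat \<times> int) set" where
  "cusp_pairs A = (SIGMA d:{d. d dvd n}. {b \<in> {0..<cusp_width N (A$2$1) * int d}.
     int N dvd A$2$1 * (A$2$2 * (int (n div d) - int d) - b * A$2$1)})"

definition cusp_matrix :: "int^2^2 \<Rightarrow> nat \<times> int \<Rightarrow> int^2^2" where
  "cusp_matrix A = (\<lambda>(d, b). A ** M2 (int (n div d)) b 0 (int d) ** adj2 A)"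

definition fixing_cosets :: "int^2^2 \<Rightarrow> (int^2^2) set set" where
  "fixing_cosets A = {K \<in> cosets. \<exists>X\<in>K. (adj2 A ** X ** A)$2$1 = 0}"

lemma cusp_conjugate_21:
  "(A ** M2 a b 0 d ** adj2 A)$2$1 = A$2$1 * (A$2$2 * (a - d) - b * A$2$1)"
  by (simp add: matmul_nth algebra_simps)

lemma finite_cusp_pairs: "finite (cusp_pairs A)"
  unfolding cusp_pairs_def
proof (intro finite_SigmaI)
  show "finite {d. d dvd n}" using n_pos by simp
  show "finite {b \<in> {0..<cusp_width N (A$2$1) * int d}.
      int N dvd A$2$1 * (A$2$2 * (int (n div d) - int d) - b * A$2$1)}" for d
    by (rule finite_subset[of _ "{0..<cusp_width N (A$2$1) * int d}"]) auto
qed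

lemma cusp_matrix_in_M:
  assumes "A \<in> SL2Z" "x \<in> cusp_pairs A"
  shows "cusp_matrix A x \<in> M"
proof -
  obtain d b where x: "x = (d, b)" "d dvd n" "int N dvd A$2$1 * (A$2$2 * (int (n div d) - int d) - b * A$2$1)"
    using assms(2) unfolding cusp_pairs_def by blast
  have "int (n div d) * int d = int n" using x(2) by (simp flip: of_nat_mult)
  then show ?thesis
    using assms(1) x unfolding cusp_matrix_def x prod.case M_iff cusp_conjugate_21
    by (simp add: det_mul SL2Z_det)
qed

lemma conj_cancel:
  assumes "A \<in> SL2Z"
  shows "adj2 A ** (A ** X ** adj2 A) ** A = X" "A ** (adj2 A ** X ** A) ** adj2 A = X"
proof -
  have d: "det A = 1" using assms by (rule SL2Z_det)
  have "adj2 A ** (A ** X ** adj2 A) ** A = (adj2 A ** A) ** X ** (adj2 A ** A)"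
    by (simp only: matrix_mul_assoc)
  then show "adj2 A ** (A ** X ** adj2 A) ** A = X" by (simp add: adj2_mult d)
  have "A ** (adj2 A ** X ** A) ** adj2 A = (A ** adj2 A) ** X ** (A ** adj2 A)"
    by (simp only: matrix_mul_assoc)
  then show "A ** (adj2 A ** X ** A) ** adj2 A = X" by (simp add: adj2_mult d)
qed

lemma conj_mult:
  assumes "A \<in> SL2Z"
  shows "(A ** X ** adj2 A) ** (A ** Y ** adj2 A) = A ** (X ** Y) ** adj2 A"
proof -
  have "(A ** X ** adj2 A) ** (A ** Y ** adj2 A) = A ** X ** (adj2 A ** A) ** Y ** adj2 A"
    by (simp only: matrix_mul_assoc)
  then show ?thesis using assms by (simp add: adj2_mult SL2Z_det matrix_mul_assoc)
qed

text \<open>An element of the group relating two of the matrices becomes, after conjugation, upper triangular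
  with positive diagonal, hence a translation by a multiple of the width.\<close>

lemma inj_cusp_matrix_coset:
  assumes A: "A \<in> SL2Z"
  shows "inj_on (\<lambda>x. coset_of (cusp_matrix A x)) (cusp_pairs A)"
proof (rule inj_onI)
  fix x y assume x: "x \<in> cusp_pairs A" and y: "y \<in> cusp_pairs A"
    and eq: "coset_of (cusp_matrix A x) = coset_of (cusp_matrix A y)"
  obtain d b where xd: "x = (d, b)" "d dvd n" "0 \<le> b" "b < cusp_width N (A$2$1) * int d"
    using x unfolding cusp_pairs_def by auto
  obtain d' b' where yd: "y = (d', b')" "d' dvd n" "0 \<le> b'" "b' < cusp_width N (A$2$1) * int d'"
    using y unfolding cusp_pairs_def by auto
  define h where "h = cusp_width N (A$2$1)"
  have pos: "d > 0" "d' > 0" "n div d > 0" using xd(2) yd(2) n_pos by (auto intro: dvd_pos_nat simp: div_greater_zero_iff dvd_imp_le)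
  have "cusp_matrix A y \<in> coset_of (cusp_matrix A x)"
    unfolding eq by (rule in_coset_of[OF cusp_matrix_in_M[OF A y]])
  then obtain C where C: "C \<in> Gamma0 N" "cusp_matrix A y = C ** cusp_matrix A x"
    using coset_of_iff[OF cusp_matrix_in_M[OF A x]] by blast
  define B where "B = adj2 A ** C ** A"
  have B: "B \<in> SL2Z" unfolding B_def by (intro SL2Z_mult SL2Z_adj2 A Gamma0_SL2Z[OF C(1)])
  have CB: "C = A ** B ** adj2 A" unfolding B_def by (rule conj_cancel(2)[OF A, symmetric])
  have "A ** M2 (int (n div d')) b' 0 (int d') ** adj2 A = A ** (B ** M2 (int (n div d)) b 0 (int d)) ** adj2 A"
    using C(2) unfolding cusp_matrix_def xd yd prod.case CB conj_mult[OF A] .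
  then have BU: "M2 (int (n div d')) b' 0 (int d') = B ** M2 (int (n div d)) b 0 (int d)"
    using conj_cancel(1)[OF A] by metis
  then have "B$2$1 * int (n div d) = 0" "int d' = B$2$1 * b + B$2$2 * int d" "b' = B$1$1 * b + B$1$2 * int d"
    by (auto simp: mat2_eq_iff matmul_nth)
  then have B21: "B$2$1 = 0" and e: "int d' = B$2$2 * int d" "b' = B$1$1 * b + B$1$2 * int d"
    using pos(3) by auto
  have "B$2$2 > 0" using e(1) pos by (metis of_nat_0_less_iff zero_less_mult_pos2)
  moreover have "B$1$1 * B$2$2 = 1" using SL2Z_det[OF B] B21 by (simp add: det_2)
  ultimately have b1: "B$2$2 = 1" "B$1$1 = 1" by (auto simp: zmult_eq_1_iff)
  define k where "k = B$1$2"
  have "B = M2 1 k 0 1" using b1 B21 by (simp add: mat2_eq_iff k_def)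
  then have "C$2$1 = - (k * (A$2$1)\<^sup>2)"
    unfolding CB by (simp only: cusp_conjugate_21) (simp add: power2_eq_square)
  then have "int N dvd k * (A$2$1)\<^sup>2" using C(1) by (simp add: Gamma0_def)
  then have "h dvd k" unfolding h_def using cusp_width_dvd_iff[OF N_pos] by blast
  then obtain m where m: "k = h * m" by blast
  have dd: "d' = d" using e(1) b1 by simp
  have bb: "b' = b + (h * int d) * m" using e(2) b1 m by (simp add: k_def)
  have "b' mod (h * int d) = b mod (h * int d)" unfolding bb by simp
  then have "b' = b" using xd yd dd by (simp add: h_def)
  then show "x = y" using dd xd yd by simp
qed

text \<open>A representative fixing the cusp is conjugate to an upper triangular matrix; its sign makes the
  diagonal positive and a translation by a multiple of the width reduces the upper right entry.\<close>

lemma cusp_cosets_image: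
  assumes A: "A \<in> SL2Z"
  shows "(\<lambda>x. coset_of (cusp_matrix A x)) ` cusp_pairs A = fixing_cosets A"
proof (intro equalityI subsetI)
  fix K assume "K \<in> (\<lambda>x. coset_of (cusp_matrix A x)) ` cusp_pairs A"
  then obtain x where x: "x \<in> cusp_pairs A" "K = coset_of (cusp_matrix A x)" by blast
  have "(adj2 A ** cusp_matrix A x ** A)$2$1 = 0"
    unfolding cusp_matrix_def by (simp add: conj_cancel[OF A] split: prod.split)
  then show "K \<in> fixing_cosets A"
    unfolding fixing_cosets_def using x coset_of_in in_coset_of cusp_matrix_in_M[OF A x(1)] by blast
next
  fix K assume "K \<in> fixing_cosets A"
  then obtain Y where K: "K \<in> cosets" and Y: "Y \<in> K" "(adj2 A ** Y ** A)$2$1 = 0"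
    unfolding fixing_cosets_def by blast
  \<comment> \<open>The sign that makes the diagonal positive.\<close>
  define s where "s = (if (adj2 A ** Y ** A)$2$2 > 0 then mat 1 else - mat 1 :: int^2^2)"
  have s: "s \<in> Gamma0 N" unfolding s_def using Gamma0_one Gamma0_uminus by auto
  define X where "X = s ** Y"
  have XK: "X \<in> K" unfolding X_def by (rule coset_left_closed[OF K Y(1) s])
  have XM: "X \<in> M" by (rule coset_eq(1)[OF K XK])
  define U where "U = adj2 A ** X ** A"
  have Us: "U = adj2 A ** Y ** A \<or> U = - (adj2 A ** Y ** A)"
    unfolding U_def X_def s_def by (simp add: matmul_uminus)
  have U21: "U$2$1 = 0" using Us Y(2) by auto
  have "det U = int n" unfolding U_def using A M_det[OF XM] by (simp add: det_mul SL2Z_det)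
  then have adn: "U$1$1 * U$2$2 = int n" using U21 by (simp add: det_2)
  then have "U$2$2 \<noteq> 0" using n_pos by auto
  moreover have "U$2$2 \<ge> 0" unfolding U_def X_def s_def by (auto simp: matmul_uminus)
  ultimately have dpos: "U$2$2 > 0" by simp
  define d where "d = nat (U$2$2)"
  have d: "int d = U$2$2" "d > 0" using dpos by (auto simp: d_def)
  have "int d dvd int n" using adn d(1) by (metis dvd_triv_right)
  then have dn: "d dvd n" by simp
  have a: "U$1$1 = int (n div d)"
  proof -
    have "int (n div d) * int d = int n" using dn by (simp flip: of_nat_mult)
    then have "int (n div d) * U$2$2 = U$1$1 * U$2$2" using adn d(1) by simp
    then show ?thesis using dpos by simp
  qed
  have U: "U = M2 (int (n div d)) (U$1$2) 0 (int d)" using a d U21 by (simp add: mat2_eq_iff)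
  have XU: "X = A ** U ** adj2 A" unfolding U_def by (rule conj_cancel(2)[OF A, symmetric])
  define h where "h = cusp_width N (A$2$1)"
  have h: "h > 0" unfolding h_def by (rule cusp_width_pos[OF N_pos])
  define b where "b = U$1$2 mod (h * int d)"
  define k where "k = - (h * (U$1$2 div (h * int d)))"
  have bk: "b = U$1$2 + k * int d"
    using div_mult_mod_eq[of "U$1$2" "h * int d"] by (simp add: b_def k_def algebra_simps)
  define C where "C = A ** transl k ** adj2 A"
  have "int N dvd k * (A$2$1)\<^sup>2" using cusp_width_dvd_iff[OF N_pos] unfolding h_def k_def by simp
  then have C: "C \<in> Gamma0 N" unfolding C_def by (intro conj_transl_Gamma0 A)
  have "C ** X = A ** (transl k ** U) ** adj2 A" unfolding C_def XU by (rule conj_mult[OF A])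
  also have "transl k ** U = M2 (int (n div d)) b 0 (int d)"
    by (subst U) (simp add: mat2_eq_iff matmul_nth bk)
  finally have CX: "C ** X = cusp_matrix A (d, b)" by (simp add: cusp_matrix_def)
  have "int N dvd (C ** X)$2$1" using M_left[OF C XM] by (simp add: M_iff)
  then have "int N dvd A$2$1 * (A$2$2 * (int (n div d) - int d) - b * A$2$1)"
    unfolding CX cusp_matrix_def prod.case cusp_conjugate_21 .
  then have "(d, b) \<in> cusp_pairs A"
    unfolding cusp_pairs_def using dn h d(2) by (auto simp: b_def h_def)
  moreover have "K = coset_of (cusp_matrix A (d, b))"
    unfolding CX[symmetric] using coset_of_eqI[OF XM C] coset_eq(2)[OF K XK] by simp
  ultimately show "K \<in> (\<lambda>x. coset_of (cusp_matrix A x)) ` cusp_pairs A" by blast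
qed

lemma fixing_cosets_one: "fixing_cosets (mat 1) = cosets"
proof -
  have "\<exists>X\<in>K. (adj2 (mat 1) ** X ** mat 1)$2$1 = 0" if K: "K \<in> cosets" for K
  proof -
    obtain A where A: "A \<in> M" "A \<in> K" using cosetE[OF K] by metis
    obtain G where G: "G \<in> Gamma0 N" "(G ** A)$2$1 = 0" using M_upper_representative[OF A(1)] .
    have "adj2 (mat 1) = (mat 1 :: int^2^2)" by (simp add: mat2_eq_iff)
    then have "(adj2 (mat 1) ** (G ** A) ** mat 1)$2$1 = 0" using G(2) by simp
    then show ?thesis using coset_left_closed[OF K A(2) G(1)] by blast
  qed
  then show ?thesis unfolding fixing_cosets_def by blast
qed

lemma finite_cosets: "finite cosets"
  unfolding fixing_cosets_one[symmetric] cusp_cosets_image[OF SL2Z_one, symmetric]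
  by (intro finite_imageI finite_cusp_pairs)

section \<open>The modular polynomial\<close>

text \<open>The functions to which \<open>polynomial_in_j\<close> applies, apart from invariance. They form a ring, so
  the coefficients of a product of linear polynomials inherit the property from the roots.\<close>

definition tame :: "(complex \<Rightarrow> complex) \<Rightarrow> bool" where
  "tame f \<longleftrightarrow> f holomorphic_on uhp \<and>
     (\<forall>A\<in>SL2Z. finite_cusp A \<longrightarrow> (\<exists>L. ((\<lambda>\<tau>. f (moebius A \<tau>)) \<longlongrightarrow> L) at_i_infinity)) \<and>
     (\<exists>k. cusp_asymp f (- real k) 0)"

lemma cusp_asymp_raise: "cusp_asymp f (- real k) 0 \<Longrightarrow> k \<le> m \<Longrightarrow> cusp_asymp f (- real m) 0"
  using cusp_asymp_smaller[of f "- real k" 0 "- real m"] by (cases "k = m") auto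

lemma tame_const: "tame (\<lambda>_. c)"
  unfolding tame_def
proof (intro conjI ballI impI)
  show "\<exists>k. cusp_asymp (\<lambda>_. c) (- real k) 0"
    using cusp_asymp_smaller[OF cusp_asymp_const[of c], of "-1"] by (intro exI[of _ 1]) simp
qed (auto intro!: exI[of _ c])

lemma tame_add:
  assumes "tame f" "tame g"
  shows "tame (\<lambda>\<tau>. f \<tau> + g \<tau>)"
  unfolding tame_def
proof (intro conjI ballI impI)
  show "(\<lambda>\<tau>. f \<tau> + g \<tau>) holomorphic_on uhp" using assms unfolding tame_def by (intro holomorphic_on_add) auto
  show "\<exists>L. ((\<lambda>\<tau>. f (moebius A \<tau>) + g (moebius A \<tau>)) \<longlongrightarrow> L) at_i_infinity" if "A \<in> SL2Z" "finite_cusp A" for A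
  proof -
    obtain L L' where "((\<lambda>\<tau>. f (moebius A \<tau>)) \<longlongrightarrow> L) at_i_infinity" "((\<lambda>\<tau>. g (moebius A \<tau>)) \<longlongrightarrow> L') at_i_infinity"
      using assms \<open>A \<in> SL2Z\<close> \<open>finite_cusp A\<close> unfolding tame_def by blast
    then show ?thesis using tendsto_add by blast
  qed
  obtain k m where "cusp_asymp f (- real k) 0" "cusp_asymp g (- real m) 0" using assms unfolding tame_def by blast
  then have "cusp_asymp f (- real (max k m)) 0" "cusp_asymp g (- real (max k m)) 0"
    by (auto intro: cusp_asymp_raise)
  then have "cusp_asymp (\<lambda>\<tau>. f \<tau> + g \<tau>) (- real (max k m)) 0"
    unfolding cusp_asymp_def using tendsto_add by (fastforce simp: ring_distribs)
  then show "\<exists>k. cusp_asymp (\<lambda>\<tau>. f \<tau> + g \<tau>) (- real k) 0" by blast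
qed

lemma tame_mult:
  assumes "tame f" "tame g"
  shows "tame (\<lambda>\<tau>. f \<tau> * g \<tau>)"
  unfolding tame_def
proof (intro conjI ballI impI)
  show "(\<lambda>\<tau>. f \<tau> * g \<tau>) holomorphic_on uhp" using assms unfolding tame_def by (intro holomorphic_on_mult) auto
  show "\<exists>L. ((\<lambda>\<tau>. f (moebius A \<tau>) * g (moebius A \<tau>)) \<longlongrightarrow> L) at_i_infinity" if "A \<in> SL2Z" "finite_cusp A" for A
  proof -
    obtain L L' where "((\<lambda>\<tau>. f (moebius A \<tau>)) \<longlongrightarrow> L) at_i_infinity" "((\<lambda>\<tau>. g (moebius A \<tau>)) \<longlongrightarrow> L') at_i_infinity"
      using assms \<open>A \<in> SL2Z\<close> \<open>finite_cusp A\<close> unfolding tame_def by blast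
    then show ?thesis using tendsto_mult by blast
  qed
  obtain k m where "cusp_asymp f (- real k) 0" "cusp_asymp g (- real m) 0" using assms unfolding tame_def by blast
  from cusp_asymp_mult[OF this] have "cusp_asymp (\<lambda>\<tau>. f \<tau> * g \<tau>) (- real (k + m)) 0" by (simp add: algebra_simps)
  then show "\<exists>k. cusp_asymp (\<lambda>\<tau>. f \<tau> * g \<tau>) (- real k) 0" by blast
qed

lemma jK_asymp_infinity:
  assumes K: "K \<in> cosets" and X: "X \<in> K" and eq: "X = M2 a b 0 d" and pos: "a > 0" "d > 0"
  shows "cusp_asymp (jK K) (- (of_int a / of_int d)) (cexp (-1) (of_int b / of_int d))"
proof -
  have "cusp_asymp (\<lambda>\<tau>. j ((of_int a * \<tau> + of_int b) / of_int d)) ((-1) * of_int a / of_int d) (1 * cexp (-1) (of_int b / of_int d))"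
    by (rule cusp_asymp_affine[OF j_asymp_infinity pos])
  then have "cusp_asymp (jK K) ((-1) * of_int a / of_int d) (1 * cexp (-1) (of_int b / of_int d))"
  proof (rule cusp_asymp_cong[rotated])
    show "\<forall>\<^sub>F \<tau> in at_i_infinity. j ((of_int a * \<tau> + of_int b) / of_int d) = jK K \<tau>"
      using eventually_uhp
    proof eventually_elim
      case (elim \<tau>)
      then show ?case using jK_eq[OF K X elim] by (simp add: eq)
    qed
  qed
  then show ?thesis by simp
qed

lemma coset_upper:
  assumes K: "K \<in> cosets"
  obtains d b where "(d, b) \<in> cusp_pairs (mat 1)" "M2 (int (n div d)) b 0 (int d) \<in> K"
proof -
  obtain x where x: "x \<in> cusp_pairs (mat 1)" "K = coset_of (cusp_matrix (mat 1) x)"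
    using K unfolding fixing_cosets_one[symmetric] cusp_cosets_image[OF SL2Z_one, symmetric] by blast
  obtain d b where xd: "x = (d, b)" by force
  have "adj2 (mat 1) = (mat 1 :: int^2^2)" by (simp add: mat2_eq_iff)
  then have "cusp_matrix (mat 1) x = M2 (int (n div d)) b 0 (int d)" by (simp add: cusp_matrix_def xd)
  then show ?thesis using that[of d b] x xd in_coset_of[OF cusp_matrix_in_M[OF SL2Z_one x(1)]] by simp
qed

lemma cusp_pairs_dvd: "(d, b) \<in> cusp_pairs A \<Longrightarrow> d dvd n \<and> d > 0 \<and> n div d > 0"
  unfolding cusp_pairs_def using n_pos by (auto intro: dvd_pos_nat simp: div_greater_zero_iff dvd_imp_le)

lemma tame_jK:
  assumes K: "K \<in> cosets"
  shows "tame (jK K)"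
  unfolding tame_def
proof (intro conjI ballI impI)
  show "jK K holomorphic_on uhp" by (rule holomorphic_jK[OF K])
  show "\<exists>L. ((\<lambda>\<tau>. jK K (moebius A \<tau>)) \<longlongrightarrow> L) at_i_infinity" if A: "A \<in> SL2Z" "finite_cusp A" for A
  proof -
    obtain X where X: "X \<in> M" "X \<in> K" using cosetE[OF K] by metis
    have "det (X ** A) > 0" using M_det_pos[OF X(1)] A by (simp add: det_mul SL2Z_det)
    then obtain B a b d where B: "B \<in> SL2Z" "a > 0" "d > 0" "X ** A = B ** M2 a b 0 d"
      using column_decomposition by metis
    have "finite_cusp B" using finite_cusp_M_iff[OF A(1) X(1) B(1,4)] A(2) B(2) by simp
    then obtain L where "((\<lambda>\<tau>. j (moebius B \<tau>)) \<longlongrightarrow> L) at_i_infinity" using j_limit[OF B(1)] by blast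
    from filterlim_compose[OF this filterlim_affine_at_i_infinity[OF B(2,3)]]
    have "((\<lambda>\<tau>. j (moebius B ((of_int a * \<tau> + of_int b) / of_int d))) \<longlongrightarrow> L) at_i_infinity" .
    then have "((\<lambda>\<tau>. jK K (moebius A \<tau>)) \<longlongrightarrow> L) at_i_infinity"
    proof (rule Lim_transform_eventually)
      show "\<forall>\<^sub>F \<tau> in at_i_infinity. j (moebius B ((of_int a * \<tau> + of_int b) / of_int d)) = jK K (moebius A \<tau>)"
        using eventually_uhp by eventually_elim (rule jK_at_cusp[OF K X(2) A(1) B(1,4), symmetric])
    qed
    then show ?thesis by blast
  qed
  obtain d b where db: "(d, b) \<in> cusp_pairs (mat 1)" "M2 (int (n div d)) b 0 (int d) \<in> K"
    using coset_upper[OF K] .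
  have pos: "int (n div d) > 0" "int d > 0" using cusp_pairs_dvd[OF db(1)] by auto
  have "real (n div d) / real d \<le> real (n div d)"
    using pos by (simp add: divide_le_eq_1 field_simps)
  also have "\<dots> \<le> real n" by simp
  finally have "- real (Suc n) < - (of_int (int (n div d)) / of_int (int d))" by simp
  from cusp_asymp_smaller[OF jK_asymp_infinity[OF K db(2) refl pos] this]
  show "\<exists>k. cusp_asymp (jK K) (- real k) 0" by blast
qed

lemma tame_coeff_prod:
  assumes "finite I" "\<And>i. i \<in> I \<Longrightarrow> tame (f i)"
  shows "tame (\<lambda>\<tau>. Polynomial.coeff (\<Prod>i\<in>I. [:- f i \<tau>, 1:]) m)"
  using assms
proof (induction I arbitrary: m rule: finite_induct)
  case empty
  then show ?case using tame_const by simp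
next
  case (insert i I)
  have IH: "tame (\<lambda>\<tau>. Polynomial.coeff (\<Prod>i\<in>I. [:- f i \<tau>, 1:]) m)" for m using insert by simp
  have shift: "tame (\<lambda>\<tau>. Polynomial.coeff (pCons 0 (\<Prod>i\<in>I. [:- f i \<tau>, 1:])) m)"
    using IH tame_const[of 0] by (cases m) (simp_all add: coeff_pCons)
  have "tame (\<lambda>\<tau>. (-1) * f i \<tau> * Polynomial.coeff (\<Prod>i\<in>I. [:- f i \<tau>, 1:]) m + Polynomial.coeff (pCons 0 (\<Prod>i\<in>I. [:- f i \<tau>, 1:])) m)"
    by (intro tame_add tame_mult IH shift insert.prems tame_const) simp
  then show ?case using insert.hyps by simp
qed

lemma coset_product_invariant:
  assumes "G \<in> Gamma0 N" "\<tau> \<in> uhp"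
  shows "(\<Prod>K\<in>cosets. [:- jK K (moebius G \<tau>), 1:]) = (\<Prod>K\<in>cosets. [:- jK K \<tau>, 1:])"
proof -
  have "(\<Prod>K\<in>cosets. [:- jK K (moebius G \<tau>), 1:]) = (\<Prod>K\<in>cosets. [:- jK (right_mult G K) \<tau>, 1:])"
    using assms by (intro prod.cong refl) (simp add: jK_moebius)
  also have "\<dots> = (\<Prod>K\<in>cosets. [:- jK K \<tau>, 1:])"
    by (rule prod.reindex_bij_betw[OF bij_right_mult[OF assms(1)]])
  finally show ?thesis .
qed

text \<open>Every coefficient of the product over the cosets is invariant and tame, hence a polynomial in \<open>j\<close>.
  The polynomial over these coefficients is unique because \<open>j\<close> takes infinitely many values.\<close>

lemma modular_poly_spec:
  assumes "\<tau> \<in> uhp"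
  shows "map_poly (\<lambda>c. poly c (j \<tau>)) (modular_poly N n j) = (\<Prod>K\<in>cosets. [:- jK K \<tau>, 1:])"
proof -
  define F where "F \<tau> = (\<Prod>K\<in>cosets. [:- jK K \<tau>, 1:])" for \<tau>
  have "\<exists>P. \<forall>\<tau>\<in>uhp. Polynomial.coeff (F \<tau>) m = poly P (j \<tau>)" for m
  proof -
    have t: "tame (\<lambda>\<tau>. Polynomial.coeff (F \<tau>) m)" unfolding F_def by (intro tame_coeff_prod finite_cosets tame_jK)
    then obtain k where k: "cusp_asymp (\<lambda>\<tau>. Polynomial.coeff (F \<tau>) m) (- real k) 0" unfolding tame_def by blast
    show ?thesis
    proof (rule polynomial_in_j[OF _ _ _ k])
      show "Polynomial.coeff (F (moebius G \<tau>)) m = Polynomial.coeff (F \<tau>) m" if "G \<in> Gamma0 N" "\<tau> \<in> uhp" for G \<tau>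
        unfolding F_def coset_product_invariant[OF that] ..
    qed (use t in \<open>auto simp: tame_def\<close>)
  qed
  then obtain P where P: "\<And>m \<tau>. \<tau> \<in> uhp \<Longrightarrow> Polynomial.coeff (F \<tau>) m = poly (P m) (j \<tau>)" by metis
  define \<Phi> where "\<Phi> = (\<Sum>m\<le>card cosets. Polynomial.monom (P m) m)"
  have coeff_\<Phi>: "Polynomial.coeff \<Phi> m = (if m \<le> card cosets then P m else 0)" for m
    unfolding \<Phi>_def by (simp add: coeff_sum sum.delta')
  have deg: "Polynomial.degree (F \<tau>) = card cosets" for \<tau>
    unfolding F_def by (subst degree_prod_eq_sum_degree) auto
  have ex: "\<forall>\<tau>\<in>uhp. map_poly (\<lambda>c. poly c (j \<tau>)) \<Phi> = F \<tau>"
  proof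
    fix \<tau> assume \<tau>: "\<tau> \<in> uhp"
    show "map_poly (\<lambda>c. poly c (j \<tau>)) \<Phi> = F \<tau>"
    proof (rule poly_eqI)
      fix m
      have "Polynomial.coeff (F \<tau>) m = 0" if "m > card cosets"
        using that deg[of \<tau>] by (intro coeff_eq_0) simp
      then show "Polynomial.coeff (map_poly (\<lambda>c. poly c (j \<tau>)) \<Phi>) m = Polynomial.coeff (F \<tau>) m"
        using P[OF \<tau>, of m] by (auto simp: coeff_map_poly coeff_\<Phi>)
    qed
  qed
  have uniq: "\<Psi> = \<Phi>" if "\<forall>\<tau>\<in>uhp. map_poly (\<lambda>c. poly c (j \<tau>)) \<Psi> = F \<tau>" for \<Psi>
  proof (rule poly_eqI)
    fix m
    have "poly (Polynomial.coeff \<Psi> m) (j \<tau>) = poly (Polynomial.coeff \<Phi> m) (j \<tau>)" if "\<tau> \<in> uhp" for \<tau>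
    proof -
      have "Polynomial.coeff (map_poly (\<lambda>c. poly c (j \<tau>)) \<Psi>) m = Polynomial.coeff (map_poly (\<lambda>c. poly c (j \<tau>)) \<Phi>) m"
        using ex \<open>\<forall>\<tau>\<in>uhp. map_poly (\<lambda>c. poly c (j \<tau>)) \<Psi> = F \<tau>\<close> that by simp
      then show ?thesis by (simp add: coeff_map_poly)
    qed
    then show "Polynomial.coeff \<Psi> m = Polynomial.coeff \<Phi> m" by (rule poly_eq_if_eq_at_j)
  qed
  have "modular_poly N n j = \<Phi>"
    unfolding modular_poly_def using ex uniq unfolding F_def jK_def by (intro the_equality) blast+
  then show ?thesis using ex assms by (simp add: F_def)
qed

lemma poly_diagonal: "poly (diagonal \<Phi>) x = poly (map_poly (\<lambda>c. poly c x) \<Phi>) x" for x :: complex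
  unfolding diagonal_def by (induction \<Phi>) (simp_all add: map_poly_pCons)

definition diag :: "complex poly" where
  "diag = diagonal (modular_poly N n j)"

lemma poly_diag_j:
  assumes "\<tau> \<in> uhp"
  shows "poly diag (j \<tau>) = (\<Prod>K\<in>cosets. j \<tau> - jK K \<tau>)"
  unfolding diag_def poly_diagonal modular_poly_spec[OF assms] by (simp add: poly_prod)

end

section \<open>Arithmetic of the cusp exponents\<close>

lemma card_residue_class:
  fixes h r :: int
  assumes "h > 0"
  shows "card {b \<in> {0..<h * int d}. b mod h = r mod h} = d"
proof -
  have "{b \<in> {0..<h * int d}. b mod h = r mod h} = (\<lambda>i. r mod h + h * int i) ` {..<d}"
  proof (intro equalityI subsetI)
    fix b assume b: "b \<in> {b \<in> {0..<h * int d}. b mod h = r mod h}"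
    have "b = r mod h + h * int (nat (b div h))"
      using b assms mult_div_mod_eq[of h b] by (simp add: pos_imp_zdiv_nonneg_iff)
    moreover have "b div h < int d"
    proof -
      have "h * (b div h) \<le> b" using mult_div_mod_eq[of h b] pos_mod_sign[OF assms, of b] by linarith
      then have "h * (b div h) < h * int d" using b by simp
      then show ?thesis using assms by (simp only: mult_less_cancel_left_pos)
    qed
    then have "nat (b div h) < d" using b assms by (simp add: nat_less_iff pos_imp_zdiv_nonneg_iff)
    ultimately show "b \<in> (\<lambda>i. r mod h + h * int i) ` {..<d}" by blast
  next
    fix b assume "b \<in> (\<lambda>i. r mod h + h * int i) ` {..<d}"
    then obtain i where i: "i < d" "b = r mod h + h * int i" by blast
    have r: "0 \<le> r mod h" "r mod h < h" using assms by auto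
    have "h * int i + h \<le> h * int d"
      using i(1) assms mult_left_mono[of "int i + 1" "int d" h] by (simp add: algebra_simps)
    then have "b < h * int d" using i(2) r(2) by linarith
    moreover have "b \<ge> 0" using i(2) r(1) assms by simp
    ultimately show "b \<in> {b \<in> {0..<h * int d}. b mod h = r mod h}" using i(2) by simp
  qed
  moreover have "inj_on (\<lambda>i. r mod h + h * int i) {..<d}"
    using assms by (intro inj_onI) simp
  ultimately show ?thesis by (simp add: card_image)
qed

text \<open>The congruence is linear in \<open>b\<close>. Its solutions form a single class modulo the width of the
  cusp, if there are any.\<close>

lemma card_linear_congruence:
  fixes c v x :: int
  assumes N: "N > 0" and cv: "coprime c v"
  shows "card {b \<in> {0..<cusp_width N c * int d}. int N dvd c * (v * x - b * c)} =
    (if gcd c (int N div gcd c (int N)) dvd x then d else 0)"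
proof -
  define g where "g = gcd c (int N)"
  define N' where "N' = int N div g"
  define c' where "c' = c div g"
  define G where "G = gcd c N'"
  have g0: "g \<noteq> 0" using N by (simp add: g_def)
  have Ng: "int N = g * N'" and cg: "c = g * c'" by (simp_all add: N'_def c'_def g_def)
  have "coprime c' N'" unfolding c'_def N'_def g_def using N by (intro div_gcd_coprime) simp
  then have iff: "int N dvd c * y \<longleftrightarrow> N' dvd y" for y
  proof -
    have "int N dvd c * y \<longleftrightarrow> g * N' dvd g * (c' * y)" unfolding Ng by (subst (1) cg) (simp add: ac_simps)
    also have "\<dots> \<longleftrightarrow> N' dvd c' * y" using g0 by (rule dvd_times_left_cancel_iff)
    also have "\<dots> \<longleftrightarrow> N' dvd y" using \<open>coprime c' N'\<close> by (simp add: coprime_commute coprime_dvd_mult_right_iff)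
    finally show ?thesis .
  qed
  define h where "h = cusp_width N c"
  have h: "h > 0" unfolding h_def by (rule cusp_width_pos[OF N])
  show ?thesis
  proof (cases "G dvd x")
    case True
    then obtain t where t: "x = G * t" by blast
    obtain u w where uw: "u * c + w * N' = G" using bezout_int[of c N'] unfolding G_def by blast
    \<comment> \<open>The Bezout relation above gives one solution.\<close>
    define b0 where "b0 = v * t * u"
    have b0: "v * x - b0 * c = N' * (v * t * w)"
      unfolding t uw[symmetric] b0_def by (simp add: algebra_simps)
    have "int N dvd c * (v * x - b * c) \<longleftrightarrow> b mod h = b0 mod h" for b
    proof -
      have "v * x - b * c = (b0 - b) * c + N' * (v * t * w)" unfolding b0[symmetric] by (simp add: algebra_simps)
      then have "int N dvd c * (v * x - b * c) \<longleftrightarrow> N' dvd (b0 - b) * c"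
        unfolding iff by (simp add: dvd_add_left_iff)
      also have "\<dots> \<longleftrightarrow> int N dvd (b0 - b) * c\<^sup>2"
        unfolding iff[symmetric] by (simp add: power2_eq_square ac_simps)
      also have "\<dots> \<longleftrightarrow> h dvd b0 - b" unfolding h_def by (rule cusp_width_dvd_iff[OF N])
      also have "\<dots> \<longleftrightarrow> b mod h = b0 mod h" by (metis mod_eq_dvd_iff)
      finally show ?thesis .
    qed
    then show ?thesis using True card_residue_class[OF h, of d b0] by (simp add: G_def N'_def g_def h_def)
  next
    case False
    have "\<not> int N dvd c * (v * x - b * c)" for b
    proof
      assume "int N dvd c * (v * x - b * c)"
      then have "N' dvd v * x - b * c" by (simp add: iff)
      then have "G dvd v * x - b * c" unfolding G_def by (rule dvd_trans[rotated]) simp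
      moreover have "G dvd b * c" unfolding G_def by simp
      ultimately have "G dvd v * x" using dvd_add[of G "v * x - b * c" "b * c"] by simp
      moreover have "coprime G v" using cv unfolding G_def by (meson coprime_divisors dvd_refl gcd_dvd1)
      ultimately show False using False by (simp add: coprime_dvd_mult_right_iff)
    qed
    then have "{b \<in> {0..<h * int d}. int N dvd c * (v * x - b * c)} = {}" by blast
    then show ?thesis using False by (simp add: G_def N'_def g_def h_def del: Collect_empty_eq)
  qed
qed

text \<open>The divisor \<open>d\<close> is paired with \<open>n / d\<close>, and no divisor is paired with itself.\<close>

lemma small_divisors_card:
  assumes "n > 0" "\<not> (\<exists>k::nat. n = k\<^sup>2)"
  shows "card {d. d dvd n} div 2 = card {d. d dvd n \<and> d < n div d}"
proof -
  have fin: "finite {d. d dvd n}" using assms(1) by simp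
  have ne: "d \<noteq> n div d" if "d dvd n" for d
  proof
    assume "d = n div d"
    then have "n = d\<^sup>2" using that by (metis dvd_mult_div_cancel power2_eq_square)
    then show False using assms(2) by blast
  qed
  have inv: "n div (n div d) = d" if dn: "d dvd n" for d
  proof -
    obtain m where "n = d * m" using dn by blast
    then show ?thesis using assms(1) by simp
  qed
  have dv: "n div d dvd n" if "d dvd n" for d using that by (metis dvd_mult_div_cancel dvd_triv_right)
  have "bij_betw (\<lambda>d. n div d) {d. d dvd n \<and> d < n div d} {d. d dvd n \<and> n div d < d}"
  proof (rule bij_betw_byWitness[of _ "\<lambda>d. n div d"])
    show "(\<lambda>d. n div d) ` {d. d dvd n \<and> d < n div d} \<subseteq> {d. d dvd n \<and> n div d < d}"
      using inv dv by fastforce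
    show "(\<lambda>d. n div d) ` {d. d dvd n \<and> n div d < d} \<subseteq> {d. d dvd n \<and> d < n div d}"
      using inv dv by fastforce
  qed (use inv in blast)+
  then have c: "card {d. d dvd n \<and> d < n div d} = card {d. d dvd n \<and> n div d < d}"
    by (rule bij_betw_same_card)
  have "{d. d dvd n} = {d. d dvd n \<and> d < n div d} \<union> {d. d dvd n \<and> n div d < d}"
    using ne by (auto simp: neq_iff)
  then have "card {d. d dvd n} = card {d. d dvd n \<and> d < n div d} + card {d. d dvd n \<and> n div d < d}"
    using fin by (metis (no_types, lifting) card_Un_disjoint disjoint_iff finite_Un less_asym mem_Collect_eq)
  then show ?thesis using c by simp
qed

text \<open>The product is \<open>(-1)\<^sup>d\<close> times \<open>exp (- \<pi> \<i> (d - 1)) = (-1)\<^sup>d\<^sup>-\<^sup>1\<close>.\<close>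

lemma prod_neg_roots_of_unity:
  assumes "d > 0"
  shows "(\<Prod>b\<in>{0..<int d}. - cexp (-1) (of_int b / of_nat d)) = -1"
proof -
  have "(\<Prod>b\<in>{0..<int d}. - cexp (-1) (of_int b / of_nat d)) = (\<Prod>b<d. - cexp (-1) (of_nat b / of_nat d))"
    by (rule prod.reindex_bij_witness[of _ int nat]) auto
  also have "\<dots> = (-1) ^ d * (\<Prod>b<d. cexp (-1) (of_nat b / of_nat d))"
    by (simp add: prod_uminus)
  also have "(\<Prod>b<d. cexp (-1) (of_nat b / of_nat d)) = exp (\<Sum>b<d. - (2 * of_real pi * \<i> * (of_nat b / of_nat d)))"
    by (simp add: cexp_def exp_sum)
  also have "(\<Sum>b<d. - (2 * of_real pi * \<i> * (of_nat b / of_nat d))) = - (2 * of_real pi * \<i> / of_nat d) * of_nat (\<Sum>b<d. b)"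
    by (simp add: sum_distrib_left sum_negf)
  also have "(\<Sum>b<d. b) = d * (d - 1) div 2"
    using Sum_Ico_nat[of 0 d] by (simp add: atLeast0LessThan)
  also have "of_nat (d * (d - 1) div 2) = (of_nat d * of_nat (d - 1) / 2 :: complex)"
  proof -
    have "even (d * (d - 1))" by (cases d) auto
    then have "2 * (d * (d - 1) div 2) = d * (d - 1)" by simp
    then have "2 * of_nat (d * (d - 1) div 2) = (of_nat d * of_nat (d - 1) :: complex)"
      by (metis of_nat_mult of_nat_numeral)
    then show ?thesis by (simp add: eq_divide_eq mult.commute)
  qed
  also have "- (2 * of_real pi * \<i> / of_nat d) * (of_nat d * of_nat (d - 1) / 2) = of_nat (d - 1) * (- (of_real pi * \<i>))"
    using assms by simp
  also have "exp \<dots> = (-1) ^ (d - 1)"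
    by (simp only: exp_of_nat_mult) (simp add: exp_minus)
  finally show ?thesis using assms by (cases d) (simp_all flip: power_add mult_2)
qed

section \<open>The diagonal near the cusps\<close>

locale nonsquare_hecke = hecke_correspondence +
  assumes nonsquare: "\<not> (\<exists>k::nat. n = k\<^sup>2)"
begin

lemma cofactor_neq: "d dvd n \<Longrightarrow> n div d \<noteq> d"
  using nonsquare by (metis dvd_mult_div_cancel power2_eq_square)

lemma prod_over_cosets:
  assumes "A \<in> SL2Z"
  shows "(\<Prod>K\<in>fixing_cosets A. f K) = (\<Prod>x\<in>cusp_pairs A. f (coset_of (cusp_matrix A x)))"
  unfolding cusp_cosets_image[OF assms, symmetric]
  by (simp add: prod.reindex[OF inj_cusp_matrix_coset[OF assms]])

subsection \<open>Leading coefficient\<close>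

lemma poly_j_asymp:
  assumes "P \<noteq> 0"
  shows "cusp_asymp (\<lambda>\<tau>. poly P (j \<tau>)) (- real (Polynomial.degree P)) (Polynomial.lead_coeff P)"
  using assms
proof (induction P)
  case 0
  then show ?case by simp
next
  case (pCons a P)
  show ?case
  proof (cases "P = 0")
    case True
    then show ?thesis using cusp_asymp_const[of a] by simp
  next
    case False
    have "cusp_asymp (\<lambda>\<tau>. j \<tau> * poly P (j \<tau>)) (-1 + - real (Polynomial.degree P)) (1 * Polynomial.lead_coeff P)"
      by (intro cusp_asymp_mult j_asymp_infinity pCons.IH False)
    from cusp_asymp_diff_left[OF this cusp_asymp_const[of "- a"]]
    show ?thesis using False by (simp add: algebra_simps)
  qed
qed

text \<open>The factor of \<open>(a b; 0 d)\<close> is \<open>j\<close> minus a function with a pole of order \<open>a / d\<close>. Only when \<open>a > d\<close>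
  does the latter dominate and contribute a constant other than \<open>1\<close>.\<close>

lemma diagonal_asymp_infinity:
  "\<exists>e. cusp_asymp (\<lambda>\<tau>. \<Prod>K\<in>cosets. j \<tau> - jK K \<tau>) e ((-1) ^ card {d. d dvd n \<and> d < n div d})"
proof -
  define c where "c = (\<lambda>(d, b). if d < n div d then - cexp (-1) (of_int b / of_nat d) else 1)"
  define X where "X x = coset_of (cusp_matrix (mat 1) x)" for x
  have one: "adj2 (mat 1) = (mat 1 :: int^2^2)" by (simp add: mat2_eq_iff)
  have "\<exists>e. cusp_asymp (\<lambda>\<tau>. j \<tau> - jK (X x) \<tau>) e (c x)" if x: "x \<in> cusp_pairs (mat 1)" for x
  proof -
    obtain d b where xd: "x = (d, b)" by force
    note d = cusp_pairs_dvd[OF x[unfolded xd]]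
    have M: "cusp_matrix (mat 1) x \<in> M" by (rule cusp_matrix_in_M[OF SL2Z_one x])
    have eq: "cusp_matrix (mat 1) x = M2 (int (n div d)) b 0 (int d)" by (simp add: cusp_matrix_def xd one)
    have "cusp_asymp (jK (X x)) (- (of_int (int (n div d)) / of_int (int d))) (cexp (-1) (of_int b / of_int (int d)))"
      using jK_asymp_infinity[OF coset_of_in[OF M] in_coset_of[OF M] eq] d unfolding X_def by simp
    then have as: "cusp_asymp (jK (X x)) (- (real (n div d) / real d)) (cexp (-1) (of_int b / of_nat d))" by simp
    consider "d < n div d" | "n div d < d" using cofactor_neq[of d] d by linarith
    then show ?thesis
    proof cases
      case 1
      then have "- (real (n div d) / real d) < -1" using d by (simp add: field_simps)
      from cusp_asymp_diff_right[OF j_asymp_infinity as this] show ?thesis using 1 unfolding c_def xd by auto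
    next
      case 2
      then have "-1 < - (real (n div d) / real d)" using d by (simp add: field_simps)
      from cusp_asymp_diff_left[OF j_asymp_infinity as this] show ?thesis using 2 unfolding c_def xd by auto
    qed
  qed
  then obtain e where e: "\<And>x. x \<in> cusp_pairs (mat 1) \<Longrightarrow> cusp_asymp (\<lambda>\<tau>. j \<tau> - jK (X x) \<tau>) (e x) (c x)" by metis
  have "cusp_asymp (\<lambda>\<tau>. \<Prod>x\<in>cusp_pairs (mat 1). j \<tau> - jK (X x) \<tau>) (\<Sum>x\<in>cusp_pairs (mat 1). e x) (\<Prod>x\<in>cusp_pairs (mat 1). c x)"
    by (intro cusp_asymp_prod finite_cusp_pairs e)
  moreover have "(\<Prod>x\<in>cusp_pairs (mat 1). j \<tau> - jK (X x) \<tau>) = (\<Prod>K\<in>cosets. j \<tau> - jK K \<tau>)" for \<tau>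
    unfolding X_def using prod_over_cosets[OF SL2Z_one, of "\<lambda>K. j \<tau> - jK K \<tau>"] by (simp add: fixing_cosets_one)
  moreover have "(\<Prod>x\<in>cusp_pairs (mat 1). c x) = (-1) ^ card {d. d dvd n \<and> d < n div d}"
  proof -
    have pairs: "cusp_pairs (mat 1) = (SIGMA d:{d. d dvd n}. {0..<int d})"
      using N_pos by (auto simp: cusp_pairs_def cusp_width_def)
    have "(\<Prod>x\<in>cusp_pairs (mat 1). c x) = (\<Prod>d\<in>{d. d dvd n}. \<Prod>b\<in>{0..<int d}. c (d, b))"
      unfolding pairs using n_pos by (subst prod.Sigma) auto
    also have "\<dots> = (\<Prod>d\<in>{d. d dvd n}. if d < n div d then -1 else 1)"
      by (intro prod.cong refl) (use n_pos in \<open>auto simp: c_def prod_neg_roots_of_unity dvd_pos_nat\<close>)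
    also have "\<dots> = (\<Prod>d\<in>{d. d dvd n \<and> d < n div d}. -1)"
      using n_pos by (intro prod.mono_neutral_cong_right) auto
    finally show ?thesis by simp
  qed
  ultimately show ?thesis by auto
qed

text \<open>The leading coefficient of a polynomial is visible in its expansion at infinity after substituting
  \<open>j\<close>.\<close>

lemma diag_nonzero_and_lead_coeff:
  "diag \<noteq> 0" "Polynomial.lead_coeff diag = (-1) ^ (card {d. d dvd n} div 2)"
proof -
  let ?s = "(-1) ^ card {d. d dvd n \<and> d < n div d} :: complex"
  obtain e where "cusp_asymp (\<lambda>\<tau>. \<Prod>K\<in>cosets. j \<tau> - jK K \<tau>) e ?s" using diagonal_asymp_infinity by blast
  then have e: "cusp_asymp (\<lambda>\<tau>. poly diag (j \<tau>)) e ?s"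
    by (rule cusp_asymp_cong[rotated]) (use eventually_uhp in \<open>auto elim!: eventually_mono simp: poly_diag_j\<close>)
  show nz: "diag \<noteq> 0"
  proof
    assume "diag = 0"
    then have "((\<lambda>\<tau>::complex. 0) \<longlongrightarrow> ?s) at_i_infinity" using e by (simp add: cusp_asymp_def)
    then have "?s = 0" using tendsto_unique[OF at_i_infinity_neq_bot _ tendsto_const] by blast
    then show False by simp
  qed
  then have "Polynomial.lead_coeff diag \<noteq> 0" by simp
  then have "Polynomial.lead_coeff diag = ?s"
    using cusp_asymp_unique(2)[OF poly_j_asymp[OF nz] e] by simp
  then show "Polynomial.lead_coeff diag = (-1) ^ (card {d. d dvd n} div 2)"
    using small_divisors_card[OF n_pos nonsquare] by simp
qed

subsection \<open>Orders at the finite cusps\<close>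

text \<open>The exponent is the vanishing order in \<open>exp (2 \<pi> \<i> \<tau> / N)\<close> divided by \<open>N\<close>. It multiplies both sides of
  the comparison in \<open>order_at_cusp\<close> and cancels there.\<close>

lemma cusp_local_expansion:
  assumes A: "A \<in> SL2Z" and L: "((\<lambda>\<tau>. j (moebius A \<tau>)) \<longlongrightarrow> L) at_i_infinity"
  obtains \<kappa> C where "\<kappa> > 0" "C \<noteq> 0" "cusp_asymp (\<lambda>\<tau>. j (moebius A \<tau>) - L) \<kappa> C"
proof -
  obtain G where G: "G holomorphic_on ball 0 1" "G 0 = L" "\<And>\<tau>. \<tau> \<in> uhp \<Longrightarrow> j (moebius A \<tau>) = G (qpar N \<tau>)"
    "\<not> G constant_on ball 0 1" using cusp_expansion[OF A L] by blast
  define F where "F q = G q - L" for q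
  have F: "F holomorphic_on ball 0 1" unfolding F_def[abs_def] by (intro holomorphic_intros G)
  have F0: "F 0 = 0" by (simp add: F_def G(2))
  have Fnc: "\<not> F constant_on ball 0 1"
  proof
    assume "F constant_on ball 0 1"
    then obtain c where "\<And>q. q \<in> ball 0 1 \<Longrightarrow> F q = c" unfolding constant_on_def by blast
    then have "\<And>q. q \<in> ball 0 1 \<Longrightarrow> G q = c + L" unfolding F_def by (metis diff_add_cancel)
    then show False using G(4) unfolding constant_on_def by blast
  qed
  have z: "(0::complex) \<in> ball 0 1" by simp
  obtain g r m where g: "0 < m" "0 < r" "ball (0::complex) r \<subseteq> ball 0 1" "g holomorphic_on ball 0 r"
    "\<And>w. w \<in> ball 0 r \<Longrightarrow> F w = (w - 0) ^ m * g w" "\<And>w. w \<in> ball 0 r \<Longrightarrow> g w \<noteq> 0"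
    by (rule holomorphic_factor_zero_nonconstant[OF F open_ball connected_ball z F0 Fnc]) metis
  have "isCont g 0"
    using holomorphic_on_imp_continuous_on[OF g(4)] g(2) by (simp add: continuous_on_eq_continuous_at)
  then have "(g \<longlongrightarrow> g 0) (at 0)" by (simp add: isCont_def)
  from filterlim_compose[OF this tendsto_qpar[OF N_pos]]
  have "((\<lambda>\<tau>. g (qpar N \<tau>)) \<longlongrightarrow> g 0) at_i_infinity" .
  moreover have "\<forall>\<^sub>F \<tau> in at_i_infinity. qpar N \<tau> \<in> ball 0 r"
    using tendsto_qpar[OF N_pos] g(2) unfolding filterlim_at by (auto dest!: tendstoD[of _ 0])
  then have "\<forall>\<^sub>F \<tau> in at_i_infinity. g (qpar N \<tau>) = (j (moebius A \<tau>) - L) * cexp (- (real m / real N)) \<tau>"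
    using eventually_uhp
  proof eventually_elim
    case (elim \<tau>)
    have "j (moebius A \<tau>) - L = cexp (real m / real N) \<tau> * g (qpar N \<tau>)"
      using g(5)[OF elim(1)] G(3)[OF elim(2)] by (simp add: F_def qpar_power[OF N_pos])
    then have "(j (moebius A \<tau>) - L) * cexp (- (real m / real N)) \<tau> =
        (cexp (real m / real N) \<tau> * cexp (- (real m / real N)) \<tau>) * g (qpar N \<tau>)" by simp
    also have "cexp (real m / real N) \<tau> * cexp (- (real m / real N)) \<tau> = 1"
      unfolding cexp_add[symmetric] by simp
    finally show ?case by simp
  qed
  ultimately have "cusp_asymp (\<lambda>\<tau>. j (moebius A \<tau>) - L) (real m / real N) (g 0)"
    unfolding cusp_asymp_def by (rule Lim_transform_eventually)
  moreover have "real m / real N > 0" using g(1) N_pos by simp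
  moreover have "g 0 \<noteq> 0" using g(2,6) by simp
  ultimately show ?thesis using that by blast
qed

text \<open>Both \<open>j - L\<close> and its composition with \<open>\<tau> \<mapsto> (a \<tau> + b) / d\<close> vanish at the cusp, to orders in the
  ratio \<open>1\<close> to \<open>a / d\<close>, and \<open>a \<noteq> d\<close>.\<close>

lemma fixing_factor_asymp:
  assumes A: "A \<in> SL2Z" and x: "(d, b) \<in> cusp_pairs A"
    and j: "cusp_asymp (\<lambda>\<tau>. j (moebius A \<tau>) - L) \<kappa> C" "\<kappa> > 0" "C \<noteq> 0"
  shows "\<exists>C'. C' \<noteq> 0 \<and> cusp_asymp (\<lambda>\<tau>. j (moebius A \<tau>) - jK (coset_of (cusp_matrix A (d, b))) (moebius A \<tau>))
    (\<kappa> * min 1 (real (n div d) / real d)) C'"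
proof -
  note d = cusp_pairs_dvd[OF x]
  define X where "X = cusp_matrix A (d, b)"
  have XM: "X \<in> M" unfolding X_def by (rule cusp_matrix_in_M[OF A x])
  have eq: "X ** A = A ** M2 (int (n div d)) b 0 (int d)"
    unfolding X_def cusp_matrix_def using A by (simp add: adj2_cancel SL2Z_det)
  have "cusp_asymp (\<lambda>\<tau>. j (moebius A ((of_int (int (n div d)) * \<tau> + of_int b) / of_int (int d))) - L)
    (\<kappa> * of_int (int (n div d)) / of_int (int d)) (C * cexp \<kappa> (of_int b / of_int (int d)))"
    by (rule cusp_asymp_affine[OF j(1)]) (use d in auto)
  then have "cusp_asymp (\<lambda>\<tau>. jK (coset_of X) (moebius A \<tau>) - L)
    (\<kappa> * of_int (int (n div d)) / of_int (int d)) (C * cexp \<kappa> (of_int b / of_int (int d)))"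
  proof (rule cusp_asymp_cong[rotated])
    show "\<forall>\<^sub>F \<tau> in at_i_infinity. j (moebius A ((of_int (int (n div d)) * \<tau> + of_int b) / of_int (int d))) - L =
       jK (coset_of X) (moebius A \<tau>) - L"
      using eventually_uhp
    proof eventually_elim
      case (elim \<tau>)
      show ?case unfolding jK_at_cusp[OF coset_of_in[OF XM] in_coset_of[OF XM] A A eq elim] ..
    qed
  qed
  then have as: "cusp_asymp (\<lambda>\<tau>. jK (coset_of X) (moebius A \<tau>) - L) (\<kappa> * (real (n div d) / real d)) (C * cexp \<kappa> (of_int b / of_nat d))"
    by simp
  consider "d < n div d" | "n div d < d" using cofactor_neq[of d] d by linarith
  then show ?thesis
  proof cases
    case 1
    then have r: "1 < real (n div d) / real d" using d by (simp add: field_simps)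
    then have "\<kappa> < \<kappa> * (real (n div d) / real d)" using j(2) by (simp del: times_divide_eq_right)
    from cusp_asymp_diff_left[OF j(1) as this] show ?thesis using r j(3) unfolding X_def by auto
  next
    case 2
    then have r: "real (n div d) / real d < 1" using d by (simp add: field_simps)
    then have "\<kappa> * (real (n div d) / real d) < \<kappa>" using j(2) by (simp del: times_divide_eq_right)
    from cusp_asymp_diff_right[OF j(1) as this] show ?thesis using r j(3) unfolding X_def
      by (intro exI[of _ "- (C * cexp \<kappa> (of_int b / of_nat d))"]) (auto simp: min_def)
  qed
qed

text \<open>The coset moves the cusp to an inequivalent one, where \<open>j\<close> takes a different value.\<close>

lemma nonfixing_factor_limit:
  assumes A: "A \<in> SL2Z" and fin: "finite_cusp A" and L: "((\<lambda>\<tau>. j (moebius A \<tau>)) \<longlongrightarrow> L) at_i_infinity"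
    and K: "K \<in> cosets - fixing_cosets A"
  shows "\<exists>C'. C' \<noteq> 0 \<and> cusp_asymp (\<lambda>\<tau>. j (moebius A \<tau>) - jK K (moebius A \<tau>)) 0 C'"
proof -
  have Kc: "K \<in> cosets" using K by simp
  obtain X where X: "X \<in> M" "X \<in> K" using cosetE[OF Kc] by metis
  have "det (X ** A) > 0" using M_det_pos[OF X(1)] A by (simp add: det_mul SL2Z_det)
  then obtain B a b d where B: "B \<in> SL2Z" "a > 0" "d > 0" "X ** A = B ** M2 a b 0 d"
    using column_decomposition by metis
  have "finite_cusp B" using finite_cusp_M_iff[OF A X(1) B(1,4)] fin B(2) by simp
  then obtain L' where L': "((\<lambda>\<tau>. j (moebius B \<tau>)) \<longlongrightarrow> L') at_i_infinity" using j_limit[OF B(1)] by blast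
  from filterlim_compose[OF this filterlim_affine_at_i_infinity[OF B(2,3), of b]]
  have "((\<lambda>\<tau>. jK K (moebius A \<tau>)) \<longlongrightarrow> L') at_i_infinity"
  proof (rule Lim_transform_eventually)
    show "\<forall>\<^sub>F \<tau> in at_i_infinity. j (moebius B ((of_int a * \<tau> + of_int b) / of_int d)) = jK K (moebius A \<tau>)"
      using eventually_uhp by eventually_elim (rule jK_at_cusp[OF Kc X(2) A B(1,4), symmetric])
  qed
  with L have "((\<lambda>\<tau>. j (moebius A \<tau>) - jK K (moebius A \<tau>)) \<longlongrightarrow> L - L') at_i_infinity" by (rule tendsto_diff)
  moreover have "L \<noteq> L'"
  proof
    assume "L = L'"
    then have "cusp_equiv N (cusp_act A None) (cusp_act B None)"
      using cusp_values_distinct[OF A L B(1)] L' by simp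
    then obtain G where G: "G \<in> Gamma0 N" "cusp_act B None = cusp_act G (cusp_act A None)"
      unfolding cusp_equiv_def by blast
    have "cusp_act B None = cusp_act (G ** A) None"
      using G A by (simp add: cusp_act_mult SL2Z_det Gamma0_det del: cusp_act.simps)
    then have z: "(adj2 (G ** A) ** B)$2$1 = 0"
      using B(1) A G(1) by (subst (asm) cusp_equiv_matrix_iff) (auto simp: SL2Z_det Gamma0_det det_mul)
    have "adj2 A ** (adj2 G ** X) ** A = adj2 A ** adj2 G ** (X ** A)" by (simp add: matrix_mul_assoc)
    also have "\<dots> = (adj2 (G ** A) ** B) ** M2 a b 0 d" unfolding B(4) by (simp add: adj2_matmul matrix_mul_assoc)
    finally have "(adj2 A ** (adj2 G ** X) ** A)$2$1 = 0"
      by (simp only: matmul_nth[of "adj2 (G ** A) ** B"] z) simp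
    then have "K \<in> fixing_cosets A"
      unfolding fixing_cosets_def using coset_left_closed[OF Kc X(2) Gamma0_adj2[OF G(1)]] Kc by blast
    then show False using K by blast
  qed
  ultimately show ?thesis by (intro exI[of _ "L - L'"]) (simp add: cusp_asymp_0_iff)
qed

text \<open>Comparison of two expansions of the diagonal at the cusp: the product over all cosets, and the
  power of \<open>j - L\<close> that divides the polynomial.\<close>

lemma order_at_cusp:
  assumes A: "A \<in> SL2Z" and fin: "finite_cusp A" and L: "((\<lambda>\<tau>. j (moebius A \<tau>)) \<longlongrightarrow> L) at_i_infinity"
  shows "real (Polynomial.order L diag) = (\<Sum>(d, b)\<in>cusp_pairs A. min 1 (real (n div d) / real d))"
proof -
  define w where "w = (\<lambda>(d, b::int). min 1 (real (n div d) / real d))"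
  obtain \<kappa> C where \<kappa>: "\<kappa> > 0" "C \<noteq> 0" "cusp_asymp (\<lambda>\<tau>. j (moebius A \<tau>) - L) \<kappa> C"
    using cusp_local_expansion[OF A L] .
  define F where "F K \<tau> = j (moebius A \<tau>) - jK K (moebius A \<tau>)" for K \<tau>
  have sub: "fixing_cosets A \<subseteq> cosets" unfolding fixing_cosets_def by blast
  have "\<forall>x\<in>cusp_pairs A. \<exists>C'. C' \<noteq> 0 \<and> cusp_asymp (F (coset_of (cusp_matrix A x))) (\<kappa> * w x) C'"
    using fixing_factor_asymp[OF A _ \<kappa>(3,1,2)] unfolding F_def[abs_def] w_def by auto
  then obtain C1 where C1: "\<And>x. x \<in> cusp_pairs A \<Longrightarrow> C1 x \<noteq> 0 \<and> cusp_asymp (F (coset_of (cusp_matrix A x))) (\<kappa> * w x) (C1 x)" by metis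
  have "\<forall>K\<in>cosets - fixing_cosets A. \<exists>C'. C' \<noteq> 0 \<and> cusp_asymp (F K) 0 C'"
    using nonfixing_factor_limit[OF A fin L] unfolding F_def[abs_def] by blast
  then obtain C2 where C2: "\<And>K. K \<in> cosets - fixing_cosets A \<Longrightarrow> C2 K \<noteq> 0 \<and> cusp_asymp (F K) 0 (C2 K)" by metis
  have p1: "cusp_asymp (\<lambda>\<tau>. \<Prod>x\<in>cusp_pairs A. F (coset_of (cusp_matrix A x)) \<tau>) (\<Sum>x\<in>cusp_pairs A. \<kappa> * w x) (\<Prod>x\<in>cusp_pairs A. C1 x)"
    by (intro cusp_asymp_prod finite_cusp_pairs) (use C1 in blast)
  have p2: "cusp_asymp (\<lambda>\<tau>. \<Prod>K\<in>cosets - fixing_cosets A. F K \<tau>) (\<Sum>K\<in>cosets - fixing_cosets A. 0) (\<Prod>K\<in>cosets - fixing_cosets A. C2 K)"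
    by (intro cusp_asymp_prod) (use C2 finite_cosets in auto)
  have split: "(\<Prod>x\<in>cusp_pairs A. F (coset_of (cusp_matrix A x)) \<tau>) * (\<Prod>K\<in>cosets - fixing_cosets A. F K \<tau>) = (\<Prod>K\<in>cosets. F K \<tau>)" for \<tau>
    unfolding prod_over_cosets[OF A, of "\<lambda>K. F K \<tau>", symmetric]
    using prod.subset_diff[OF sub finite_cosets, of "\<lambda>K. F K \<tau>"] by (simp add: mult.commute)
  define C3 where "C3 = (\<Prod>x\<in>cusp_pairs A. C1 x) * (\<Prod>K\<in>cosets - fixing_cosets A. C2 K)"
  have C3: "C3 \<noteq> 0" unfolding C3_def using C1 C2 finite_cusp_pairs finite_cosets by (auto simp: prod_zero_iff)
  have "cusp_asymp (\<lambda>\<tau>. \<Prod>K\<in>cosets. F K \<tau>) (\<kappa> * (\<Sum>x\<in>cusp_pairs A. w x)) C3"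
    using cusp_asymp_mult[OF p1 p2] by (simp add: split C3_def sum_distrib_left)
  then have as1: "cusp_asymp (\<lambda>\<tau>. poly diag (j (moebius A \<tau>))) (\<kappa> * (\<Sum>x\<in>cusp_pairs A. w x)) C3"
  proof (rule cusp_asymp_cong[rotated])
    show "\<forall>\<^sub>F \<tau> in at_i_infinity. (\<Prod>K\<in>cosets. F K \<tau>) = poly diag (j (moebius A \<tau>))"
      using eventually_uhp by eventually_elim (simp add: F_def poly_diag_j moebius_in_uhp_SL2Z A)
  qed
  define k where "k = Polynomial.order L diag"
  obtain Q where Q: "diag = [:- L, 1:] ^ k * Q" "\<not> [:- L, 1:] dvd Q"
    using order_decomp[OF diag_nonzero_and_lead_coeff(1), of L] unfolding k_def by blast
  have QL: "poly Q L \<noteq> 0" using Q(2) by (simp add: poly_eq_0_iff_dvd)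
  have "((\<lambda>\<tau>. poly Q (j (moebius A \<tau>))) \<longlongrightarrow> poly Q L) at_i_infinity"
    by (rule tendsto_poly[OF L])
  then have "cusp_asymp (\<lambda>\<tau>. poly Q (j (moebius A \<tau>))) 0 (poly Q L)" by (simp add: cusp_asymp_0_iff)
  from cusp_asymp_mult[OF cusp_asymp_power[OF \<kappa>(3), of k] this]
  have as2: "cusp_asymp (\<lambda>\<tau>. poly diag (j (moebius A \<tau>))) (real k * \<kappa>) (C ^ k * poly Q L)"
    unfolding Q(1) by (simp add: poly_power)
  have "real k * \<kappa> = \<kappa> * (\<Sum>x\<in>cusp_pairs A. w x)"
    using cusp_asymp_unique(1)[OF as2 as1] \<kappa>(2) QL C3 by simp
  then show ?thesis using \<kappa>(1) by (simp add: k_def w_def mult.commute)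
qed

text \<open>For fixed \<open>d\<close> the number of cosets is \<open>d\<close> or zero, and \<open>d min 1 (a / d) = min d a\<close>.\<close>

lemma order_at_cusp_eq_exponent:
  assumes A: "A \<in> SL2Z" and fin: "finite_cusp A" and L: "((\<lambda>\<tau>. j (moebius A \<tau>)) \<longlongrightarrow> L) at_i_infinity"
    and nonneg: "A$2$1 \<ge> 0" and denom: "cusp_denom s = nat (A$2$1)"
  shows "Polynomial.order L diag = cusp_exponent s n N"
proof -
  define c where "c = A$2$1"
  define m where "m = nat c"
  have m: "int m = c" unfolding m_def c_def using nonneg by (rule nat_0_le)
  define g where "g = gcd m N"
  define G where "G = gcd m (N div g)"
  have G: "int G = gcd c (int N div gcd c (int N))"
    by (simp only: G_def g_def m[symmetric] gcd_int_int_eq zdiv_int[symmetric])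
  have cv: "coprime c (A$2$2)"
  proof (rule coprimeI)
    fix e assume e: "e dvd c" "e dvd A$2$2"
    have "e dvd det A" unfolding det_2 by (intro dvd_diff dvd_mult e(2) e(1)[unfolded c_def])
    then show "is_unit e" using A by (simp add: SL2Z_det)
  qed
  have cond: "int G dvd int (n div d) - int d \<longleftrightarrow> [n = d\<^sup>2] (mod G)" if d: "d dvd n" for d
  proof -
    have "g dvd N" unfolding g_def by simp
    then have "N div g dvd N" by (metis dvd_div_mult_self dvd_triv_left)
    then have "G dvd N" unfolding G_def using gcd_dvd2 by (rule dvd_trans[rotated])
    then have "coprime d G" by (rule coprime_divisors[OF d _ coprime_n])
    have "int n - int (d\<^sup>2) = int d * (int (n div d) - int d)"
      using d by (simp add: right_diff_distrib power2_eq_square flip: of_nat_mult)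
    then have "[n = d\<^sup>2] (mod G) \<longleftrightarrow> int G dvd int d * (int (n div d) - int d)"
      by (simp add: cong_int_iff[symmetric] cong_iff_dvd_diff)
    also have "\<dots> \<longleftrightarrow> int G dvd int (n div d) - int d"
      using \<open>coprime d G\<close> by (intro coprime_dvd_mult_right_iff) (simp add: coprime_commute)
    finally show ?thesis by simp
  qed
  define B where "B d = {b \<in> {0..<cusp_width N c * int d}. int N dvd c * (A$2$2 * (int (n div d) - int d) - b * c)}" for d
  have cardB: "card (B d) = (if int G dvd int (n div d) - int d then d else 0)" for d
    unfolding B_def G by (rule card_linear_congruence[OF N_pos cv])
  have finB: "finite (B d)" for d
    unfolding B_def by (rule finite_subset[of _ "{0..<cusp_width N c * int d}"]) auto
  have "real (Polynomial.order L diag) = (\<Sum>(d, b)\<in>cusp_pairs A. min 1 (real (n div d) / real d))"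
    by (rule order_at_cusp[OF A fin L])
  also have "\<dots> = (\<Sum>d | d dvd n. \<Sum>b\<in>B d. min 1 (real (n div d) / real d))"
    unfolding cusp_pairs_def B_def[symmetric] c_def[symmetric] using n_pos finB by (subst sum.Sigma) auto
  also have "\<dots> = (\<Sum>d | d dvd n. if [n = d\<^sup>2] (mod G) then real (min d (n div d)) else 0)"
  proof (rule sum.cong[OF refl])
    fix d assume "d \<in> {d. d dvd n}"
    then have d: "d dvd n" "d > 0" using n_pos by (auto intro: dvd_pos_nat)
    have "real d * min 1 (real (n div d) / real d) = real (min d (n div d))"
      using d(2) by (auto simp: min_def field_simps)
    then show "(\<Sum>b\<in>B d. min 1 (real (n div d) / real d)) = (if [n = d\<^sup>2] (mod G) then real (min d (n div d)) else 0)"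
      by (simp add: cardB cond[OF d(1)])
  qed
  also have "\<dots> = real (\<Sum>d | d dvd n \<and> [n = d\<^sup>2] (mod G). min d (n div d))"
    using n_pos by (simp add: sum.inter_filter[symmetric])
  also have "(\<Sum>d | d dvd n \<and> [n = d\<^sup>2] (mod G). min d (n div d)) = cusp_exponent s n N"
    unfolding cusp_exponent_def Let_def denom by (simp add: G_def g_def m_def c_def)
  finally show ?thesis by simp
qed

end

section \<open>The diagonal near a point of the upper half plane\<close>

lemma moebius_fixed_point_iff:
  assumes "\<tau> \<in> uhp" "det A \<noteq> 0"
  shows "moebius A \<tau> = \<tau> \<longleftrightarrow>
    of_int (A$2$1) * \<tau>\<^sup>2 + of_int (A$2$2 - A$1$1) * \<tau> - of_int (A$1$2) = 0"
proof -
  have "moebius A \<tau> = \<tau> \<longleftrightarrow> of_int (A$1$1) * \<tau> + of_int (A$1$2) = \<tau> * den A \<tau>"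
    unfolding moebius_den using den_nonzero[OF assms] by (simp add: divide_eq_eq)
  also have "\<dots> \<longleftrightarrow> of_int (A$2$1) * \<tau>\<^sup>2 + of_int (A$2$2 - A$1$1) * \<tau> - of_int (A$1$2) = 0"
    by (auto simp: den_def power2_eq_square algebra_simps)
  finally show ?thesis .
qed

lemma square_if_square_times_square:
  assumes "int n * c\<^sup>2 = c'\<^sup>2" "c \<noteq> 0"
  shows "\<exists>k::nat. n = k\<^sup>2"
proof -
  have "c\<^sup>2 dvd c'\<^sup>2" using assms(1) by (metis dvd_triv_right)
  then have "c dvd c'" by simp
  then obtain k where k: "c' = c * k" by blast
  then have "int n * c\<^sup>2 = k\<^sup>2 * c\<^sup>2" using assms(1) by (simp add: power_mult_distrib mult.commute)
  then have "int n = k\<^sup>2" using assms(2) by simp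
  then have "int n = int ((nat \<bar>k\<bar>)\<^sup>2)" by simp
  then have "n = (nat \<bar>k\<bar>)\<^sup>2" by (simp only: of_nat_eq_iff)
  then show ?thesis by blast
qed

lemma same_vanishing_order:
  fixes f :: "complex \<Rightarrow> complex"
  assumes "((\<lambda>w. f w / (w - z) ^ p) \<longlongrightarrow> A) (at z)" "((\<lambda>w. f w / (w - z) ^ q) \<longlongrightarrow> B) (at z)"
    and "A \<noteq> 0" "B \<noteq> 0"
  shows "p = q"
proof -
  have less: False if lim: "((\<lambda>w. f w / (w - z) ^ p) \<longlongrightarrow> A) (at z)" "((\<lambda>w. f w / (w - z) ^ q) \<longlongrightarrow> B) (at z)"
    and "A \<noteq> 0" "p < q" for p q A B
  proof -
    have "((\<lambda>w. f w / (w - z) ^ q * (w - z) ^ (q - p)) \<longlongrightarrow> B * (z - z) ^ (q - p)) (at z)"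
      by (intro tendsto_intros lim)
    moreover have "B * (z - z) ^ (q - p) = 0" using \<open>p < q\<close> by (simp add: zero_power)
    ultimately have "((\<lambda>w. f w / (w - z) ^ q * (w - z) ^ (q - p)) \<longlongrightarrow> 0) (at z)" by metis
    then have "((\<lambda>w. f w / (w - z) ^ p) \<longlongrightarrow> 0) (at z)"
    proof (rule Lim_transform_eventually)
      have "f w / (w - z) ^ q * (w - z) ^ (q - p) = f w / (w - z) ^ p" if "w \<noteq> z" for w
      proof -
        have "(w - z) ^ q = (w - z) ^ p * (w - z) ^ (q - p)" using \<open>p < q\<close> by (simp flip: power_add)
        then show ?thesis using that by simp
      qed
      then show "\<forall>\<^sub>F w in at z. f w / (w - z) ^ q * (w - z) ^ (q - p) = f w / (w - z) ^ p"
        unfolding eventually_at by (intro exI[of _ 1]) auto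
    qed
    then have "A = 0" using lim(1) tendsto_unique[OF trivial_limit_at] by blast
    then show False using \<open>A \<noteq> 0\<close> by contradiction
  qed
  consider "p < q" | "q < p" | "p = q" by linarith
  then show ?thesis using less[OF assms(1,2)] less[OF assms(2,1)] assms(3,4) by cases auto
qed

context genus_zero_hauptmodul
begin

text \<open>A rotation by an \<open>m\<close>-th root of unity in the coordinate whose \<open>m\<close>-th power is \<open>j - j \<tau>\<^sub>0\<close>
  permutes the fibres of \<open>j\<close>. By injectivity it is carried out by elements of the group, which by
  proper discontinuity are finitely many and fix \<open>\<tau>\<^sub>0\<close>; the derivative identifies one of them.\<close>

lemma stabilizer_realizes_roots_of_unity:
  assumes t0: "\<tau>0 \<in> uhp" and m: "m > 0" and r: "r > 0" "ball \<tau>0 r \<subseteq> uhp"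
    and g: "g holomorphic_on ball \<tau>0 r" "\<And>w. w \<in> ball \<tau>0 r \<Longrightarrow> g w \<noteq> 0"
    and jg: "\<And>w. w \<in> ball \<tau>0 r \<Longrightarrow> j w - j \<tau>0 = (w - \<tau>0) ^ m * g w"
    and \<xi>: "\<xi> ^ m = 1"
  shows "\<exists>G\<in>Gamma0 N. moebius G \<tau>0 = \<tau>0 \<and> 1 / (den G \<tau>0)\<^sup>2 = \<xi>"
proof -
  have z: "\<tau>0 \<in> ball \<tau>0 r" using r by simp
  obtain l where l: "l holomorphic_on ball \<tau>0 r" "\<And>x. x \<in> ball \<tau>0 r \<Longrightarrow> exp (l x) = g x"
    using holomorphic_logarithm_exists[OF convex_ball open_ball g z] by metis
  define e where "e w = exp (l w / of_nat m)" for w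
  have e: "e holomorphic_on ball \<tau>0 r" unfolding e_def[abs_def] using m by (intro holomorphic_intros l) auto
  have e0: "e w \<noteq> 0" for w by (simp add: e_def)
  have em: "e w ^ m = g w" if "w \<in> ball \<tau>0 r" for w
    using l(2)[OF that] m by (simp add: e_def flip: exp_of_nat_mult)
  \<comment> \<open>A local coordinate whose \<open>m\<close>-th power is \<open>j - j \<tau>0\<close>.\<close>
  define v where "v w = (w - \<tau>0) * e w" for w
  have v: "v holomorphic_on ball \<tau>0 r" unfolding v_def[abs_def] by (intro holomorphic_intros e)
  have vm: "v w ^ m = j w - j \<tau>0" if "w \<in> ball \<tau>0 r" for w
    using jg[OF that] em[OF that] by (simp add: v_def power_mult_distrib)
  have v0: "v \<tau>0 = 0" by (simp add: v_def)
  have de: "(e has_field_derivative deriv e \<tau>0) (at \<tau>0)" by (rule holomorphic_derivI[OF e open_ball z])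
  have "(v has_field_derivative (1 - 0) * e \<tau>0 + deriv e \<tau>0 * (\<tau>0 - \<tau>0)) (at \<tau>0)"
    unfolding v_def[abs_def] by (intro DERIV_mult DERIV_diff DERIV_ident DERIV_const de)
  then have "deriv v \<tau>0 = e \<tau>0" by (simp add: DERIV_imp_deriv)
  then have dv: "deriv v \<tau>0 \<noteq> 0" using e0 by simp
  obtain s where s: "s > 0" "ball \<tau>0 s \<subseteq> ball \<tau>0 r" "inj_on v (ball \<tau>0 s)"
    using locally_injective_at_regular_point[OF v z open_ball dv] by blast
  have vs: "v holomorphic_on ball \<tau>0 s" using v s(2) by (rule holomorphic_on_subset)
  have op: "open (v ` ball \<tau>0 t)" if "t \<le> s" for t
    using that s(3) by (intro open_mapping_thm3 holomorphic_on_subset[OF vs] inj_on_subset[OF s(3)]) auto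
  \<comment> \<open>Points approaching \<open>\<tau>0\<close>; rotating them in the coordinate \<open>v\<close> gives points \<open>y k\<close> in the same fibres of \<open>j\<close>.\<close>
  define x where "x k = \<tau>0 + of_real (s / (2 * real (Suc k)))" for k
  have "(\<lambda>k. of_real (s / 2 * (1 / real (Suc k))) :: complex) \<longlonglongrightarrow> of_real (s / 2 * 0)"
    using LIMSEQ_Suc[OF lim_1_over_n] by (intro tendsto_intros)
  then have "x \<longlonglongrightarrow> \<tau>0 + of_real (s / 2 * 0)"
    unfolding x_def[abs_def] by (intro tendsto_add tendsto_const) (simp add: field_simps)
  then have xlim: "x \<longlonglongrightarrow> \<tau>0" by simp
  have x0: "x k \<noteq> \<tau>0" for k
  proof -
    have "s / (2 * real (Suc k)) \<noteq> 0" using s(1) by simp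
    then have "complex_of_real (s / (2 * real (Suc k))) \<noteq> 0" by (simp only: of_real_eq_0_iff not_False_eq_True)
    then show ?thesis unfolding x_def by (metis add_cancel_left_right)
  qed
  have xs: "x k \<in> ball \<tau>0 s" for k
  proof -
    have "s / (2 * real (Suc k)) < s"
      using s(1) mult_strict_left_mono[of 1 "2 * real (Suc k)" s] by (subst pos_divide_less_eq) simp_all
    moreover have "norm (complex_of_real (s / (2 * real (Suc k)))) = s / (2 * real (Suc k))"
      using s(1) by (simp only: norm_of_real) simp
    moreover have "dist \<tau>0 (x k) = norm (complex_of_real (s / (2 * real (Suc k))))"
      unfolding x_def dist_norm by (metis add_diff_cancel_left' norm_minus_commute)
    ultimately show ?thesis by simp
  qed
  have isC: "isCont v \<tau>0" using holomorphic_on_imp_continuous_on[OF v] z by (simp add: continuous_on_eq_continuous_at)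
  have "(\<lambda>k. \<xi> * v (x k)) \<longlonglongrightarrow> \<xi> * v \<tau>0"
    by (intro tendsto_intros isCont_tendsto_compose[OF isC] xlim)
  then have \<xi>v: "(\<lambda>k. \<xi> * v (x k)) \<longlonglongrightarrow> 0" by (simp add: v0)
  have ev: "\<forall>\<^sub>F k in sequentially. \<xi> * v (x k) \<in> v ` ball \<tau>0 t" if "0 < t" "t \<le> s" for t
  proof (rule topological_tendstoD[OF \<xi>v op[OF that(2)]])
    show "0 \<in> v ` ball \<tau>0 t" using v0 that(1) by force
  qed
  obtain k0 where k0: "\<And>k. k \<ge> k0 \<Longrightarrow> \<xi> * v (x k) \<in> v ` ball \<tau>0 s"
    using ev[OF s(1)] by (auto simp: eventually_sequentially)
  define x' where "x' k = x (k + k0)" for k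
  have x'lim: "x' \<longlonglongrightarrow> \<tau>0" unfolding x'_def using xlim by (rule LIMSEQ_ignore_initial_segment)
  have "\<exists>y. y \<in> ball \<tau>0 s \<and> v y = \<xi> * v (x' k)" for k
    using k0[of "k + k0"] unfolding x'_def by fastforce
  then obtain y where y: "\<And>k. y k \<in> ball \<tau>0 s" "\<And>k. v (y k) = \<xi> * v (x' k)" by metis
  have ylim: "y \<longlonglongrightarrow> \<tau>0"
    unfolding tendsto_iff
  proof (intro allI impI)
    fix \<epsilon> :: real assume "\<epsilon> > 0"
    define t where "t = min \<epsilon> s"
    have t: "0 < t" "t \<le> s" using \<open>\<epsilon> > 0\<close> s(1) by (auto simp: t_def)
    have "\<forall>\<^sub>F k in sequentially. \<xi> * v (x (k + k0)) \<in> v ` ball \<tau>0 t"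
      by (rule eventually_sequentially_seg[of "\<lambda>k. \<xi> * v (x k) \<in> v ` ball \<tau>0 t" k0, THEN iffD2, OF ev[OF t]])
    then show "\<forall>\<^sub>F k in sequentially. dist (y k) \<tau>0 < \<epsilon>"
    proof eventually_elim
      case (elim k)
      then obtain u where u: "u \<in> ball \<tau>0 t" "v u = v (y k)" using y(2)[of k] by (auto simp: x'_def)
      moreover have "u \<in> ball \<tau>0 s" using u(1) t by auto
      ultimately have "u = y k" using inj_onD[OF s(3) u(2)] y(1) by blast
      then show ?case using u(1) by (auto simp: t_def dist_commute)
    qed
  qed
  have xr: "x' k \<in> ball \<tau>0 r" and yr: "y k \<in> ball \<tau>0 r" for k
    using xs[of "k + k0"] y(1)[of k] s(2) unfolding x'_def by blast+
  have \<xi>0: "\<xi> \<noteq> 0" using \<xi> m by (auto simp: zero_power)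
  have vx0: "v (x' k) \<noteq> 0" for k using x0[of "k + k0"] e0 by (simp add: v_def x'_def)
  then have y0: "y k \<noteq> \<tau>0" for k using y(2)[of k] v0 \<xi>0 by auto
  have "j (x' k) = j (y k)" for k
    using vm[OF xr[of k]] vm[OF yr[of k]] y(2)[of k] \<xi> by (simp add: power_mult_distrib)
  then have "Gamma0_related N (x' k) (y k)" for k
    using xr yr r(2) by (intro j_injective) blast+
  then obtain G where G: "\<And>k. G k \<in> Gamma0 N" "\<And>k. y k = moebius (G k) (x' k)"
    unfolding Gamma0_related_def by metis
  obtain H and \<rho> :: "nat \<Rightarrow> nat" where H: "H \<in> SL2Z" "strict_mono \<rho>" "\<And>k. G (\<rho> k) = H" "moebius H \<tau>0 = \<tau>0"
    by (rule limit_of_equivalent_points[OF x'lim t0 ylim t0 Gamma0_SL2Z[OF G(1)] G(2)]) blast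
  have HG: "H \<in> Gamma0 N" using G(1)[of "\<rho> 0"] H(3) by simp
  have dH: "det H \<noteq> 0" using H(1) by (simp add: SL2Z_det)
  have xsub: "(\<lambda>k. x' (\<rho> k)) \<longlonglongrightarrow> \<tau>0" and ysub: "(\<lambda>k. y (\<rho> k)) \<longlonglongrightarrow> \<tau>0"
    using LIMSEQ_subseq_LIMSEQ[OF x'lim H(2)] LIMSEQ_subseq_LIMSEQ[OF ylim H(2)] by (simp_all add: o_def)
  \<comment> \<open>The quotients of \<open>y k - \<tau>0\<close> by \<open>x k - \<tau>0\<close> converge to the derivative of \<open>H\<close>, and to \<open>\<xi>\<close> because \<open>v\<close> is a coordinate.\<close>
  have contd: "isCont (den H) \<tau>0" unfolding den_def[abs_def] by (intro continuous_intros)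
  have "(\<lambda>k. 1 / (den H (x' (\<rho> k)) * den H \<tau>0)) \<longlonglongrightarrow> 1 / (den H \<tau>0 * den H \<tau>0)"
    using den_nonzero[OF t0 dH] by (intro tendsto_intros isCont_tendsto_compose[OF contd] xsub) auto
  moreover have "1 / (den H (x' (\<rho> k)) * den H \<tau>0) = \<xi> * (e (x' (\<rho> k)) / e (y (\<rho> k)))" for k
  proof -
    have xu: "x' (\<rho> k) \<in> uhp" using xr r(2) by blast
    have "y (\<rho> k) - \<tau>0 = moebius H (x' (\<rho> k)) - moebius H \<tau>0" using G(2)[of "\<rho> k"] H(3,4) by simp
    also have "\<dots> = (x' (\<rho> k) - \<tau>0) / (den H (x' (\<rho> k)) * den H \<tau>0)"
      using moebius_diff[OF xu t0 dH] H(1) by (simp add: SL2Z_det)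
    finally have 1: "y (\<rho> k) - \<tau>0 = (x' (\<rho> k) - \<tau>0) * (1 / (den H (x' (\<rho> k)) * den H \<tau>0))" by simp
    have "(y (\<rho> k) - \<tau>0) * e (y (\<rho> k)) = \<xi> * ((x' (\<rho> k) - \<tau>0) * e (x' (\<rho> k)))"
      using y(2)[of "\<rho> k"] by (simp add: v_def)
    then have "(x' (\<rho> k) - \<tau>0) * (1 / (den H (x' (\<rho> k)) * den H \<tau>0) * e (y (\<rho> k))) = (x' (\<rho> k) - \<tau>0) * (\<xi> * e (x' (\<rho> k)))"
      unfolding 1 by (simp only: ac_simps)
    then have "1 / (den H (x' (\<rho> k)) * den H \<tau>0) * e (y (\<rho> k)) = \<xi> * e (x' (\<rho> k))"
      using x0[of "\<rho> k + k0"] by (simp only: mult_cancel_left) (simp add: x'_def)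
    then show ?thesis using e0[of "y (\<rho> k)"] by (simp only: times_divide_eq_right eq_divide_eq) simp
  qed
  ultimately have l1: "(\<lambda>k. \<xi> * (e (x' (\<rho> k)) / e (y (\<rho> k)))) \<longlonglongrightarrow> 1 / (den H \<tau>0 * den H \<tau>0)" by simp
  have conte: "isCont e \<tau>0" using holomorphic_on_imp_continuous_on[OF e] z by (simp add: continuous_on_eq_continuous_at)
  have "(\<lambda>k. \<xi> * (e (x' (\<rho> k)) / e (y (\<rho> k)))) \<longlonglongrightarrow> \<xi> * (e \<tau>0 / e \<tau>0)"
    using e0 by (intro tendsto_intros isCont_tendsto_compose[OF conte] xsub ysub) auto
  with l1 have "1 / (den H \<tau>0 * den H \<tau>0) = \<xi> * (e \<tau>0 / e \<tau>0)" by (rule LIMSEQ_unique)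
  then have "1 / (den H \<tau>0)\<^sup>2 = \<xi>" using e0 by (simp add: power2_eq_square)
  then show ?thesis using HG H(4) by blast
qed

lemma j_local_factor:
  assumes t0: "\<tau>0 \<in> uhp"
  obtains g r m where "m > 0" "r > 0" "ball \<tau>0 r \<subseteq> uhp" "g holomorphic_on ball \<tau>0 r"
    "\<And>w. w \<in> ball \<tau>0 r \<Longrightarrow> j w - j \<tau>0 = (w - \<tau>0) ^ m * g w" "\<And>w. w \<in> ball \<tau>0 r \<Longrightarrow> g w \<noteq> 0"
proof -
  define f where "f w = j w - j \<tau>0" for w
  have f: "f holomorphic_on uhp" unfolding f_def[abs_def] by (intro holomorphic_intros j_hol)
  have f0: "f \<tau>0 = 0" by (simp add: f_def)
  have fnc: "\<not> f constant_on uhp"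
  proof
    assume "f constant_on uhp"
    then obtain c where "\<And>w. w \<in> uhp \<Longrightarrow> f w = c" unfolding constant_on_def by blast
    then have "\<And>w. w \<in> uhp \<Longrightarrow> j w = c + j \<tau>0" unfolding f_def by (metis diff_add_cancel)
    then show False using j_nonconstant unfolding constant_on_def by blast
  qed
  show ?thesis
    using holomorphic_factor_zero_nonconstant[OF f open_uhp connected_uhp t0 f0 fnc] that unfolding f_def by metis
qed

end

context nonsquare_hecke
begin

text \<open>Equal derivatives at the common fixed point force the bottom rows to differ by the factor
  \<open>\<plusminus>\<surd>n\<close> only. Both rows are integral and nonzero, so \<open>n\<close> would be a square.\<close>

lemma hecke_rotation_not_in_stabilizer:
  assumes X: "X \<in> M" "moebius X \<tau>0 = \<tau>0" and G: "G \<in> Gamma0 N" and t0: "\<tau>0 \<in> uhp"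
  shows "1 / (den G \<tau>0)\<^sup>2 \<noteq> of_nat n / (den X \<tau>0)\<^sup>2"
proof
  assume eq: "1 / (den G \<tau>0)\<^sup>2 = of_nat n / (den X \<tau>0)\<^sup>2"
  have dX: "den X \<tau>0 \<noteq> 0" using den_nonzero[OF t0] M_det_pos[OF X(1)] by simp
  have dG: "den G \<tau>0 \<noteq> 0" using den_nonzero[OF t0] G by (simp add: Gamma0_det)
  have "(den X \<tau>0)\<^sup>2 = of_nat n * (den G \<tau>0)\<^sup>2" using eq dX dG by (simp add: field_simps)
  also have "\<dots> = (of_real (sqrt (real n)) * den G \<tau>0)\<^sup>2"
    by (simp add: power_mult_distrib flip: of_real_power)
  finally have "den X \<tau>0 = of_real (sqrt (real n)) * den G \<tau>0 \<or> den X \<tau>0 = - (of_real (sqrt (real n)) * den G \<tau>0)"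
    by (simp add: power2_eq_iff)
  then obtain s :: real where s: "den X \<tau>0 = of_real s * den G \<tau>0" "s\<^sup>2 = real n"
  proof (elim disjE)
    assume "den X \<tau>0 = of_real (sqrt (real n)) * den G \<tau>0"
    then show ?thesis using that[of "sqrt (real n)"] by simp
  next
    assume "den X \<tau>0 = - (of_real (sqrt (real n)) * den G \<tau>0)"
    then show ?thesis using that[of "- sqrt (real n)"] by simp
  qed
  have "Im (den X \<tau>0) = s * Im (den G \<tau>0)" "Re (den X \<tau>0) = s * Re (den G \<tau>0)" using s(1) by simp_all
  then have c: "of_int (X$2$1) = s * of_int (G$2$1)" and d: "of_int (X$2$2) = s * of_int (G$2$2)"
    using t0 by (auto simp: den_def uhp_def algebra_simps)
  have sq: "int n * v\<^sup>2 = u\<^sup>2" if "of_int u = s * of_int v" for u v :: int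
  proof -
    have "(of_int u :: real)\<^sup>2 = real n * (of_int v)\<^sup>2" using that s(2) by (simp add: power_mult_distrib)
    then have "(of_int (u\<^sup>2) :: real) = of_int (int n * v\<^sup>2)" by simp
    then show ?thesis by (simp only: of_int_eq_iff)
  qed
  have "G$2$1 \<noteq> 0 \<or> G$2$2 \<noteq> 0" using Gamma0_det[OF G] by (auto simp: det_2)
  then show False
    using square_if_square_times_square[OF sq[OF c]] square_if_square_times_square[OF sq[OF d]] nonsquare by blast
qed

definition point_fixing_cosets :: "complex \<Rightarrow> (int^2^2) set set" where
  "point_fixing_cosets \<tau>0 = {K \<in> cosets. \<exists>X\<in>K. moebius X \<tau>0 = \<tau>0}"

text \<open>Each coset fixing the point contributes the vanishing order \<open>m\<close> of \<open>j - j \<tau>\<^sub>0\<close>, the others contribute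
  nothing. The factor \<open>m\<close> also occurs when the power of \<open>X - j \<tau>\<^sub>0\<close> in the diagonal is evaluated at \<open>j\<close>.\<close>

lemma order_at_point:
  assumes t0: "\<tau>0 \<in> uhp"
  shows "Polynomial.order (j \<tau>0) diag = card (point_fixing_cosets \<tau>0)"
proof -
  obtain g r m where m: "m > 0" and r: "r > 0" "ball \<tau>0 r \<subseteq> uhp" and g: "g holomorphic_on ball \<tau>0 r"
    and jg: "\<And>w. w \<in> ball \<tau>0 r \<Longrightarrow> j w - j \<tau>0 = (w - \<tau>0) ^ m * g w"
    and g0: "\<And>w. w \<in> ball \<tau>0 r \<Longrightarrow> g w \<noteq> 0"
    using j_local_factor[OF t0] by metis
  have z: "\<tau>0 \<in> ball \<tau>0 r" using r by simp
  have contg: "isCont g \<tau>0" using holomorphic_on_imp_continuous_on[OF g] z by (simp add: continuous_on_eq_continuous_at)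
  have near: "\<forall>\<^sub>F w in at \<tau>0. w \<in> ball \<tau>0 r"
    using z by (intro eventually_at_in_open') auto
  have fixing: "\<exists>C. C \<noteq> 0 \<and> ((\<lambda>w. (j w - jK K w) / (w - \<tau>0) ^ m) \<longlongrightarrow> C) (at \<tau>0)"
    if K: "K \<in> point_fixing_cosets \<tau>0" for K
  proof -
    obtain X where X: "K \<in> cosets" "X \<in> K" "moebius X \<tau>0 = \<tau>0" using K unfolding point_fixing_cosets_def by blast
    have XM: "X \<in> M" by (rule coset_eq(1)[OF X(1,2)])
    have dX: "det X = int n" "det X \<noteq> 0" using M_det[OF XM] n_pos by auto
    have contX: "isCont (moebius X) \<tau>0" by (rule continuous_moebius[OF dX(2) t0])
    have contd: "isCont (den X) \<tau>0" unfolding den_def[abs_def] by (intro continuous_intros)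
    define \<zeta> where "\<zeta> = of_nat n / (den X \<tau>0)\<^sup>2"
    define C where "C = g \<tau>0 - (of_nat n / (den X \<tau>0 * den X \<tau>0)) ^ m * g (moebius X \<tau>0)"
    have "\<zeta> ^ m \<noteq> 1"
    proof
      assume "\<zeta> ^ m = 1"
      then obtain G where "G \<in> Gamma0 N" "1 / (den G \<tau>0)\<^sup>2 = \<zeta>"
        using stabilizer_realizes_roots_of_unity[OF t0 m r g g0 jg] by blast
      then show False using hecke_rotation_not_in_stabilizer[OF XM X(3) _ t0] unfolding \<zeta>_def by blast
    qed
    moreover have "C = (1 - \<zeta> ^ m) * g \<tau>0" by (simp add: C_def X(3) \<zeta>_def power2_eq_square algebra_simps)
    ultimately have "C \<noteq> 0" using g0[OF z] by simp
    have "((\<lambda>w. g w - (of_nat n / (den X w * den X \<tau>0)) ^ m * g (moebius X w)) \<longlongrightarrow> C) (at \<tau>0)"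
      unfolding C_def using den_nonzero[OF t0 dX(2)] contg contd contX X(3)
      by (intro tendsto_intros isCont_tendsto_compose[of "moebius X \<tau>0" g]) (auto simp: isCont_def)
    moreover have "\<forall>\<^sub>F w in at \<tau>0. moebius X w \<in> ball \<tau>0 r"
      using contX z X(3) unfolding isCont_def by (intro topological_tendstoD[OF _ open_ball]) auto
    then have "\<forall>\<^sub>F w in at \<tau>0. g w - (of_nat n / (den X w * den X \<tau>0)) ^ m * g (moebius X w) = (j w - jK K w) / (w - \<tau>0) ^ m"
      using near eventually_neq_at_within[of \<tau>0 \<tau>0]
    proof eventually_elim
      case (elim w)
      have wu: "w \<in> uhp" using elim(2) r(2) by blast
      have "moebius X w - \<tau>0 = moebius X w - moebius X \<tau>0" by (simp add: X(3))
      also have "\<dots> = (w - \<tau>0) * (of_nat n / (den X w * den X \<tau>0))"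
        using moebius_diff[OF wu t0 dX(2)] by (simp add: dX(1))
      finally have mw: "moebius X w - \<tau>0 = (w - \<tau>0) * (of_nat n / (den X w * den X \<tau>0))" .
      have "jK K w - j \<tau>0 = (moebius X w - \<tau>0) ^ m * g (moebius X w)"
        unfolding jK_eq[OF X(1,2) wu] by (rule jg[OF elim(1)])
      also have "\<dots> = (w - \<tau>0) ^ m * ((of_nat n / (den X w * den X \<tau>0)) ^ m * g (moebius X w))"
        unfolding mw power_mult_distrib by (simp only: mult.assoc)
      finally have "j w - jK K w = (w - \<tau>0) ^ m * (g w - (of_nat n / (den X w * den X \<tau>0)) ^ m * g (moebius X w))"
        using jg[OF elim(2)] by (simp only: right_diff_distrib) (simp add: algebra_simps)
      then show ?case using elim(3) by simp
    qed
    ultimately have "((\<lambda>w. (j w - jK K w) / (w - \<tau>0) ^ m) \<longlongrightarrow> C) (at \<tau>0)" by (rule Lim_transform_eventually)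
    then show ?thesis using \<open>C \<noteq> 0\<close> by blast
  qed
  have isCj: "isCont j \<tau>0" using holomorphic_on_imp_continuous_on[OF j_hol] open_uhp t0
    by (simp add: continuous_on_eq_continuous_at)
  have nonfixing: "\<exists>C. C \<noteq> 0 \<and> ((\<lambda>w. j w - jK K w) \<longlongrightarrow> C) (at \<tau>0)" if K: "K \<in> cosets - point_fixing_cosets \<tau>0" for K
  proof (intro exI conjI)
    have Kc: "K \<in> cosets" using K by simp
    have "isCont (jK K) \<tau>0" using holomorphic_on_imp_continuous_on[OF holomorphic_jK[OF Kc]] open_uhp t0
      by (simp add: continuous_on_eq_continuous_at)
    then show "((\<lambda>w. j w - jK K w) \<longlongrightarrow> j \<tau>0 - jK K \<tau>0) (at \<tau>0)"
      using isCj unfolding isCont_def by (intro tendsto_diff)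
    show "j \<tau>0 - jK K \<tau>0 \<noteq> 0"
    proof
      assume eq: "j \<tau>0 - jK K \<tau>0 = 0"
      obtain X where X: "X \<in> M" "X \<in> K" using cosetE[OF Kc] by metis
      have Xu: "moebius X \<tau>0 \<in> uhp" by (rule moebius_in_uhp[OF t0 M_det_pos[OF X(1)]])
      have "j (moebius X \<tau>0) = j \<tau>0" using eq jK_eq[OF Kc X(2) t0] by simp
      then obtain G where G: "G \<in> Gamma0 N" "\<tau>0 = moebius G (moebius X \<tau>0)"
        using j_injective[OF Xu t0] unfolding Gamma0_related_def by blast
      have "moebius (G ** X) \<tau>0 = \<tau>0" using G(2) M_det_pos[OF X(1)] by (simp add: moebius_mult[OF t0])
      then have "K \<in> point_fixing_cosets \<tau>0"
        unfolding point_fixing_cosets_def using Kc coset_left_closed[OF Kc X(2) G(1)] by blast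
      then show False using K by blast
    qed
  qed
  define FK where "FK = point_fixing_cosets \<tau>0"
  have sub: "FK \<subseteq> cosets" unfolding FK_def point_fixing_cosets_def by blast
  have finFK: "finite FK" using sub finite_cosets by (rule finite_subset)
  obtain C1 where C1: "\<And>K. K \<in> FK \<Longrightarrow> C1 K \<noteq> 0 \<and> ((\<lambda>w. (j w - jK K w) / (w - \<tau>0) ^ m) \<longlongrightarrow> C1 K) (at \<tau>0)"
    using fixing unfolding FK_def by metis
  obtain C2 where C2: "\<And>K. K \<in> cosets - FK \<Longrightarrow> C2 K \<noteq> 0 \<and> ((\<lambda>w. j w - jK K w) \<longlongrightarrow> C2 K) (at \<tau>0)"
    using nonfixing unfolding FK_def by metis
  define k where "k = Polynomial.order (j \<tau>0) diag"
  obtain Q where Q: "diag = [:- j \<tau>0, 1:] ^ k * Q" "\<not> [:- j \<tau>0, 1:] dvd Q"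
    using order_decomp[OF diag_nonzero_and_lead_coeff(1), of "j \<tau>0"] unfolding k_def by blast
  have QL: "poly Q (j \<tau>0) \<noteq> 0" using Q(2) by (simp add: poly_eq_0_iff_dvd)
  have "((\<lambda>w. (\<Prod>K\<in>FK. (j w - jK K w) / (w - \<tau>0) ^ m) * (\<Prod>K\<in>cosets - FK. j w - jK K w)) \<longlongrightarrow>
      (\<Prod>K\<in>FK. C1 K) * (\<Prod>K\<in>cosets - FK. C2 K)) (at \<tau>0)"
    using C1 C2 by (intro tendsto_mult tendsto_prod) auto
  then have lim1: "((\<lambda>w. poly diag (j w) / (w - \<tau>0) ^ (m * card FK)) \<longlongrightarrow> (\<Prod>K\<in>FK. C1 K) * (\<Prod>K\<in>cosets - FK. C2 K)) (at \<tau>0)"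
  proof (rule Lim_transform_eventually)
    show "\<forall>\<^sub>F w in at \<tau>0. (\<Prod>K\<in>FK. (j w - jK K w) / (w - \<tau>0) ^ m) * (\<Prod>K\<in>cosets - FK. j w - jK K w) =
        poly diag (j w) / (w - \<tau>0) ^ (m * card FK)"
      using near
    proof eventually_elim
      case (elim w)
      then have "w \<in> uhp" using r(2) by blast
      then have "poly diag (j w) = (\<Prod>K\<in>cosets - FK. j w - jK K w) * (\<Prod>K\<in>FK. j w - jK K w)"
        using prod.subset_diff[OF sub finite_cosets, of "\<lambda>K. j w - jK K w"] by (simp add: poly_diag_j)
      then show ?case by (simp add: prod_dividef power_mult)
    qed
  qed
  have isCQ: "((\<lambda>w. poly Q (j w)) \<longlongrightarrow> poly Q (j \<tau>0)) (at \<tau>0)"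
    using isCj by (intro tendsto_poly) (simp add: isCont_def)
  have "((\<lambda>w. g w ^ k * poly Q (j w)) \<longlongrightarrow> g \<tau>0 ^ k * poly Q (j \<tau>0)) (at \<tau>0)"
    using contg by (intro tendsto_intros isCQ) (simp add: isCont_def)
  then have lim2: "((\<lambda>w. poly diag (j w) / (w - \<tau>0) ^ (m * k)) \<longlongrightarrow> g \<tau>0 ^ k * poly Q (j \<tau>0)) (at \<tau>0)"
  proof (rule Lim_transform_eventually)
    show "\<forall>\<^sub>F w in at \<tau>0. g w ^ k * poly Q (j w) = poly diag (j w) / (w - \<tau>0) ^ (m * k)"
      using near eventually_neq_at_within[of \<tau>0 \<tau>0]
    proof eventually_elim
      case (elim w)
      have "poly diag (j w) = (j w - j \<tau>0) ^ k * poly Q (j w)" unfolding Q(1) by (simp add: poly_power)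
      also have "\<dots> = (w - \<tau>0) ^ (m * k) * (g w ^ k * poly Q (j w))"
        unfolding jg[OF elim(1)] by (simp add: power_mult_distrib power_mult)
      finally show ?case using elim(2) by simp
    qed
  qed
  have "m * k = m * card FK"
  proof (rule same_vanishing_order[OF lim2 lim1])
    show "g \<tau>0 ^ k * poly Q (j \<tau>0) \<noteq> 0" using g0[OF z] QL by simp
    show "(\<Prod>K\<in>FK. C1 K) * (\<Prod>K\<in>cosets - FK. C2 K) \<noteq> 0"
      using C1 C2 finFK finite_cosets by (auto simp: prod_zero_iff)
  qed
  then show ?thesis using m by (simp add: k_def FK_def)
qed

end

section \<open>Binary quadratic forms\<close>

lemma bqf_pos_def_iff: "bqf_pos_def (a, b, c) \<longleftrightarrow> a > 0 \<and> b\<^sup>2 - 4 * a * c < 0"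
proof
  assume pd: "bqf_pos_def (a, b, c)"
  have "bqf_eval (a, b, c) 1 0 > 0" by (rule pd[unfolded bqf_pos_def_def, rule_format]) simp
  then have a: "a > 0" by simp
  have "bqf_eval (a, b, c) (- b) (2 * a) > 0"
    by (rule pd[unfolded bqf_pos_def_def, rule_format]) (use a in simp)
  moreover have "bqf_eval (a, b, c) (- b) (2 * a) = a * (4 * a * c - b\<^sup>2)"
    by (simp add: power2_eq_square algebra_simps)
  ultimately have "4 * a * c - b\<^sup>2 > 0" using a by (simp add: zero_less_mult_iff)
  then show "a > 0 \<and> b\<^sup>2 - 4 * a * c < 0" using a by simp
next
  assume ab: "a > 0 \<and> b\<^sup>2 - 4 * a * c < 0"
  show "bqf_pos_def (a, b, c)"
    unfolding bqf_pos_def_def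
  proof (intro allI impI)
    fix x y :: int assume xy: "(x, y) \<noteq> (0, 0)"
    have eq: "4 * a * bqf_eval (a, b, c) x y = (2 * a * x + b * y)\<^sup>2 + (4 * a * c - b\<^sup>2) * y\<^sup>2"
      by (simp add: power2_eq_square algebra_simps)
    have "(2 * a * x + b * y)\<^sup>2 + (4 * a * c - b\<^sup>2) * y\<^sup>2 > 0"
    proof (cases "y = 0")
      case True
      then show ?thesis using xy ab by simp
    next
      case False
      then have "(4 * a * c - b\<^sup>2) * y\<^sup>2 > 0" using ab by (intro mult_pos_pos) auto
      then show ?thesis using zero_le_power2[of "2 * a * x + b * y"] by linarith
    qed
    then have "4 * a * bqf_eval (a, b, c) x y > 0" unfolding eq .
    then show "bqf_eval (a, b, c) x y > 0" using ab by (simp add: zero_less_mult_iff)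
  qed
qed

abbreviation is_root :: "int \<Rightarrow> int \<Rightarrow> int \<Rightarrow> complex \<Rightarrow> bool" where
  "is_root a b c \<tau> \<equiv> of_int a * \<tau>\<^sup>2 + of_int b * \<tau> + of_int c = 0"

text \<open>Real and imaginary part of the quadratic equation. They show that a form is determined by
  its root and its leading coefficient, and the latter by the discriminant.\<close>

lemma root_coordinates:
  assumes "\<tau> \<in> uhp" "is_root a b c \<tau>"
  shows "real_of_int b = - 2 * of_int a * Re \<tau>" "real_of_int c = of_int a * ((Re \<tau>)\<^sup>2 + (Im \<tau>)\<^sup>2)"
    "real_of_int (b\<^sup>2 - 4 * a * c) = - 4 * (of_int a)\<^sup>2 * (Im \<tau>)\<^sup>2"
proof -
  have im: "Im (of_int a * \<tau>\<^sup>2 + of_int b * \<tau> + of_int c) = 0"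
    and re: "Re (of_int a * \<tau>\<^sup>2 + of_int b * \<tau> + of_int c) = 0" by (simp_all only: assms(2) zero_complex.sel)
  have y: "Im \<tau> > 0" using assms(1) by (simp add: uhp_def)
  have "(2 * of_int a * Re \<tau> + of_int b) * Im \<tau> = 0"
    using im by (simp add: power2_eq_square algebra_simps)
  then show b: "real_of_int b = - 2 * of_int a * Re \<tau>" using y by simp
  have "of_int a * ((Re \<tau>)\<^sup>2 - (Im \<tau>)\<^sup>2) + of_int b * Re \<tau> + of_int c = 0"
    using re by (simp add: power2_eq_square algebra_simps)
  then show c: "real_of_int c = of_int a * ((Re \<tau>)\<^sup>2 + (Im \<tau>)\<^sup>2)"
    unfolding b by (simp add: power2_eq_square algebra_simps)
  show "real_of_int (b\<^sup>2 - 4 * a * c) = - 4 * (of_int a)\<^sup>2 * (Im \<tau>)\<^sup>2"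
    by (simp add: b c power2_eq_square algebra_simps)
qed

lemma root_exists:
  assumes "a > 0" "b\<^sup>2 - 4 * a * c < 0"
  obtains \<tau> where "\<tau> \<in> uhp" "is_root a b c \<tau>"
proof -
  define s where "s = sqrt (real_of_int (4 * a * c - b\<^sup>2))"
  have "4 * a * c - b\<^sup>2 > 0" using assms(2) by simp
  then have "real_of_int (4 * a * c - b\<^sup>2) > 0" by (simp only: of_int_0_less_iff)
  then have s: "s > 0" "s\<^sup>2 = real_of_int (4 * a * c - b\<^sup>2)"
    unfolding s_def by (simp_all only: real_sqrt_gt_zero real_sqrt_pow2 less_imp_le)
  define \<tau> where "\<tau> = Complex (- of_int b / (2 * of_int a)) (s / (2 * of_int a))"
  have u: "\<tau> \<in> uhp" using s assms(1) by (simp add: \<tau>_def uhp_def)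
  have "2 * of_int a * \<tau> + of_int b = Complex 0 s"
    using assms(1) by (simp add: \<tau>_def complex_eq_iff)
  then have "(2 * of_int a * \<tau> + of_int b)\<^sup>2 = (Complex 0 s)\<^sup>2" by simp
  also have "\<dots> = - of_real (s\<^sup>2)" by (simp add: complex_eq_iff power2_eq_square)
  also have "\<dots> = of_int (b\<^sup>2 - 4 * a * c)" unfolding s(2) by simp
  finally have "4 * of_int a * (of_int a * \<tau>\<^sup>2 + of_int b * \<tau> + of_int c) = 0"
    by (simp add: power2_eq_square algebra_simps)
  then have "is_root a b c \<tau>" using assms(1) by simp
  with u show ?thesis by (rule that)
qed

lemma root_unique:
  assumes "a > 0" "\<tau> \<in> uhp" "is_root a b c \<tau>" "\<tau>' \<in> uhp" "is_root a b c \<tau>'"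
  shows "\<tau> = \<tau>'"
proof (rule complex_eqI)
  have a: "real_of_int a > 0" using assms(1) by simp
  have "- 2 * of_int a * Re \<tau> = - 2 * of_int a * Re \<tau>'"
    using root_coordinates(1)[OF assms(2,3)] root_coordinates(1)[OF assms(4,5)] by metis
  then show "Re \<tau> = Re \<tau>'" using a by simp
  have "- 4 * (real_of_int a)\<^sup>2 * (Im \<tau>)\<^sup>2 = - 4 * (real_of_int a)\<^sup>2 * (Im \<tau>')\<^sup>2"
    using root_coordinates(3)[OF assms(2,3)] root_coordinates(3)[OF assms(4,5)] by simp
  then have "(Im \<tau>)\<^sup>2 = (Im \<tau>')\<^sup>2" using a by simp
  then show "Im \<tau> = Im \<tau>'" using assms(2,4) by (simp add: uhp_def power2_eq_iff)
qed

lemma bqf_root_spec: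
  assumes "bqf_pos_def (a, b, c)"
  shows "bqf_root (a, b, c) \<in> uhp \<and> is_root a b c (bqf_root (a, b, c))"
proof -
  have ab: "a > 0" "b\<^sup>2 - 4 * a * c < 0" using assms unfolding bqf_pos_def_iff by auto
  obtain \<tau> where t: "\<tau> \<in> uhp" "is_root a b c \<tau>" using root_exists[OF ab] .
  have "\<exists>!\<tau>. \<tau> \<in> uhp \<and> is_root a b c \<tau>"
    using t root_unique[OF ab(1)] by (intro ex1I[of _ \<tau>]) blast+
  from theI'[OF this] show ?thesis by simp
qed

lemma bqf_root_eq_iff:
  assumes "bqf_pos_def (a, b, c)" "\<tau> \<in> uhp"
  shows "bqf_root (a, b, c) = \<tau> \<longleftrightarrow> is_root a b c \<tau>"
proof -
  have "a > 0" using assms unfolding bqf_pos_def_iff by simp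
  then show ?thesis using bqf_root_spec[OF assms(1)] root_unique assms(2) by metis
qed

lemma bqf_root_in_uhp: "bqf_pos_def Q \<Longrightarrow> bqf_root Q \<in> uhp"
  using bqf_root_spec by (cases Q) blast

lemma bqf_determined_by_root:
  assumes "bqf_pos_def Q" "bqf_pos_def Q'" "bqf_disc Q = bqf_disc Q'" "bqf_root Q = bqf_root Q'"
  shows "Q = Q'"
proof -
  obtain a b c where Q: "Q = (a, b, c)" by (cases Q)
  obtain a' b' c' where Q': "Q' = (a', b', c')" by (cases Q')
  define \<tau> where "\<tau> = bqf_root Q"
  have t: "\<tau> \<in> uhp" "is_root a b c \<tau>" using bqf_root_spec assms(1) unfolding \<tau>_def Q by blast+
  have t': "is_root a' b' c' \<tau>" using bqf_root_spec assms(2) unfolding \<tau>_def assms(4) Q' by blast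
  have pos: "a > 0" "a' > 0" using assms(1,2) unfolding Q Q' bqf_pos_def_iff by auto
  have y: "Im \<tau> > 0" using t by (simp add: uhp_def)
  have "b\<^sup>2 - 4 * a * c = b'\<^sup>2 - 4 * a' * c'" using assms(3) unfolding Q Q' bqf_disc.simps .
  then have "- 4 * (real_of_int a)\<^sup>2 * (Im \<tau>)\<^sup>2 = - 4 * (real_of_int a')\<^sup>2 * (Im \<tau>)\<^sup>2"
    using root_coordinates(3)[OF t] root_coordinates(3)[OF t(1) t'] by metis
  then have "(real_of_int a)\<^sup>2 = (real_of_int a')\<^sup>2" using y by simp
  then have a: "a = a'" using pos by (simp add: power2_eq_iff)
  have "real_of_int b = of_int b'" "real_of_int c = of_int c'"
    using root_coordinates(1,2)[OF t] root_coordinates(1,2)[OF t(1) t'] a by simp_all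
  then show ?thesis using a by (simp add: Q Q')
qed

lemma bqf_act_mult: "bqf_act (bqf_act Q A) B = bqf_act Q (A ** B)"
  by (cases Q) (simp add: bqf_act_def matmul_nth power2_eq_square algebra_simps)

lemma bqf_act_one: "bqf_act Q (mat 1) = Q"
  by (cases Q) (simp add: bqf_act_def)

lemma bqf_disc_act: "bqf_disc (bqf_act Q A) = bqf_disc Q * (det A)\<^sup>2"
  by (cases Q) (simp add: bqf_act_def det_2 power2_eq_square algebra_simps)

lemma bqf_pos_def_act:
  assumes "bqf_pos_def Q" "A \<in> SL2Z"
  shows "bqf_pos_def (bqf_act Q A)"
  unfolding bqf_pos_def_def bqf_eval_act
proof (intro allI impI)
  fix x y :: int assume xy: "(x, y) \<noteq> (0, 0)"
  have d: "A$1$1 * A$2$2 - A$1$2 * A$2$1 = 1" using SL2Z_det[OF assms(2)] by (simp add: det_2)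
  have "(A$1$1 * x + A$1$2 * y, A$2$1 * x + A$2$2 * y) \<noteq> (0, 0)"
  proof
    assume "(A$1$1 * x + A$1$2 * y, A$2$1 * x + A$2$2 * y) = (0, 0)"
    then have z: "A$1$1 * x + A$1$2 * y = 0" "A$2$1 * x + A$2$2 * y = 0" by auto
    have "(A$1$1 * A$2$2 - A$1$2 * A$2$1) * x = A$2$2 * (A$1$1 * x + A$1$2 * y) - A$1$2 * (A$2$1 * x + A$2$2 * y)"
      by (simp add: algebra_simps)
    then have "x = 0" unfolding z d by simp
    moreover have "(A$1$1 * A$2$2 - A$1$2 * A$2$1) * y = A$1$1 * (A$2$1 * x + A$2$2 * y) - A$2$1 * (A$1$1 * x + A$1$2 * y)"
      by (simp add: algebra_simps)
    then have "y = 0" unfolding z d by simp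
    ultimately show False using xy by simp
  qed
  then show "bqf_eval Q (A$1$1 * x + A$1$2 * y) (A$2$1 * x + A$2$2 * y) > 0"
    using assms(1) unfolding bqf_pos_def_def by blast
qed

text \<open>The form \<open>Q A\<close> is \<open>Q\<close> evaluated after applying \<open>A\<close> to the variables, so its root is the one of \<open>Q\<close>
  moved by the inverse of \<open>A\<close>.\<close>

lemma bqf_root_act:
  assumes pd: "bqf_pos_def Q" and A: "A \<in> SL2Z"
  shows "bqf_root (bqf_act Q A) = moebius (adj2 A) (bqf_root Q)"
proof -
  obtain a b c where Q: "Q = (a, b, c)" by (cases Q)
  obtain a' b' c' where Q': "bqf_act Q A = (a', b', c')" by (cases "bqf_act Q A")
  define \<sigma> where "\<sigma> = bqf_root Q"
  have s: "\<sigma> \<in> uhp" "is_root a b c \<sigma>" using bqf_root_spec pd unfolding \<sigma>_def Q by blast+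
  define \<tau> where "\<tau> = moebius (adj2 A) \<sigma>"
  have t: "\<tau> \<in> uhp" unfolding \<tau>_def by (intro moebius_in_uhp_SL2Z s SL2Z_adj2 A)
  have At: "moebius A \<tau> = \<sigma>" unfolding \<tau>_def using s A by (simp add: moebius_adj2 SL2Z_det)
  have d: "den A \<tau> \<noteq> 0" using den_nonzero[OF t] A by (simp add: SL2Z_det)
  define u where "u = of_int (A$1$1) * \<tau> + of_int (A$1$2)"
  have u: "u = \<sigma> * den A \<tau>" using At d unfolding moebius_den u_def by (simp add: field_simps)
  have coeffs: "a' = a * (A$1$1)\<^sup>2 + b * A$1$1 * A$2$1 + c * (A$2$1)\<^sup>2"
    "b' = 2 * a * A$1$1 * A$1$2 + b * (A$1$1 * A$2$2 + A$1$2 * A$2$1) + 2 * c * A$2$1 * A$2$2"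
    "c' = a * (A$1$2)\<^sup>2 + b * A$1$2 * A$2$2 + c * (A$2$2)\<^sup>2"
    using Q' unfolding Q bqf_act_def by simp_all
  have "of_int a' * \<tau>\<^sup>2 + of_int b' * \<tau> + of_int c' = of_int a * u\<^sup>2 + of_int b * u * den A \<tau> + of_int c * (den A \<tau>)\<^sup>2"
    unfolding coeffs by (simp add: u_def den_def power2_eq_square algebra_simps)
  also have "\<dots> = (den A \<tau>)\<^sup>2 * (of_int a * \<sigma>\<^sup>2 + of_int b * \<sigma> + of_int c)"
    unfolding u by (simp add: power2_eq_square algebra_simps)
  also have "\<dots> = 0" using s(2) by simp
  finally have "is_root a' b' c' \<tau>" .
  then show ?thesis
    using bqf_root_eq_iff[of a' b' c' \<tau>] bqf_pos_def_act[OF pd A] t unfolding Q' \<tau>_def \<sigma>_def by blast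
qed

lemma bqfs_act:
  assumes "Q \<in> bqfs N D" "A \<in> Gamma0 N"
  shows "bqf_act Q A \<in> bqfs N D"
proof -
  obtain a b c where Q: "Q = (a, b, c)" by (cases Q)
  have "int N dvd a" "int N dvd A$2$1" using assms by (auto simp: bqfs_def Q Gamma0_def)
  then have "int N dvd fst (bqf_act Q A)"
    unfolding Q bqf_act_def by (auto simp: power2_eq_square intro!: dvd_add)
  then show ?thesis
    using assms bqf_pos_def_act[OF _ Gamma0_SL2Z[OF assms(2)]]
    by (simp add: bqfs_def bqf_disc_act Gamma0_det)
qed

definition bqf_rel :: "nat \<Rightarrow> int \<Rightarrow> (bqf \<times> bqf) set" where
  "bqf_rel N D = {(Q, Q'). Q \<in> bqfs N D \<and> Q' \<in> bqfs N D \<and> (\<exists>A\<in>Gamma0 N. Q' = bqf_act Q A)}"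

lemma bqf_classes_eq: "bqf_classes N D = bqfs N D // bqf_rel N D"
  by (simp add: bqf_classes_def bqf_rel_def)

lemma equiv_bqf_rel: "equiv (bqfs N D) (bqf_rel N D)"
proof (intro equivI)
  show "refl_on (bqfs N D) (bqf_rel N D)"
    unfolding refl_on_def bqf_rel_def using Gamma0_one by (auto intro!: bexI[of _ "mat 1"] simp: bqf_act_one)
  show "sym (bqf_rel N D)"
  proof (rule symI)
    fix Q Q' assume "(Q, Q') \<in> bqf_rel N D"
    then obtain A where A: "Q \<in> bqfs N D" "Q' \<in> bqfs N D" "A \<in> Gamma0 N" "Q' = bqf_act Q A"
      unfolding bqf_rel_def by blast
    then have "Q = bqf_act Q' (adj2 A)" by (simp add: bqf_act_mult adj2_mult Gamma0_det bqf_act_one)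
    then show "(Q', Q) \<in> bqf_rel N D" using A Gamma0_adj2[OF A(3)] unfolding bqf_rel_def by blast
  qed
  show "trans (bqf_rel N D)"
  proof (rule transI)
    fix Q Q' Q'' assume "(Q, Q') \<in> bqf_rel N D" "(Q', Q'') \<in> bqf_rel N D"
    then obtain A B where A: "Q \<in> bqfs N D" "Q'' \<in> bqfs N D" "A \<in> Gamma0 N" "B \<in> Gamma0 N" "Q'' = bqf_act (bqf_act Q A) B"
      unfolding bqf_rel_def by blast
    then show "(Q, Q'') \<in> bqf_rel N D"
      unfolding bqf_rel_def using Gamma0_mult[OF A(3,4)] by (auto simp: bqf_act_mult)
  qed
  show "bqf_rel N D \<subseteq> bqfs N D \<times> bqfs N D" by (auto simp: bqf_rel_def)
qed

lemma card_quotient_by_sign: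
  assumes "finite S" "\<And>A. A \<in> S \<Longrightarrow> - A \<in> S" "\<And>A :: int^2^2. A \<in> S \<Longrightarrow> - A \<noteq> A"
  shows "2 * card (S // {(A, B). A \<in> S \<and> B \<in> S \<and> (B = A \<or> B = - A)}) = card S"
proof -
  let ?r = "{(A, B). A \<in> S \<and> B \<in> S \<and> (B = A \<or> B = - A)}"
  have eq: "equiv S ?r"
    by (intro equivI) (auto simp: refl_on_def sym_def trans_def)
  have cls: "?r `` {A} = {A, - A}" if "A \<in> S" for A using that assms(2) by auto
  have "2 * card (S // ?r) = card (\<Union> (S // ?r))"
  proof (rule card_partition)
    show "finite (S // ?r)" using assms(1) by (intro finite_quotient) auto
    show "finite (\<Union> (S // ?r))" using assms(1) by (simp add: Union_quotient[OF eq])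
    show "card X = 2" if X: "X \<in> S // ?r" for X
    proof -
      obtain A where A: "A \<in> S" "X = ?r `` {A}" using X by (rule quotientE)
      have "A \<noteq> - A" using assms(3)[OF A(1)] by metis
      then show ?thesis unfolding A(2) cls[OF A(1)] by simp
    qed
    show "X \<inter> Y = {}" if "X \<in> S // ?r" "Y \<in> S // ?r" "X \<noteq> Y" for X Y
      using quotient_disj[OF eq that(1,2)] that(3) by blast
  qed
  then show ?thesis by (simp add: Union_quotient[OF eq])
qed

section \<open>Counting fixed points of Hecke correspondences by forms\<close>

context nonsquare_hecke
begin

definition stab :: "complex \<Rightarrow> (int^2^2) set" where
  "stab \<tau> = {G \<in> Gamma0 N. moebius G \<tau> = \<tau>}"

definition fixing_matrices :: "complex \<Rightarrow> (int^2^2) set" where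
  "fixing_matrices \<tau> = {X \<in> M. moebius X \<tau> = \<tau>}"

definition traces :: "int set" where
  "traces = {r. real_of_int \<bar>r\<bar> < 2 * sqrt (real n)}"

definition forms_at :: "int \<Rightarrow> complex \<Rightarrow> bqf set" where
  "forms_at r \<tau> = {Q \<in> bqfs N (r\<^sup>2 - 4 * int n). bqf_root Q = \<tau>}"

lemma traces_iff: "r \<in> traces \<longleftrightarrow> r\<^sup>2 < 4 * int n"
proof -
  have "real_of_int \<bar>r\<bar> < 2 * sqrt (real n) \<longleftrightarrow> real_of_int \<bar>r\<bar> < sqrt (4 * real n)"
    by (simp add: real_sqrt_mult)
  also have "\<dots> \<longleftrightarrow> sqrt ((real_of_int \<bar>r\<bar>)\<^sup>2) < sqrt (4 * real n)" by simp
  also have "\<dots> \<longleftrightarrow> (real_of_int \<bar>r\<bar>)\<^sup>2 < 4 * real n" by (rule real_sqrt_less_iff)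
  also have "(real_of_int \<bar>r\<bar>)\<^sup>2 = real_of_int (r\<^sup>2)" by simp
  also have "real_of_int (r\<^sup>2) < 4 * real n \<longleftrightarrow> real_of_int (r\<^sup>2) < real_of_int (4 * int n)" by simp
  also have "\<dots> \<longleftrightarrow> r\<^sup>2 < 4 * int n" by (simp only: of_int_less_iff)
  finally show ?thesis by (simp add: traces_def)
qed

lemma finite_traces: "finite traces"
proof (rule finite_subset)
  show "traces \<subseteq> {- (4 * int n)..4 * int n}"
  proof
    fix r assume "r \<in> traces"
    then have r: "r\<^sup>2 < 4 * int n" by (simp add: traces_iff)
    have "\<bar>r\<bar> \<le> r\<^sup>2"
    proof (cases "r = 0")
      case False
      then have "\<bar>r\<bar> * 1 \<le> \<bar>r\<bar> * \<bar>r\<bar>" by (intro mult_left_mono) auto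
      then show ?thesis by (simp add: power2_eq_square)
    qed simp
    then show "r \<in> {- (4 * int n)..4 * int n}" using r by auto
  qed
qed simp

lemma finite_stab:
  assumes "\<tau> \<in> uhp"
  shows "finite (stab \<tau>)"
proof (rule finite_subset)
  show "stab \<tau> \<subseteq> {A \<in> SL2Z. \<exists>t. Im t \<ge> Im \<tau> \<and> cmod t \<le> cmod \<tau> \<and> Im (moebius A t) \<ge> Im \<tau> \<and> cmod (moebius A t) \<le> cmod \<tau>}"
    unfolding stab_def using Gamma0_SL2Z by (auto intro!: exI[of _ \<tau>])
qed (use assms in \<open>intro finite_returning_matrices, simp add: uhp_def\<close>)

lemma card_stab_pos: "\<tau> \<in> uhp \<Longrightarrow> card (stab \<tau>) > 0"
  using finite_stab[of \<tau>] Gamma0_one by (auto simp: card_gt_0_iff stab_def intro!: exI[of _ "mat 1"])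

lemma card_stab_moebius:
  assumes t: "\<tau> \<in> uhp" and G: "G \<in> Gamma0 N"
  shows "card (stab (moebius G \<tau>)) = card (stab \<tau>)"
proof -
  have into: "(\<lambda>A. G ** A ** adj2 G) ` stab \<tau> \<subseteq> stab (moebius G \<tau>)" if "\<tau> \<in> uhp" "G \<in> Gamma0 N" for G \<tau>
  proof
    fix B assume "B \<in> (\<lambda>A. G ** A ** adj2 G) ` stab \<tau>"
    then obtain A where A: "A \<in> Gamma0 N" "moebius A \<tau> = \<tau>" "B = G ** A ** adj2 G" unfolding stab_def by blast
    have gu: "moebius G \<tau> \<in> uhp" by (rule moebius_in_uhp_Gamma0[OF that])
    have "moebius B (moebius G \<tau>) = moebius (B ** G) \<tau>"
      using that(1) Gamma0_det[OF that(2)] by (simp add: moebius_mult)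
    also have "B ** G = G ** A" unfolding A(3) using adj2_cancel(4)[OF Gamma0_det[OF that(2)]] .
    also have "moebius (G ** A) \<tau> = moebius G \<tau>" using that(1) A by (simp add: moebius_mult Gamma0_det)
    finally show "B \<in> stab (moebius G \<tau>)"
      unfolding stab_def A(3) using A(1) that(2) by (simp add: Gamma0_mult Gamma0_adj2)
  qed
  have gu: "moebius G \<tau> \<in> uhp" by (rule moebius_in_uhp_Gamma0[OF t G])
  have inverse_eq: "moebius (adj2 G) (moebius G \<tau>) = \<tau>" using t G by (simp add: moebius_adj2 Gamma0_det)
  have "bij_betw (\<lambda>A. G ** A ** adj2 G) (stab \<tau>) (stab (moebius G \<tau>))"
  proof (rule bij_betw_byWitness[of _ "\<lambda>B. adj2 G ** B ** adj2 (adj2 G)"])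
    show "(\<lambda>B. adj2 G ** B ** adj2 (adj2 G)) ` stab (moebius G \<tau>) \<subseteq> stab \<tau>"
      using into[OF gu Gamma0_adj2[OF G]] unfolding inverse_eq .
    show "\<forall>A\<in>stab \<tau>. adj2 G ** (G ** A ** adj2 G) ** adj2 (adj2 G) = A"
      using conj_cancel(1)[OF Gamma0_SL2Z[OF G]] by simp
    show "\<forall>B\<in>stab (moebius G \<tau>). G ** (adj2 G ** B ** adj2 (adj2 G)) ** adj2 G = B"
      using conj_cancel(2)[OF Gamma0_SL2Z[OF G]] by simp
  qed (rule into[OF t G])
  then show ?thesis by (rule bij_betw_same_card[symmetric])
qed

lemma right_cancel_M: "X \<in> M \<Longrightarrow> A ** X = B ** X \<Longrightarrow> A = B" for A B :: "int^2^2"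
proof -
  assume X: "X \<in> M" and eq: "A ** X = B ** X"
  have "A ** (X ** adj2 X) = B ** (X ** adj2 X)" using eq by (simp add: matrix_mul_assoc)
  then show "A = B" using M_det[OF X] n_pos by (simp add: adj2_mult mat2_eq_iff matmul_nth)
qed

text \<open>The representatives fixing \<open>\<tau>\<close> in one coset form a coset of the stabilizer.\<close>

lemma card_fixing_matrices:
  assumes t: "\<tau> \<in> uhp"
  shows "card (fixing_matrices \<tau>) = card (point_fixing_cosets \<tau>) * card (stab \<tau>)"
proof -
  define F where "F K = K \<inter> fixing_matrices \<tau>" for K
  have F: "\<exists>X. X \<in> K \<and> X \<in> M \<and> F K = (\<lambda>G. G ** X) ` stab \<tau>" if K: "K \<in> point_fixing_cosets \<tau>" for K
  proof -
    obtain X where X: "K \<in> cosets" "X \<in> K" "moebius X \<tau> = \<tau>" using K unfolding point_fixing_cosets_def by blast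
    have XM: "X \<in> M" and KX: "K = coset_of X" by (rule coset_eq[OF X(1,2)])+
    have dX: "det X \<noteq> 0" using M_det_pos[OF XM] by simp
    have mv: "moebius (G ** X) \<tau> = moebius G \<tau>" for G using t dX X(3) by (simp add: moebius_mult)
    have "F K = (\<lambda>G. G ** X) ` stab \<tau>"
    proof (intro equalityI subsetI)
      fix Y assume "Y \<in> F K"
      then have Y: "Y \<in> K" "moebius Y \<tau> = \<tau>" unfolding F_def fixing_matrices_def by auto
      then obtain G where "G \<in> Gamma0 N" "Y = G ** X" unfolding KX coset_of_iff[OF XM] by blast
      then show "Y \<in> (\<lambda>G. G ** X) ` stab \<tau>" using Y(2) mv unfolding stab_def by auto
    next
      fix Y assume "Y \<in> (\<lambda>G. G ** X) ` stab \<tau>"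
      then obtain G where "G \<in> Gamma0 N" "moebius G \<tau> = \<tau>" "Y = G ** X" unfolding stab_def by blast
      then show "Y \<in> F K"
        unfolding F_def fixing_matrices_def using mv coset_left_closed[OF X(1,2)] M_left[OF _ XM] by simp
    qed
    then show ?thesis using X(2) XM by blast
  qed
  have ne: "F K \<noteq> {}" if K: "K \<in> point_fixing_cosets \<tau>" for K
    using F[OF K] card_stab_pos[OF t] by auto
  have sub: "point_fixing_cosets \<tau> \<subseteq> cosets" unfolding point_fixing_cosets_def by blast
  have disj: "F K \<inter> F K' = {}" if "K \<in> point_fixing_cosets \<tau>" "K' \<in> point_fixing_cosets \<tau>" "K \<noteq> K'" for K K'
  proof -
    have "K \<inter> K' = {}"
      using quotient_disj[OF equiv_hecke_rel, of K N n K'] sub that unfolding hecke_cosets_eq by blast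
    then show ?thesis unfolding F_def by blast
  qed
  have inj: "inj_on F (point_fixing_cosets \<tau>)"
  proof (rule inj_onI)
    fix K K' assume K: "K \<in> point_fixing_cosets \<tau>" "K' \<in> point_fixing_cosets \<tau>" "F K = F K'"
    show "K = K'"
    proof (rule ccontr)
      assume "K \<noteq> K'"
      then show False using disj[OF K(1,2)] ne[OF K(1)] K(3) by simp
    qed
  qed
  have un: "\<Union> (F ` point_fixing_cosets \<tau>) = fixing_matrices \<tau>"
  proof (intro equalityI subsetI)
    fix X assume X: "X \<in> fixing_matrices \<tau>"
    then have XM: "X \<in> M" "moebius X \<tau> = \<tau>" unfolding fixing_matrices_def by auto
    then have "coset_of X \<in> point_fixing_cosets \<tau>"
      unfolding point_fixing_cosets_def using coset_of_in in_coset_of by blast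
    then show "X \<in> \<Union> (F ` point_fixing_cosets \<tau>)" using X in_coset_of[OF XM(1)] unfolding F_def by blast
  qed (auto simp: F_def)
  have finK: "finite (point_fixing_cosets \<tau>)" using sub finite_cosets by (rule finite_subset)
  have cardF: "card (F K) = card (stab \<tau>) \<and> finite (F K)" if K: "K \<in> point_fixing_cosets \<tau>" for K
  proof -
    obtain X where X: "X \<in> M" "F K = (\<lambda>G. G ** X) ` stab \<tau>" using F[OF K] by blast
    have "inj_on (\<lambda>G. G ** X) (stab \<tau>)" using right_cancel_M[OF X(1)] by (intro inj_onI) blast
    then show ?thesis unfolding X(2) using finite_stab[OF t] by (simp add: card_image)
  qed
  have "card (stab \<tau>) * card (F ` point_fixing_cosets \<tau>) = card (\<Union> (F ` point_fixing_cosets \<tau>))"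
  proof (rule card_partition)
    show "finite (F ` point_fixing_cosets \<tau>)" using finK by simp
    show "finite (\<Union> (F ` point_fixing_cosets \<tau>))" using finK cardF by blast
    show "card X = card (stab \<tau>)" if "X \<in> F ` point_fixing_cosets \<tau>" for X using that cardF by blast
    show "X \<inter> Y = {}" if "X \<in> F ` point_fixing_cosets \<tau>" "Y \<in> F ` point_fixing_cosets \<tau>" "X \<noteq> Y" for X Y
      using that disj by blast
  qed
  then show ?thesis unfolding un card_image[OF inj] by (simp add: mult.commute)
qed

text \<open>The fixed points solve a quadratic equation. If it degenerated, the matrix would be scalar and its
  determinant a square.\<close>

lemma fixing_matrix_root:
  assumes t: "\<tau> \<in> uhp" and X: "X \<in> fixing_matrices \<tau>"
  shows "is_root (X$2$1) (X$2$2 - X$1$1) (- X$1$2) \<tau>" "X$2$1 \<noteq> 0"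
proof -
  have XM: "X \<in> M" and fix_X: "moebius X \<tau> = \<tau>" using X unfolding fixing_matrices_def by auto
  have dX: "det X \<noteq> 0" using M_det_pos[OF XM] by simp
  have root: "of_int (X$2$1) * \<tau>\<^sup>2 + of_int (X$2$2 - X$1$1) * \<tau> - of_int (X$1$2) = 0"
    using fix_X unfolding moebius_fixed_point_iff[OF t dX] .
  then show "is_root (X$2$1) (X$2$2 - X$1$1) (- X$1$2) \<tau>" by simp
  show "X$2$1 \<noteq> 0"
  proof
    assume c: "X$2$1 = 0"
    then have "of_int (X$2$2 - X$1$1) * \<tau> + of_int (- X$1$2) = 0" using root by simp
    then have "X$2$2 - X$1$1 = 0" using lin_nonzero[OF t, of "X$2$2 - X$1$1" "- X$1$2"] by auto
    then have "int n = (X$1$1)\<^sup>2" using M_det[OF XM] c by (simp add: det_2 power2_eq_square)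
    then have "int n = int ((nat \<bar>X$1$1\<bar>)\<^sup>2)" by simp
    then have "n = (nat \<bar>X$1$1\<bar>)\<^sup>2" by (simp only: of_nat_eq_iff)
    then show False using nonsquare by blast
  qed
qed

lemma finite_forms_at: "finite (forms_at r \<tau>)"
proof -
  have "Q = Q'" if "Q \<in> forms_at r \<tau>" "Q' \<in> forms_at r \<tau>" for Q Q'
    using that unfolding forms_at_def bqfs_def by (intro bqf_determined_by_root) auto
  then have "forms_at r \<tau> = {} \<or> (\<exists>Q. forms_at r \<tau> = {Q})" by blast
  then show ?thesis by auto
qed

text \<open>A matrix of determinant \<open>n\<close> fixing \<open>\<tau>\<close> is the same as its trace together with its fixed point
  form, up to the sign of the lower left entry.\<close>

lemma card_fixing_matrices_forms:
  assumes t: "\<tau> \<in> uhp"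
  shows "card (fixing_matrices \<tau>) = 2 * (\<Sum>r\<in>traces. card (forms_at r \<tau>))"
proof -
  define P where "P = {X \<in> fixing_matrices \<tau>. X$2$1 > 0}"
  define f where "f X = (X$1$1 + X$2$2, (X$2$1, X$2$2 - X$1$1, - X$1$2))" for X :: "int^2^2"
  \<comment> \<open>The inverse map. Its entries are integral because \<open>B\<close> and the trace have the same parity.\<close>
  define h where "h = (\<lambda>(r, (A, B, C)). M2 ((r - B) div 2) (- C) A ((r + B) div 2))"
  have "bij_betw f P (SIGMA r:traces. forms_at r \<tau>)"
  proof (rule bij_betw_byWitness[of _ h])
    show "\<forall>X\<in>P. h (f X) = X" by (simp add: h_def f_def mat2_eq_iff)
    show "f ` P \<subseteq> (SIGMA r:traces. forms_at r \<tau>)"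
    proof
      fix y assume "y \<in> f ` P"
      then obtain X where X: "X \<in> fixing_matrices \<tau>" "X$2$1 > 0" "y = f X" unfolding P_def by blast
      have XM: "X \<in> M" using X(1) unfolding fixing_matrices_def by simp
      note root = fixing_matrix_root(1)[OF t X(1)]
      define r where "r = X$1$1 + X$2$2"
      have disc: "(X$2$2 - X$1$1)\<^sup>2 - 4 * X$2$1 * (- X$1$2) = r\<^sup>2 - 4 * int n"
        unfolding M_det[OF XM, symmetric] r_def det_2 by (simp add: power2_eq_square algebra_simps)
      have "real_of_int ((X$2$2 - X$1$1)\<^sup>2 - 4 * X$2$1 * (- X$1$2)) < 0"
        unfolding root_coordinates(3)[OF t root] using X(2) t by (simp add: uhp_def)
      then have neg: "(X$2$2 - X$1$1)\<^sup>2 - 4 * X$2$1 * (- X$1$2) < 0" by (simp only: of_int_less_0_iff)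
      then have pd: "bqf_pos_def (X$2$1, X$2$2 - X$1$1, - X$1$2)" unfolding bqf_pos_def_iff using X(2) by simp
      have "r \<in> traces" unfolding traces_iff using neg unfolding disc by simp
      moreover have "(X$2$1, X$2$2 - X$1$1, - X$1$2) \<in> forms_at r \<tau>"
        unfolding forms_at_def bqfs_def using pd disc XM bqf_root_eq_iff[OF pd t] root by (simp add: M_iff)
      ultimately show "y \<in> (SIGMA r:traces. forms_at r \<tau>)" unfolding X(3) f_def r_def by blast
    qed
    have inv: "h (r, Q) \<in> P \<and> f (h (r, Q)) = (r, Q)" if Q: "Q \<in> forms_at r \<tau>" for r Q
    proof -
      obtain A B C where ABC: "Q = (A, B, C)" by (cases Q)
      have pd: "bqf_pos_def (A, B, C)" and disc: "B\<^sup>2 - 4 * A * C = r\<^sup>2 - 4 * int n" and NA: "int N dvd A"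
        and root: "bqf_root (A, B, C) = \<tau>" using Q unfolding forms_at_def bqfs_def ABC by auto
      have A: "A > 0" using pd unfolding bqf_pos_def_iff by simp
      have "r\<^sup>2 - B\<^sup>2 = 2 * (2 * int n - 2 * A * C)" using disc by simp
      then have "even (r\<^sup>2 - B\<^sup>2)" by simp
      then have ev: "even (r - B)" "even (r + B)" by simp_all
      define a where "a = (r - B) div 2"
      define d where "d = (r + B) div 2"
      have a: "r - B = 2 * a" and d: "r + B = 2 * d" using ev by (simp_all add: a_def d_def)
      have rB: "r = a + d" "B = d - a" using a d by simp_all
      have X: "h (r, Q) = M2 a (- C) A d" by (simp add: h_def ABC a_def d_def)
      have "4 * (a * d + C * A) = 4 * int n" using disc unfolding rB by (simp add: power2_eq_square algebra_simps)
      then have det: "det (M2 a (- C) A d) = int n" by simp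
      have XM: "M2 a (- C) A d \<in> M" unfolding M_iff using det NA by simp
      have "is_root A B C \<tau>" using bqf_root_eq_iff[OF pd t] root by simp
      then have "moebius (M2 a (- C) A d) \<tau> = \<tau>"
        using det n_pos by (subst moebius_fixed_point_iff[OF t]) (simp_all add: rB)
      then have "h (r, Q) \<in> P" unfolding P_def fixing_matrices_def X using XM A by simp
      moreover have "f (h (r, Q)) = (r, Q)" unfolding X f_def by (simp add: ABC rB)
      ultimately show ?thesis by blast
    qed
    show "\<forall>y\<in>(SIGMA r:traces. forms_at r \<tau>). f (h y) = y" using inv by blast
    show "h ` (SIGMA r:traces. forms_at r \<tau>) \<subseteq> P" using inv by blast
  qed
  then have "card P = card (SIGMA r:traces. forms_at r \<tau>)" by (rule bij_betw_same_card)
  also have "\<dots> = (\<Sum>r\<in>traces. card (forms_at r \<tau>))"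
    using finite_traces finite_forms_at by (intro card_SigmaI) auto
  finally have cP: "card P = (\<Sum>r\<in>traces. card (forms_at r \<tau>))" .
  have finP: "finite P"
  proof -
    have "finite (SIGMA r:traces. forms_at r \<tau>)" using finite_traces finite_forms_at by blast
    then show ?thesis using bij_betw_finite[OF \<open>bij_betw f P (SIGMA r:traces. forms_at r \<tau>)\<close>] by simp
  qed
  have um: "- X \<in> fixing_matrices \<tau>" if "X \<in> fixing_matrices \<tau>" for X
    using that unfolding fixing_matrices_def M_iff by (simp add: det_2)
  have "fixing_matrices \<tau> = P \<union> uminus ` P"
  proof (intro equalityI subsetI)
    fix X assume X: "X \<in> fixing_matrices \<tau>"
    show "X \<in> P \<union> uminus ` P"
    proof (cases "X$2$1 > 0")
      case False
      then have "- X \<in> P" unfolding P_def using um[OF X] fixing_matrix_root(2)[OF t X] by simp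
      then have "- (- X) \<in> uminus ` P" by (rule imageI)
      then show ?thesis by simp
    qed (use X in \<open>simp add: P_def\<close>)
  next
    fix X assume "X \<in> P \<union> uminus ` P"
    then show "X \<in> fixing_matrices \<tau>" using um unfolding P_def by auto
  qed
  moreover have "P \<inter> uminus ` P = {}" unfolding P_def by auto
  ultimately have "card (fixing_matrices \<tau>) = card P + card (uminus ` P)"
    using finP by (simp add: card_Un_disjoint)
  also have "card (uminus ` P) = card P" by (intro card_image) (simp add: inj_on_def)
  finally show ?thesis using cP by simp
qed

section \<open>Class polynomials\<close>

text \<open>A form is determined by its root and discriminant, so fixing the form and fixing the root
  amount to the same.\<close>

lemma bqf_stab_eq:
  assumes "Q \<in> bqfs N D"
  shows "bqf_stab N Q = stab (bqf_root Q)"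
proof -
  have pd: "bqf_pos_def Q" using assms by (simp add: bqfs_def)
  note u = bqf_root_in_uhp[OF pd]
  have "bqf_act Q A = Q \<longleftrightarrow> moebius A (bqf_root Q) = bqf_root Q" if A: "A \<in> Gamma0 N" for A
  proof
    assume "bqf_act Q A = Q"
    then have "moebius (adj2 A) (bqf_root Q) = bqf_root Q" using bqf_root_act[OF pd Gamma0_SL2Z[OF A]] by simp
    then show "moebius A (bqf_root Q) = bqf_root Q" using moebius_adj2(2)[OF u, of A] A by (simp add: Gamma0_det)
  next
    assume "moebius A (bqf_root Q) = bqf_root Q"
    then have "bqf_root (bqf_act Q A) = bqf_root Q"
      using bqf_root_act[OF pd Gamma0_SL2Z[OF A]] moebius_adj2(1)[OF u, of A] A by (simp add: Gamma0_det)
    then show "bqf_act Q A = Q"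
      using pd bqf_pos_def_act[OF pd Gamma0_SL2Z[OF A]] A
      by (intro bqf_determined_by_root) (auto simp: bqf_disc_act Gamma0_det)
  qed
  then show ?thesis unfolding bqf_stab_def stab_def by blast
qed

lemma bqf_weight_eq:
  assumes "Q \<in> bqfs N D"
  shows "2 * bqf_weight N Q = card (stab (bqf_root Q))"
proof -
  have pd: "bqf_pos_def Q" using assms by (simp add: bqfs_def)
  have "- A \<noteq> A" if "A \<in> stab (bqf_root Q)" for A
  proof
    assume "- A = A"
    then have "A$1$1 = 0" "A$1$2 = 0" by (simp_all add: mat2_eq_iff)
    then have "det A = 0" by (simp add: det_2)
    then show False using that Gamma0_det unfolding stab_def by fastforce
  qed
  then show ?thesis
    unfolding bqf_weight_def bqf_stab_eq[OF assms]
    using finite_stab[OF bqf_root_in_uhp[OF pd]] by (intro card_quotient_by_sign) (auto simp: stab_def Gamma0_uminus)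
qed

definition form_class :: "int \<Rightarrow> bqf \<Rightarrow> bqf set" where
  "form_class D Q = bqf_rel N D `` {Q}"

definition form_rep :: "bqf set \<Rightarrow> bqf" where
  "form_rep K = (SOME Q. Q \<in> K)"

lemma form_rep:
  assumes "K \<in> bqf_classes N D"
  shows "form_rep K \<in> bqfs N D" "K = form_class D (form_rep K)"
proof -
  obtain Q where Q: "Q \<in> bqfs N D" "K = bqf_rel N D `` {Q}"
    using assms unfolding bqf_classes_eq by (rule quotientE)
  have "Q \<in> K" unfolding Q(2) by (rule equiv_class_self[OF equiv_bqf_rel Q(1)])
  then have "form_rep K \<in> K" unfolding form_rep_def by (rule someI)
  then have rel: "(Q, form_rep K) \<in> bqf_rel N D" unfolding Q(2) by simp
  then show "form_rep K \<in> bqfs N D" by (simp add: bqf_rel_def)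
  show "K = form_class D (form_rep K)"
    unfolding form_class_def using equiv_class_eq[OF equiv_bqf_rel rel] Q(2) by simp
qed

lemma class_eq_if_root_related:
  assumes Q: "Q \<in> bqfs N D" and Q': "Q' \<in> bqfs N D" and rel: "Gamma0_related N (bqf_root Q) (bqf_root Q')"
  shows "form_class D Q = form_class D Q'"
proof -
  obtain G where G: "G \<in> Gamma0 N" "bqf_root Q' = moebius G (bqf_root Q)" using rel unfolding Gamma0_related_def by blast
  have pd: "bqf_pos_def Q" "bqf_pos_def Q'" using Q Q' by (auto simp: bqfs_def)
  note GS = Gamma0_SL2Z[OF Gamma0_adj2[OF G(1)]]
  have "Q' = bqf_act Q (adj2 G)"
  proof (rule bqf_determined_by_root)
    show "bqf_root Q' = bqf_root (bqf_act Q (adj2 G))" unfolding bqf_root_act[OF pd(1) GS] G(2) by simp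
    show "bqf_disc Q' = bqf_disc (bqf_act Q (adj2 G))" using Q Q' G by (simp add: bqf_disc_act bqfs_def Gamma0_det)
  qed (use pd bqf_pos_def_act GS in auto)
  then have "(Q, Q') \<in> bqf_rel N D" unfolding bqf_rel_def using Q Q' Gamma0_adj2[OF G(1)] by blast
  then show ?thesis unfolding form_class_def by (rule equiv_class_eq[OF equiv_bqf_rel])
qed

lemma form_class_eqD:
  assumes Q: "Q \<in> bqfs N D" and Q': "Q' \<in> bqfs N D" and eq: "form_class D Q = form_class D Q'"
  shows "Gamma0_related N (bqf_root Q) (bqf_root Q')"
proof -
  have "(Q, Q') \<in> bqf_rel N D" using eq_equiv_class[OF eq[unfolded form_class_def] equiv_bqf_rel Q'] .
  then obtain A where A: "A \<in> Gamma0 N" "Q' = bqf_act Q A" unfolding bqf_rel_def by blast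
  have "bqf_pos_def Q" using Q by (simp add: bqfs_def)
  then have "bqf_root Q' = moebius (adj2 A) (bqf_root Q)" unfolding A(2) by (rule bqf_root_act[OF _ Gamma0_SL2Z[OF A(1)]])
  then show ?thesis unfolding Gamma0_related_def using Gamma0_adj2[OF A(1)] by blast
qed

text \<open>A form provides a Hecke matrix fixing its root, which makes the diagonal vanish there.\<close>

lemma diag_root_at_form:
  assumes r: "r \<in> traces" and Q: "Q \<in> bqfs N (r\<^sup>2 - 4 * int n)"
  shows "poly diag (j (bqf_root Q)) = 0"
proof -
  define \<tau> where "\<tau> = bqf_root Q"
  have t: "\<tau> \<in> uhp" unfolding \<tau>_def using Q by (intro bqf_root_in_uhp) (simp add: bqfs_def)
  have "Q \<in> forms_at r \<tau>" unfolding forms_at_def \<tau>_def using Q by simp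
  then have "card (forms_at r \<tau>) > 0" using finite_forms_at by (auto simp: card_gt_0_iff)
  then have "(\<Sum>r\<in>traces. card (forms_at r \<tau>)) > 0"
    by (rule sum_pos2[OF finite_traces r]) simp
  then have "card (point_fixing_cosets \<tau>) * card (stab \<tau>) > 0"
    unfolding card_fixing_matrices[OF t, symmetric] card_fixing_matrices_forms[OF t] by simp
  then have "Polynomial.order (j \<tau>) diag > 0" unfolding order_at_point[OF t] by simp
  then show ?thesis using diag_nonzero_and_lead_coeff(1) by (simp add: order_root \<tau>_def)
qed

text \<open>Inequivalent classes have distinct values of \<open>j\<close> at their roots, and these are among the roots of the
  diagonal, a nonzero polynomial.\<close>

lemma finite_bqf_classes:
  assumes r: "r \<in> traces"
  shows "finite (bqf_classes N (r\<^sup>2 - 4 * int n))"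
proof -
  define D where "D = r\<^sup>2 - 4 * int n"
  have "inj_on (\<lambda>K. j (bqf_root (form_rep K))) (bqf_classes N D)"
  proof (rule inj_onI)
    fix K K' assume K: "K \<in> bqf_classes N D" "K' \<in> bqf_classes N D"
      and eq: "j (bqf_root (form_rep K)) = j (bqf_root (form_rep K'))"
    note rep = form_rep[OF K(1)] form_rep[OF K(2)]
    have "Gamma0_related N (bqf_root (form_rep K)) (bqf_root (form_rep K'))"
      using rep(1,3) eq by (intro j_injective bqf_root_in_uhp) (auto simp: bqfs_def)
    then have "form_class D (form_rep K) = form_class D (form_rep K')"
      by (rule class_eq_if_root_related[OF rep(1,3)])
    then show "K = K'" using rep(2,4) by simp
  qed
  moreover have "(\<lambda>K. j (bqf_root (form_rep K))) ` bqf_classes N D \<subseteq> {x. poly diag x = 0}"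
    using diag_root_at_form[OF r] form_rep(1) unfolding D_def by blast
  moreover have "finite {x. poly diag x = 0}" by (rule poly_roots_finite[OF diag_nonzero_and_lead_coeff(1)])
  ultimately show ?thesis unfolding D_def by (metis finite_imageD finite_subset)
qed

lemma lookup_class_poly:
  assumes r: "r \<in> traces"
  defines "D \<equiv> r\<^sup>2 - 4 * int n"
  shows "Poly_Mapping.lookup (class_poly N j D) x =
    (\<Sum>K\<in>{K \<in> bqf_classes N D. j (bqf_root (form_rep K)) = x}. 1 / of_nat (bqf_weight N (form_rep K)))"
proof -
  have "Poly_Mapping.lookup (class_poly N j D) x =
     (\<Sum>K\<in>bqf_classes N D. if j (bqf_root (form_rep K)) = x then 1 / of_nat (bqf_weight N (form_rep K)) else 0)"
    unfolding class_poly_def Let_def form_rep_def[symmetric]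
    by (simp only: lookup_sum lookup_single when_def)
  also have "\<dots> = (\<Sum>K\<in>{K \<in> bqf_classes N D. j (bqf_root (form_rep K)) = x}. 1 / of_nat (bqf_weight N (form_rep K)))"
    unfolding D_def by (rule sum.inter_filter[OF finite_bqf_classes[OF r], symmetric])
  finally show ?thesis .
qed

text \<open>The classes contributing at \<open>j \<tau>\<close> are those of the forms with root equal to \<open>\<tau>\<close>; all of them have
  the weight given by the stabilizer of \<open>\<tau>\<close>.\<close>

lemma lookup_class_poly_point:
  assumes r: "r \<in> traces" and t: "\<tau> \<in> uhp"
  shows "Poly_Mapping.lookup (class_poly N j (r\<^sup>2 - 4 * int n)) (j \<tau>) =
    of_nat (card (forms_at r \<tau>)) * (2 / of_nat (card (stab \<tau>)))"
proof -
  define D where "D = r\<^sup>2 - 4 * int n"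
  define S where "S = {K \<in> bqf_classes N D. j (bqf_root (form_rep K)) = j \<tau>}"
  have relS: "Gamma0_related N (bqf_root (form_rep K)) \<tau>" if "K \<in> S" for K
    using that form_rep(1) t unfolding S_def by (intro j_injective bqf_root_in_uhp) (auto simp: bqfs_def)
  have F: "Q \<in> bqfs N D \<and> bqf_root Q = \<tau>" if "Q \<in> forms_at r \<tau>" for Q using that unfolding forms_at_def D_def by simp
  have weight: "1 / of_nat (bqf_weight N (form_rep K)) = (2 / of_nat (card (stab \<tau>)) :: rat)" if K: "K \<in> S" for K
  proof -
    have rep: "form_rep K \<in> bqfs N D" using K form_rep(1) unfolding S_def by blast
    obtain G where G: "G \<in> Gamma0 N" "\<tau> = moebius G (bqf_root (form_rep K))"
      using relS[OF K] unfolding Gamma0_related_def by blast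
    have "2 * bqf_weight N (form_rep K) = card (stab \<tau>)"
      unfolding bqf_weight_eq[OF rep] G(2)
      using rep by (intro card_stab_moebius[symmetric] bqf_root_in_uhp G) (simp add: bqfs_def)
    then show ?thesis by (simp flip: \<open>2 * bqf_weight N (form_rep K) = card (stab \<tau>)\<close>)
  qed
  have "bij_betw (form_class D) (forms_at r \<tau>) S"
    unfolding bij_betw_def
  proof
    show "inj_on (form_class D) (forms_at r \<tau>)"
    proof (rule inj_onI)
      fix Q Q' assume Q: "Q \<in> forms_at r \<tau>" "Q' \<in> forms_at r \<tau>"
      show "Q = Q'" using F[OF Q(1)] F[OF Q(2)] by (intro bqf_determined_by_root) (auto simp: bqfs_def)
    qed
    show "form_class D ` forms_at r \<tau> = S"
    proof (intro equalityI subsetI)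
      fix K assume "K \<in> form_class D ` forms_at r \<tau>"
      then obtain Q where Q: "Q \<in> bqfs N D" "bqf_root Q = \<tau>" "K = form_class D Q" using F by blast
      have K: "K \<in> bqf_classes N D" unfolding Q(3) form_class_def bqf_classes_eq by (rule quotientI[OF Q(1)])
      have "Gamma0_related N (bqf_root Q) (bqf_root (form_rep K))"
        using form_class_eqD[OF Q(1) form_rep(1)[OF K]] form_rep(2)[OF K] Q(3) by simp
      then have "j (bqf_root (form_rep K)) = j \<tau>" using j_related[of "bqf_root Q"] t Q(2) by simp
      then show "K \<in> S" using K unfolding S_def by simp
    next
      fix K assume K: "K \<in> S"
      then have Kc: "K \<in> bqf_classes N D" unfolding S_def by simp
      note rep = form_rep[OF Kc]
      have pd: "bqf_pos_def (form_rep K)" using rep(1) by (simp add: bqfs_def)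
      obtain G where G: "G \<in> Gamma0 N" "\<tau> = moebius G (bqf_root (form_rep K))"
        using relS[OF K] unfolding Gamma0_related_def by blast
      define Q where "Q = bqf_act (form_rep K) (adj2 G)"
      have Q: "Q \<in> bqfs N D" unfolding Q_def by (rule bqfs_act[OF rep(1) Gamma0_adj2[OF G(1)]])
      have root: "bqf_root Q = \<tau>"
        unfolding Q_def bqf_root_act[OF pd Gamma0_SL2Z[OF Gamma0_adj2[OF G(1)]]] G(2) by simp
      have "form_class D (form_rep K) = form_class D Q"
        using relS[OF K] by (intro class_eq_if_root_related[OF rep(1) Q]) (simp add: root)
      then have "K = form_class D Q" using rep(2) by simp
      moreover have "Q \<in> forms_at r \<tau>" unfolding forms_at_def using Q root by (simp add: D_def)
      ultimately show "K \<in> form_class D ` forms_at r \<tau>" by blast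
    qed
  qed
  then have "card S = card (forms_at r \<tau>)" by (rule bij_betw_same_card[symmetric])
  moreover have "Poly_Mapping.lookup (class_poly N j D) (j \<tau>) = (\<Sum>K\<in>S. 2 / of_nat (card (stab \<tau>)))"
    unfolding D_def lookup_class_poly[OF r] using weight unfolding S_def D_def by (intro sum.cong refl)
  ultimately show ?thesis by (simp add: D_def)
qed

definition total_exponent :: "complex \<Rightarrow>\<^sub>0 rat" where
  "total_exponent = (\<Sum>r\<in>traces. class_poly N j (r\<^sup>2 - 4 * int n))"

text \<open>Double counting of the Hecke matrices fixing \<open>\<tau>\<close>: by cosets, and by traces and forms.\<close>

lemma lookup_total_exponent:
  assumes t: "\<tau> \<in> uhp"
  shows "Poly_Mapping.lookup total_exponent (j \<tau>) = of_nat (Polynomial.order (j \<tau>) diag)"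
proof -
  have s: "card (stab \<tau>) > 0" by (rule card_stab_pos[OF t])
  have "Poly_Mapping.lookup total_exponent (j \<tau>) =
      (\<Sum>r\<in>traces. of_nat (card (forms_at r \<tau>)) * (2 / of_nat (card (stab \<tau>))))"
    unfolding total_exponent_def lookup_sum using lookup_class_poly_point[OF _ t] by (intro sum.cong) auto
  also have "\<dots> = of_nat (2 * (\<Sum>r\<in>traces. card (forms_at r \<tau>))) / of_nat (card (stab \<tau>))"
    by (simp add: sum_distrib_left sum_divide_distrib mult.commute)
  also have "2 * (\<Sum>r\<in>traces. card (forms_at r \<tau>)) = card (point_fixing_cosets \<tau>) * card (stab \<tau>)"
    unfolding card_fixing_matrices[OF t, symmetric] card_fixing_matrices_forms[OF t] ..
  finally show ?thesis using s by (simp add: order_at_point[OF t])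
qed

lemma lookup_total_exponent_outside:
  assumes "x \<notin> j ` uhp"
  shows "Poly_Mapping.lookup total_exponent x = 0"
proof -
  have "Poly_Mapping.lookup (class_poly N j (r\<^sup>2 - 4 * int n)) x = 0" if r: "r \<in> traces" for r
  proof -
    have e: "{K \<in> bqf_classes N (r\<^sup>2 - 4 * int n). j (bqf_root (form_rep K)) = x} = {}"
      using assms form_rep(1) bqf_root_in_uhp unfolding bqfs_def by blast
    show ?thesis unfolding lookup_class_poly[OF r] e by simp
  qed
  then show ?thesis unfolding total_exponent_def lookup_sum by simp
qed

section \<open>Cusp representatives\<close>

text \<open>Matrices with equivalent cusps differ by a group element on the left and a translation on the
  right; neither affects the limit.\<close>

lemma cusp_limit_equiv:
  assumes A: "A \<in> SL2Z" and B: "B \<in> SL2Z" and eq: "cusp_equiv N (cusp_act B None) (cusp_act A None)"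
    and L: "((\<lambda>\<tau>. j (moebius B \<tau>)) \<longlongrightarrow> L) at_i_infinity"
  shows "((\<lambda>\<tau>. j (moebius A \<tau>)) \<longlongrightarrow> L) at_i_infinity"
proof -
  obtain G where G: "G \<in> Gamma0 N" "cusp_act A None = cusp_act G (cusp_act B None)"
    using eq unfolding cusp_equiv_def by blast
  then have "cusp_act A None = cusp_act (G ** B) None"
    using B by (simp add: cusp_act_mult SL2Z_det Gamma0_det del: cusp_act.simps)
  then obtain k where k: "A = (G ** B) ** transl k \<or> A = - ((G ** B) ** transl k)"
    using cusp_stabilizer_coset[OF A SL2Z_mult[OF Gamma0_SL2Z[OF G(1)] B]] by blast
  have "((\<lambda>\<tau>. j (moebius B (\<tau> + of_int k))) \<longlongrightarrow> L) at_i_infinity"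
    by (rule filterlim_compose[OF L filterlim_shift_at_i_infinity])
  then show ?thesis
  proof (rule Lim_transform_eventually)
    show "\<forall>\<^sub>F \<tau> in at_i_infinity. j (moebius B (\<tau> + of_int k)) = j (moebius A \<tau>)"
      using eventually_uhp
    proof eventually_elim
      case (elim \<tau>)
      have u: "\<tau> + of_int k \<in> uhp" using elim by (simp add: uhp_def)
      have "moebius A \<tau> = moebius ((G ** B) ** transl k) \<tau>" using k by auto
      also have "\<dots> = moebius (G ** B) (\<tau> + of_int k)"
        using elim by (simp add: moebius_mult SL2Z_det[OF transl_SL2Z])
      also have "\<dots> = moebius G (moebius B (\<tau> + of_int k))" using u B by (simp add: moebius_mult SL2Z_det)
      finally show ?case using j_inv[OF G(1) moebius_in_uhp_SL2Z[OF u B]] by simp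
    qed
  qed
qed

lemma cusp_value_eq:
  assumes A: "A \<in> SL2Z" "cusp_act A None = s" and L: "((\<lambda>\<tau>. j (moebius A \<tau>)) \<longlongrightarrow> L) at_i_infinity"
  shows "cusp_value j s = L"
  unfolding cusp_value_def
proof (rule the_equality)
  show "\<exists>A\<in>SL2Z. cusp_act A None = s \<and> ((\<lambda>\<tau>. j (moebius A \<tau>)) \<longlongrightarrow> L) at_i_infinity" using assms by blast
  fix L' assume "\<exists>A\<in>SL2Z. cusp_act A None = s \<and> ((\<lambda>\<tau>. j (moebius A \<tau>)) \<longlongrightarrow> L') at_i_infinity"
  then obtain B where B: "B \<in> SL2Z" "cusp_act B None = s" "((\<lambda>\<tau>. j (moebius B \<tau>)) \<longlongrightarrow> L') at_i_infinity" by blast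
  have "((\<lambda>\<tau>. j (moebius A \<tau>)) \<longlongrightarrow> L') at_i_infinity"
    using cusp_limit_equiv[OF A(1) B(1) _ B(3)] A(2) B(2) cusp_equiv_refl by simp
  then show "L' = L" using tendsto_unique[OF at_i_infinity_neq_bot _ L] by blast
qed

text \<open>Infinitely many representatives would give two matrices in the same coset of the group,
  hence two equivalent cusps.\<close>

lemma finite_cusp_representatives:
  assumes "cusp_representatives N S"
  shows "finite S"
proof (rule ccontr)
  assume "infinite S"
  then obtain s :: "nat \<Rightarrow> cusp" where s: "inj s" "range s \<subseteq> S" using infinite_countable_subset by blast
  have "\<exists>A. A \<in> SL2Z \<and> s k = cusp_act A None" for k using cusp_eq_matrix[of "s k"] by metis
  then obtain A where A: "\<And>k. A k \<in> SL2Z" "\<And>k. s k = cusp_act (A k) None" by metis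
  obtain B and r :: "nat \<Rightarrow> nat" where B: "B \<in> SL2Z" and r: "strict_mono r" "\<And>k. A (r k) ** adj2 B \<in> Gamma0 N"
    using SL2Z_sequence_in_one_coset[of N A, OF N_pos A(1)] by metis
  have eq: "cusp_equiv N (cusp_act B None) (s (r k))" for k
    unfolding cusp_equiv_def
  proof (rule bexI[OF _ r(2)])
    have "cusp_act (A (r k) ** adj2 B) (cusp_act B None) = cusp_act ((A (r k) ** adj2 B) ** B) None"
      using A(1) B by (simp add: cusp_act_mult SL2Z_det det_mul del: cusp_act.simps)
    also have "(A (r k) ** adj2 B) ** B = A (r k)" using adj2_cancel(4)[OF SL2Z_det[OF B]] .
    finally show "s (r k) = cusp_act (A (r k) ** adj2 B) (cusp_act B None)" unfolding A(2) by simp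
  qed
  have "\<exists>!t. t \<in> S \<and> cusp_equiv N t (cusp_act B None)" using assms unfolding cusp_representatives_def by blast
  then have "s (r 0) = s (r 1)" using cusp_equiv_sym[OF eq] s(2) by blast
  then have "r 0 = r 1" using s(1) by (simp add: inj_eq)
  then show False using strict_monoD[OF r(1), of 0 1] by simp
qed

section \<open>Factorization of the diagonal\<close>

text \<open>The roots of the diagonal are values of \<open>j\<close> at points or at finite cusps, never both; their
  multiplicities are known in either case.\<close>

theorem diagonal_factorization:
  assumes S: "cusp_representatives N S"
  shows "natural_exponents total_exponent \<and>
    diag = (-1) ^ (card {d. d dvd n} div 2) * linear_powers total_exponent *
      (\<Prod>s | s \<in> S \<and> \<not> cusp_equiv N s None. [:- cusp_value j s, 1:] ^ cusp_exponent s n N)"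
proof
  show nat: "natural_exponents total_exponent"
    unfolding natural_exponents_def
  proof
    fix x show "Poly_Mapping.lookup total_exponent x \<in> \<nat>"
    proof (cases "x \<in> j ` uhp")
      case True
      then show ?thesis using lookup_total_exponent by auto
    qed (simp add: lookup_total_exponent_outside)
  qed
  define S' where "S' = {s. s \<in> S \<and> \<not> cusp_equiv N s None}"
  have finS': "finite S'" using finite_cusp_representatives[OF S] unfolding S'_def by simp
  define lin where "lin x = [:- x, 1:] ^ Polynomial.order x diag" for x
  have cusp: "\<exists>A. A \<in> SL2Z \<and> cusp_act A None = s \<and> ((\<lambda>\<tau>. j (moebius A \<tau>)) \<longlongrightarrow> cusp_value j s) at_i_infinity \<and>
      Polynomial.order (cusp_value j s) diag = cusp_exponent s n N" if s: "s \<in> S'" for s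
  proof -
    obtain A where A: "A \<in> SL2Z" "s = cusp_act A None" "A$2$1 \<ge> 0" "cusp_denom s = nat (A$2$1)" by (rule cusp_eq_matrix)
    have fin: "finite_cusp A" unfolding finite_cusp_def A(2)[symmetric] using s cusp_equiv_sym unfolding S'_def by blast
    obtain L where L: "((\<lambda>\<tau>. j (moebius A \<tau>)) \<longlongrightarrow> L) at_i_infinity" using j_limit[OF A(1) fin] by blast
    have "cusp_value j s = L" by (rule cusp_value_eq[OF A(1) A(2)[symmetric] L])
    then show ?thesis using A(1,2) L order_at_cusp_eq_exponent[OF A(1) fin L A(3,4)] by blast
  qed
  have inj: "inj_on (cusp_value j) S'"
  proof (rule inj_onI)
    fix s t assume st: "s \<in> S'" "t \<in> S'" "cusp_value j s = cusp_value j t"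
    obtain A where A: "A \<in> SL2Z" "cusp_act A None = s" "((\<lambda>\<tau>. j (moebius A \<tau>)) \<longlongrightarrow> cusp_value j s) at_i_infinity"
      using cusp[OF st(1)] by blast
    obtain B where B: "B \<in> SL2Z" "cusp_act B None = t" "((\<lambda>\<tau>. j (moebius B \<tau>)) \<longlongrightarrow> cusp_value j s) at_i_infinity"
      using cusp[OF st(2)] st(3) by auto
    have "cusp_equiv N s t" using cusp_values_distinct[OF A(1,3) B(1,3)] A(2) B(2) by simp
    moreover have "\<exists>!u. u \<in> S \<and> cusp_equiv N u t" using S unfolding cusp_representatives_def by blast
    ultimately show "s = t" using st(1,2) cusp_equiv_refl unfolding S'_def by blast
  qed
  have cusps: "(\<Prod>s\<in>S'. [:- cusp_value j s, 1:] ^ cusp_exponent s n N) = (\<Prod>x\<in>cusp_value j ` S'. lin x)"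
    unfolding prod.reindex[OF inj] o_def lin_def using cusp by (intro prod.cong refl) metis
  define T where "T = Poly_Mapping.keys total_exponent"
  have keysT: "x \<in> j ` uhp" if "x \<in> T" for x
    using that lookup_total_exponent_outside unfolding T_def in_keys_iff by blast
  have forms: "linear_powers total_exponent = (\<Prod>x\<in>T. lin x)"
    unfolding linear_powers_def T_def[symmetric] lin_def
  proof (rule prod.cong[OF refl])
    fix x assume "x \<in> T"
    then obtain \<tau> where "\<tau> \<in> uhp" "x = j \<tau>" using keysT by blast
    then show "[:- x, 1:] ^ nat \<lfloor>Poly_Mapping.lookup total_exponent x\<rfloor> = [:- x, 1:] ^ Polynomial.order x diag"
      using lookup_total_exponent by simp
  qed
  have finT: "finite T" by (simp add: T_def)
  have disj: "T \<inter> cusp_value j ` S' = {}"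
  proof -
    have False if x: "x \<in> T" and s: "s \<in> S'" "x = cusp_value j s" for x s
    proof -
      obtain \<tau> where "\<tau> \<in> uhp" "x = j \<tau>" using keysT[OF x] by blast
      then show False using cusp[OF s(1)] cusp_value_not_attained s(2) by metis
    qed
    then show ?thesis by blast
  qed
  have roots: "{x. poly diag x = 0} \<subseteq> T \<union> cusp_value j ` S'"
  proof
    fix x assume "x \<in> {x. poly diag x = 0}"
    then have ord: "Polynomial.order x diag \<noteq> 0" using diag_nonzero_and_lead_coeff(1) by (simp add: order_root)
    from j_surjective[of x] show "x \<in> T \<union> cusp_value j ` S'"
    proof
      assume "\<exists>\<tau>\<in>uhp. j \<tau> = x"
      then show ?thesis using lookup_total_exponent ord unfolding T_def by (auto simp: in_keys_iff)
    next
      assume "\<exists>A\<in>SL2Z. finite_cusp A \<and> ((\<lambda>\<tau>. j (moebius A \<tau>)) \<longlongrightarrow> x) at_i_infinity"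
      then obtain A where A: "A \<in> SL2Z" "finite_cusp A" "((\<lambda>\<tau>. j (moebius A \<tau>)) \<longlongrightarrow> x) at_i_infinity" by blast
      obtain s where s: "s \<in> S" "cusp_equiv N s (cusp_act A None)" using S unfolding cusp_representatives_def by blast
      have "\<not> cusp_equiv N s None"
        using A(2) cusp_equiv_trans[OF cusp_equiv_sym s(2)] unfolding finite_cusp_def by blast
      then have s': "s \<in> S'" using s(1) unfolding S'_def by simp
      obtain B where B: "B \<in> SL2Z" "cusp_act B None = s" "((\<lambda>\<tau>. j (moebius B \<tau>)) \<longlongrightarrow> cusp_value j s) at_i_infinity"
        using cusp[OF s'] by blast
      have "((\<lambda>\<tau>. j (moebius A \<tau>)) \<longlongrightarrow> cusp_value j s) at_i_infinity"
        using cusp_limit_equiv[OF A(1) B(1) _ B(3)] s(2) B(2) by simp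
      then have "x = cusp_value j s" using tendsto_unique[OF at_i_infinity_neq_bot A(3)] by blast
      then show ?thesis using s' by blast
    qed
  qed
  have "diag = Polynomial.smult (Polynomial.lead_coeff diag) (\<Prod>x | poly diag x = 0. lin x)"
    unfolding lin_def by (rule complex_poly_decompose[symmetric])
  also have "(\<Prod>x | poly diag x = 0. lin x) = (\<Prod>x\<in>T \<union> cusp_value j ` S'. lin x)"
  proof (rule prod.mono_neutral_left[OF _ roots])
    show "\<forall>x\<in>T \<union> cusp_value j ` S' - {x. poly diag x = 0}. lin x = 1"
      by (auto simp: lin_def order_0I)
  qed (use finT finS' in simp)
  also have "\<dots> = (\<Prod>x\<in>T. lin x) * (\<Prod>x\<in>cusp_value j ` S'. lin x)"
    using finT finS' disj by (intro prod.union_disjoint) auto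
  also have "Polynomial.smult (Polynomial.lead_coeff diag) \<dots> = (-1) ^ (card {d. d dvd n} div 2) * ((\<Prod>x\<in>T. lin x) * (\<Prod>x\<in>cusp_value j ` S'. lin x))"
  proof -
    have "Polynomial.smult ((-1) ^ k) p = (-1) ^ k * p" for k and p :: "complex poly"
      by (induction k) simp_all
    then show ?thesis unfolding diag_nonzero_and_lead_coeff(2) .
  qed
  finally show "diag = (-1) ^ (card {d. d dvd n} div 2) * linear_powers total_exponent *
      (\<Prod>s | s \<in> S \<and> \<not> cusp_equiv N s None. [:- cusp_value j s, 1:] ^ cusp_exponent s n N)"
    unfolding forms S'_def[symmetric] cusps by (simp only: mult.assoc)
qed

end

theorem theorem2p2:
  fixes N n :: nat and j :: "complex \<Rightarrow> complex" and S :: "cusp set"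
  assumes "N > 0" and "n > 0"
    and "has_genus (X0 N) 0"
    and "hauptmodul N j"
    and "coprime n N"
    and "\<not> (\<exists>k::nat. n = k\<^sup>2)"
    and "cusp_representatives N S"
  shows "let E = (\<Sum>r | real_of_int \<bar>r\<bar> < 2 * sqrt (real n). class_poly N j (r\<^sup>2 - 4 * int n)) in
    natural_exponents E \<and>
    diagonal (modular_poly N n j) =
      (-1) ^ (card {d. d dvd n} div 2) * linear_powers E *
      (\<Prod>s | s \<in> S \<and> \<not> cusp_equiv N s None. [:- cusp_value j s, 1:] ^ cusp_exponent s n N)"
proof -
  interpret nonsquare_hecke N j n
    by unfold_locales (use assms in auto)
  show ?thesis
    using diagonal_factorization[OF assms(7)] unfolding total_exponent_def traces_def diag_def Let_def .
qed

end
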